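(* Let $\{\phi_s\}_{s\in\mathbb R}$ be a minimal $W^{\rm u}$ flow of a codimension one $C^{1+\varepsilon}$ Anosov flow $\{f_t\}_{t\in\mathbb R}$ on a compact connected Riemannian manifold $M$, with unique invariant Borel probability measure $\mu$, uniformly expanding parametrisation $\{\widetilde\phi_s\}_{s\in\mathbb R}$ and associated function $s^*$. Suppose that (1) the flow $\{\phi_s\}_{s\in\mathbb R}$ is of class $C^1$ and $\{\widetilde\phi_s\}_{s\in\mathbb R}$ is a $C^1$ reparametrisation of $\{\phi_s\}_{s\in\mathbb R}$, with associated function $\rho\in C(M;(0,\infty))$; (2) the derivative $u_{t,s}(x):=(\partial_1\partial_2 s^* )(t,s,x)$ exists and is continuous in $s,t\in\mathbb R$ and $x\in M$; (3) the vector fields $X_f$ of $\{f_t\}$ and $X_\phi$ of $\{\phi_s\}$ are of class $C^1$, $X_f(\rho)\in C(M)$ and $\rho^{-1}X_f(\rho)\in C^1(M)$. Let $H_\phi$ be the self-adjoint generator in $L^2(M,\mu)$ of the unitary group $U^\phi_s\varphi=\varphi\circ\phi_s$. Then $H_\phi$ has purely absolutely continuous spectrum, except at $0$, where it has a simple eigenvalue with eigenspace $\mathbb C\cdot1$.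
   Context: Setting. $M$ is a compact connected Riemannian manifold with distance $d$. $\{f_t\}_{t\in\mathbb R}$ is a $C^{1+\varepsilon}$ Anosov flow on $M$ ($\varepsilon>0$): $(t,x)\mapsto f_t(x)$ is of class $C^{1+\varepsilon}$, there are no fixed points, and through each $x\in M$ pass three submanifolds $W^{\rm u}(x)=\{y\mid\lim_{t\to-\infty}d(f_t(x),f_t(y))=0\}$, $W^{\rm s}(x)=\{y\mid\lim_{t\to+\infty}d(f_t(x),f_t(y))=0\}$ and $\mathrm{Orb}(x)=\{f_t(x)\mid t\in\mathbb R\}$, whose tangent spaces $E^{\rm u}_x,E^{\rm s}_x,E_x$ vary continuously with $x$ and satisfy $T_xM=E^{\rm u}_x\oplus E^{\rm s}_x\oplus E_x$. Its vector field is $X_f$. The flow is codimension one, meaning here that $\{W^{\rm u}(x)\}_{x\in M}$ is a one-dimensional orientable continuous foliation of $M$, and this foliation defines a continuous minimal flow $\{\phi_s\}_{s\in\mathbb R}$ on $M$ whose orbits are the unstable manifolds $W^{\rm u}(x)$; such a flow is called a minimal $W^{\rm u}$ flow. It is known to be uniquely ergodic, with unique invariant Borel probability measure $\mu$. Since $f_t(W^{\rm u}(x))=W^{\rm u}(f_t(x))$, there is a function $s^*:\mathbb R\times\mathbb R\times M\to\mathbb R$ with $$(f_t\circ\phi_s)(x)=(\phi_{s^*(t,s,x)}\circ f_t)(x)\quad\text{for all }s,t\in\mathbb R,\ x\in M.$$ It is known that the foliation $\{W^{\rm u}(x)\}_{x\in M}$ admits a uniformly expanding parametrisation: a continuous flow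 $\{\widetilde\phi_s\}_{s\in\mathbb R}$, which is a continuous reparametrisation of $\{\phi_s\}$, such that $f_t\circ\widetilde\phi_s=\widetilde\phi_{\lambda^ts}\circ f_t$ for some constant $\lambda>1$ and all $s,t\in\mathbb R$. The flow $\{\widetilde\phi_s\}$ is uniquely ergodic with unique invariant probability measure $\widetilde\mu$, and $\widetilde\mu$ is invariant under $\{f_t\}$. $C^1$ reparametrisation. That $\{\widetilde\phi_s\}$ is a $C^1$ reparametrisation of $\{\phi_s\}$ means that there is $\tau\in C^1(M\times\mathbb R;\mathbb R)$ with $\phi_s(x)=\widetilde\phi_{\tau(x,s)}(x)$, $\tau(x,0)=0$, $\tau(x,\cdot)$ strictly increasing, $\tau(x,s+t)=\tau(x,s)+\tau(\phi_s(x),t)$ for all $s,t\in\mathbb R$, $x\in M$, and in particular $(\partial_2\tau)(x,0)>0$ for all $x\in M$. Under hypothesis (1), $\{\phi_s\}$ has a continuous vector field $X_\phi$; the function $\rho(x):=1/(\partial_2\tau)(x,0)$ belongs to $C(M;(0,\infty))$; $\{\widetilde\phi_s\}$ has vector field $\rho X_\phi$; and $\widetilde\mu=\mu/\widetilde\rho$ with $\widetilde\rho:=\rho\int_M\rho^{-1}\,d\mu$. $X_f(\rho)$ denotes the derivative of $\rho$ along the flow $\{f_t\}$, i.e. $X_f(\rho)(x)=\frac{d}{dt}|_{t=0}\rho(f_t(x))$. Operators. The operators $U^\phi_s\varphi=\varphi\circ\phi_s$ on $\mathcal H=L^2(M,\mu)$ form a strongly continuous unitary group with self-adjoint generator $H_\phi\varphi=\lim_{s\to0}is^{-1}(U^\phi_s-1)\varphi$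 (so $U^\phi_s=e^{-isH_\phi}$), which is essentially self-adjoint on $C^1(M)$ with $H_\phi\varphi=iX_\phi\varphi$ for $\varphi\in C^1(M)$. *)

theory Defs
  imports "HOL-Probability.Probability"
begin

section \<open>Differentiability classes on open subsets of Euclidean space\<close>

text \<open>Only used on open \<open>U\<close>. In finite dimension, continuity of the derivative in the operator
  norm is the same as continuity of all directional derivatives.\<close>

primrec Ck_on :: "nat \<Rightarrow> 'e::euclidean_space set \<Rightarrow> ('e \<Rightarrow> 'f::euclidean_space) \<Rightarrow> bool" where
  "Ck_on 0 U h \<longleftrightarrow> continuous_on U h"
| "Ck_on (Suc k) U h \<longleftrightarrow>
     (\<exists>D. (\<forall>x\<in>U. (h has_derivative D x) (at x)) \<and> (\<forall>v. Ck_on k U (\<lambda>x. D x v)))"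

definition smooth_on :: "'e::euclidean_space set \<Rightarrow> ('e \<Rightarrow> 'f::euclidean_space) \<Rightarrow> bool" where
  "smooth_on U h \<longleftrightarrow> (\<forall>k. Ck_on k U h)"

definition C1_holder_on ::
  "real \<Rightarrow> 'e::euclidean_space set \<Rightarrow> ('e \<Rightarrow> 'f::euclidean_space) \<Rightarrow> bool" where
  "C1_holder_on \<epsilon> U h \<longleftrightarrow>
     (\<exists>D. (\<forall>x\<in>U. (h has_derivative D x) (at x)) \<and>
          (\<forall>x\<in>U. \<exists>\<delta>>0. \<exists>C. \<forall>y\<in>U \<inter> ball x \<delta>. \<forall>z\<in>U \<inter> ball x \<delta>. \<forall>v.
              norm (D y v - D z v) \<le> C * dist y z powr \<epsilon> * norm v))"

section \<open>Manifolds\<close>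

text \<open>A chart is a pair (domain, coordinate map). The manifold is the whole type \<open>'a\<close>; its
  dimension is \<open>DIM('e)\<close>.\<close>

type_synonym ('a, 'e) chart = "'a set \<times> ('a \<Rightarrow> 'e)"

abbreviation chart_inv :: "('a, 'e) chart \<Rightarrow> 'e \<Rightarrow> 'a" where
  "chart_inv c \<equiv> inv_into (fst c) (snd c)"

definition topological_chart ::
  "('a::topological_space, 'e::euclidean_space) chart \<Rightarrow> bool" where
  "topological_chart c \<longleftrightarrow> open (fst c) \<and> open (snd c ` fst c) \<and>
     (\<exists>k. homeomorphism (fst c) (snd c ` fst c) (snd c) k)"

definition smooth_atlas ::
  "('a::topological_space, 'e::euclidean_space) chart set \<Rightarrow> bool" where
  "smooth_atlas A \<longleftrightarrow>
     (\<forall>c\<in>A. topological_chart c) \<and> (\<Union>c\<in>A. fst c) = UNIV \<and>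
     (\<forall>c\<in>A. \<forall>d\<in>A. smooth_on (snd c ` (fst c \<inter> fst d)) (snd d \<circ> chart_inv c))"

definition std_atlas :: "('b, 'b) chart set" where
  "std_atlas = {(UNIV, id)}"

definition prod_atlas ::
  "('a, 'e) chart set \<Rightarrow> ('b, 'f) chart set \<Rightarrow> ('a \<times> 'b, 'e \<times> 'f) chart set" where
  "prod_atlas A B = (\<lambda>(c, d). (fst c \<times> fst d, map_prod (snd c) (snd d))) ` (A \<times> B)"

text \<open>Maps whose coordinate representatives all have the regularity \<open>P\<close>.\<close>

definition regular_map ::
  "('e set \<Rightarrow> ('e \<Rightarrow> 'f) \<Rightarrow> bool) \<Rightarrow>
   ('a::topological_space, 'e) chart set \<Rightarrow> ('b::topological_space, 'f) chart set \<Rightarrow>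
   ('a \<Rightarrow> 'b) \<Rightarrow> bool" where
  "regular_map P A B h \<longleftrightarrow>
     continuous_on UNIV h \<and>
     (\<forall>c\<in>A. \<forall>d\<in>B. P (snd c ` (fst c \<inter> h -` fst d)) (snd d \<circ> h \<circ> chart_inv c))"

abbreviation C1_map ::
  "('a::topological_space, 'e::euclidean_space) chart set \<Rightarrow>
   ('b::topological_space, 'f::euclidean_space) chart set \<Rightarrow> ('a \<Rightarrow> 'b) \<Rightarrow> bool" where
  "C1_map \<equiv> regular_map (Ck_on 1)"

section \<open>Riemannian metrics\<close>

text \<open>A metric tensor is given by its coordinate expressions: \<open>g c y v w\<close> is the inner product of
  the tangent vectors with components \<open>v\<close>, \<open>w\<close> in the chart \<open>c\<close> at the point with coordinates
  \<open>y\<close>.\<close>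

type_synonym ('a, 'e) metric_tensor = "('a, 'e) chart \<Rightarrow> 'e \<Rightarrow> 'e \<Rightarrow> 'e \<Rightarrow> real"

definition riemannian_metric ::
  "('a, 'e::euclidean_space) chart set \<Rightarrow> ('a, 'e) metric_tensor \<Rightarrow> bool" where
  "riemannian_metric A g \<longleftrightarrow>
     (\<forall>c\<in>A. \<forall>y\<in>snd c ` fst c.
        bilinear (g c y) \<and> (\<forall>v w. g c y v w = g c y w v) \<and> (\<forall>v. v \<noteq> 0 \<longrightarrow> g c y v v > 0)) \<and>
     (\<forall>c\<in>A. \<forall>v w. smooth_on (snd c ` fst c) (\<lambda>y. g c y v w)) \<and>
     (\<forall>c\<in>A. \<forall>d\<in>A. \<forall>x\<in>fst c \<inter> fst d. \<forall>D.
        ((snd d \<circ> chart_inv c) has_derivative D) (at (snd c x)) \<longrightarrow>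
        (\<forall>v w. g c (snd c x) v w = g d (snd d x) (D v) (D w)))"

text \<open>\<open>\<gamma>\<close> is a piecewise \<open>C\<^sup>1\<close> curve on \<open>[0,1]\<close> (finite exceptional set \<open>K\<close>, as in
  the library's \<open>piecewise_C1_differentiable_on\<close>) of finite length \<open>l\<close>; \<open>\<sigma>\<close> is its
  speed.\<close>

definition curve_length ::
  "('a::topological_space, 'e::euclidean_space) chart set \<Rightarrow> ('a, 'e) metric_tensor \<Rightarrow>
   (real \<Rightarrow> 'a) \<Rightarrow> real \<Rightarrow> bool" where
  "curve_length A g \<gamma> l \<longleftrightarrow>
     continuous_on {0..1} \<gamma> \<and>
     (\<exists>K \<sigma>. finite K \<and>
        (\<forall>c\<in>A. (\<lambda>t. snd c (\<gamma> t)) C1_differentiable_on ({t\<in>{0..1}. \<gamma> t \<in> fst c} - K)) \<and>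
        (\<forall>t\<in>{0..1} - K. \<forall>c\<in>A. \<gamma> t \<in> fst c \<longrightarrow>
           (let v = vector_derivative (\<lambda>r. snd c (\<gamma> r)) (at t)
            in \<sigma> t = sqrt (g c (snd c (\<gamma> t)) v v))) \<and>
        (\<sigma> has_integral l) {0..1})"

text \<open>The \<open>dist\<close> of the type \<open>'a\<close> is the Riemannian distance of \<open>g\<close>.\<close>

definition compact_connected_riemannian_manifold ::
  "('a::metric_space, 'e::euclidean_space) chart set \<Rightarrow> ('a, 'e) metric_tensor \<Rightarrow> bool" where
  "compact_connected_riemannian_manifold A g \<longleftrightarrow>
     compact (UNIV :: 'a set) \<and> connected (UNIV :: 'a set) \<and>
     smooth_atlas A \<and> riemannian_metric A g \<and>
     (\<forall>x y :: 'a. dist x y = Inf {l. \<exists>\<gamma>. \<gamma> 0 = x \<and> \<gamma> 1 = y \<and> curve_length A g \<gamma> l})"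

section \<open>Immersed submanifolds and distributions\<close>

text \<open>Subspaces of tangent spaces, given by their components in each chart.\<close>

type_synonym ('a, 'e) distribution = "('a, 'e) chart \<Rightarrow> 'a \<Rightarrow> 'e set"

text \<open>\<open>W\<close> is a (second countable, injectively) immersed \<open>C\<^sup>1\<close> submanifold with tangent spaces
  \<open>T c x\<close> for \<open>x \<in> W\<close>. \<open>P\<close> is a countable family of parametrisations by open subsets of a linear
  subspace \<open>S\<close> of the model space; they are the inverses of the charts of \<open>W\<close>, whose intrinsic
  topology may be finer than the subspace topology. Transition maps are only required to be
  homeomorphisms between open sets: as the parametrisations are \<open>C\<^sup>1\<close> immersions,
  transitions are then automatically \<open>C\<^sup>1\<close>.\<close>

definition immersed_submanifold ::
  "('a::topological_space, 'e::euclidean_space) chart set \<Rightarrow> 'a set \<Rightarrow>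
   ('a, 'e) distribution \<Rightarrow> bool" where
  "immersed_submanifold A W T \<longleftrightarrow>
     (\<exists>(S :: 'e set) P. subspace S \<and> countable P \<and> W = (\<Union>(V, \<psi>)\<in>P. \<psi> ` V) \<and>
        (\<forall>(V, \<psi>)\<in>P. openin (top_of_set S) V \<and> continuous_on V \<psi> \<and> inj_on \<psi> V) \<and>
        (\<forall>(V, \<psi>)\<in>P. \<forall>(V', \<psi>')\<in>P.
           openin (top_of_set S) {y\<in>V. \<psi> y \<in> \<psi>' ` V'} \<and>
           continuous_on {y\<in>V. \<psi> y \<in> \<psi>' ` V'} (inv_into V' \<psi>' \<circ> \<psi>)) \<and>
        (\<forall>(V, \<psi>)\<in>P. \<forall>c\<in>A. \<exists>D.
           (\<forall>y\<in>V. \<psi> y \<in> fst c \<longrightarrow>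
              ((snd c \<circ> \<psi>) has_derivative D y) (at y within V) \<and>
              inj_on (D y) S \<and> T c (\<psi> y) = D y ` S) \<and>
           (\<forall>v\<in>S. continuous_on {y\<in>V. \<psi> y \<in> fst c} (\<lambda>y. D y v))))"

text \<open>Continuity with values in the Grassmannian: the orthogonal projections onto the subspaces
  (in coordinates) depend continuously on the point.\<close>

definition continuous_distribution ::
  "('a::topological_space, 'e::euclidean_space) chart set \<Rightarrow> ('a, 'e) distribution \<Rightarrow> bool" where
  "continuous_distribution A T \<longleftrightarrow>
     (\<forall>c\<in>A. (\<forall>x\<in>fst c. subspace (T c x)) \<and>
            (\<forall>v. continuous_on (fst c) (\<lambda>x. closest_point (T c x) v)))"

section \<open>Flows\<close>

definition is_flow :: "(real \<Rightarrow> 'a \<Rightarrow> 'a) \<Rightarrow> bool" where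
  "is_flow f \<longleftrightarrow> (\<forall>x. f 0 x = x) \<and> (\<forall>s t x. f (s + t) x = f s (f t x))"

definition continuous_flow :: "(real \<Rightarrow> 'a::topological_space \<Rightarrow> 'a) \<Rightarrow> bool" where
  "continuous_flow f \<longleftrightarrow> is_flow f \<and> continuous_on UNIV (\<lambda>(t, x). f t x)"

definition C1_flow ::
  "('a::topological_space, 'e::euclidean_space) chart set \<Rightarrow> (real \<Rightarrow> 'a \<Rightarrow> 'a) \<Rightarrow> bool" where
  "C1_flow A f \<longleftrightarrow> is_flow f \<and> C1_map (prod_atlas std_atlas A) A (\<lambda>(t, x). f t x)"

definition orbit :: "(real \<Rightarrow> 'a \<Rightarrow> 'a) \<Rightarrow> 'a \<Rightarrow> 'a set" where
  "orbit f x = range (\<lambda>t. f t x)"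

definition minimal_flow :: "(real \<Rightarrow> 'a::topological_space \<Rightarrow> 'a) \<Rightarrow> bool" where
  "minimal_flow f \<longleftrightarrow> (\<forall>x. closure (orbit f x) = UNIV)"

text \<open>\<open>X c x\<close> are the components in the chart \<open>c\<close> of the vector field of the flow \<open>f\<close> at
  \<open>x\<close>.\<close>

definition vector_field_of ::
  "('a, 'e::euclidean_space) chart set \<Rightarrow> (real \<Rightarrow> 'a \<Rightarrow> 'a) \<Rightarrow>
   (('a, 'e) chart \<Rightarrow> 'a \<Rightarrow> 'e) \<Rightarrow> bool" where
  "vector_field_of A f X \<longleftrightarrow>
     (\<forall>c\<in>A. \<forall>x\<in>fst c. ((\<lambda>t. snd c (f t x)) has_vector_derivative X c x) (at 0))"

definition C1_vector_field ::
  "('a, 'e::euclidean_space) chart set \<Rightarrow> (('a, 'e) chart \<Rightarrow> 'a \<Rightarrow> 'e) \<Rightarrow> bool" where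
  "C1_vector_field A X \<longleftrightarrow> (\<forall>c\<in>A. Ck_on 1 (snd c ` fst c) (\<lambda>y. X c (chart_inv c y)))"

section \<open>Codimension one Anosov flows\<close>

definition unstable_manifold :: "(real \<Rightarrow> 'a::metric_space \<Rightarrow> 'a) \<Rightarrow> 'a \<Rightarrow> 'a set" where
  "unstable_manifold f x = {y. ((\<lambda>t. dist (f t x) (f t y)) \<longlongrightarrow> 0) at_bot}"

definition stable_manifold :: "(real \<Rightarrow> 'a::metric_space \<Rightarrow> 'a) \<Rightarrow> 'a \<Rightarrow> 'a set" where
  "stable_manifold f x = {y. ((\<lambda>t. dist (f t x) (f t y)) \<longlongrightarrow> 0) at_top}"

definition anosov_flow ::
  "('a::metric_space, 'e::euclidean_space) chart set \<Rightarrow> real \<Rightarrow> (real \<Rightarrow> 'a \<Rightarrow> 'a) \<Rightarrow> bool" where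
  "anosov_flow A \<epsilon> f \<longleftrightarrow>
     is_flow f \<and>
     regular_map (C1_holder_on \<epsilon>) (prod_atlas std_atlas A) A (\<lambda>(t, x). f t x) \<and>
     (\<forall>x. \<exists>t. f t x \<noteq> x) \<and>
     (\<exists>Eu Es E0.
        (\<forall>x. immersed_submanifold A (unstable_manifold f x) Eu \<and>
             immersed_submanifold A (stable_manifold f x) Es \<and>
             immersed_submanifold A (orbit f x) E0) \<and>
        continuous_distribution A Eu \<and> continuous_distribution A Es \<and>
        continuous_distribution A E0 \<and>
        (\<forall>c\<in>A. \<forall>x\<in>fst c. \<forall>v. \<exists>!(a, b, d). a \<in> Eu c x \<and> b \<in> Es c x \<and> d \<in> E0 c x \<and> v = a + b + d))"

text \<open>\<open>L x\<close> is the leaf through \<open>x\<close> of a one-dimensional orientable \<open>C\<^sup>0\<close> foliation of a manifold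
  modelled on \<open>'e\<close>. In the foliated charts, the leaf coordinate of \<open>z\<close> is \<open>z \<bullet> b\<close> and the
  transverse coordinates are \<open>z - (z \<bullet> b) *\<^sub>R b\<close>; the components of a leaf in a chart domain
  are the plaques. The last clause says that coordinate changes preserve the orientation of the
  plaques.\<close>

definition orientable_foliation_dim1 ::
  "'e::euclidean_space itself \<Rightarrow> ('a::topological_space \<Rightarrow> 'a set) \<Rightarrow> bool" where
  "orientable_foliation_dim1 _ L \<longleftrightarrow>
     (\<forall>x. x \<in> L x \<and> path_connected (L x)) \<and> (\<forall>x. \<forall>y\<in>L x. L y = L x) \<and>
     (\<exists>b\<in>(Basis :: 'e set). \<exists>F :: ('a, 'e) chart set.
        let tr = (\<lambda>z. z - (z \<bullet> b) *\<^sub>R b) in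
        (\<Union>c\<in>F. fst c) = UNIV \<and>
        (\<forall>c\<in>F. topological_chart c \<and> convex (snd c ` fst c) \<and>
           (\<forall>x\<in>fst c. connected_component_set (fst c \<inter> L x) x =
              {y\<in>fst c. tr (snd c y) = tr (snd c x)})) \<and>
        (\<forall>c\<in>F. \<forall>d\<in>F. \<forall>x\<in>fst c \<inter> fst d. \<exists>W. open W \<and> x \<in> W \<and> W \<subseteq> fst c \<inter> fst d \<and>
           (\<forall>y\<in>W. \<forall>z\<in>W. tr (snd c y) = tr (snd c z) \<longrightarrow>
              (snd c y \<bullet> b < snd c z \<bullet> b \<longleftrightarrow> snd d y \<bullet> b < snd d z \<bullet> b))))"

definition codimension_one_anosov_flow ::
  "('a::metric_space, 'e::euclidean_space) chart set \<Rightarrow> real \<Rightarrow> (real \<Rightarrow> 'a \<Rightarrow> 'a) \<Rightarrow> bool" where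
  "codimension_one_anosov_flow A \<epsilon> f \<longleftrightarrow>
     anosov_flow A \<epsilon> f \<and> orientable_foliation_dim1 TYPE('e) (unstable_manifold f)"

definition minimal_Wu_flow ::
  "(real \<Rightarrow> 'a::metric_space \<Rightarrow> 'a) \<Rightarrow> (real \<Rightarrow> 'a \<Rightarrow> 'a) \<Rightarrow> bool" where
  "minimal_Wu_flow f \<phi> \<longleftrightarrow>
     continuous_flow \<phi> \<and> minimal_flow \<phi> \<and> (\<forall>x. orbit \<phi> x = unstable_manifold f x)"

section \<open>Reparametrisations\<close>

definition reparametrisation ::
  "(real \<Rightarrow> 'a \<Rightarrow> 'a) \<Rightarrow> (real \<Rightarrow> 'a \<Rightarrow> 'a) \<Rightarrow> ('a \<Rightarrow> real \<Rightarrow> real) \<Rightarrow> bool" where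
  "reparametrisation \<phi> \<phi>' \<tau> \<longleftrightarrow>
     (\<forall>x s. \<phi> s x = \<phi>' (\<tau> x s) x) \<and> (\<forall>x. \<tau> x 0 = 0) \<and> (\<forall>x. strict_mono (\<tau> x)) \<and>
     (\<forall>x s t. \<tau> x (s + t) = \<tau> x s + \<tau> (\<phi> s x) t)"

definition C1_reparametrisation ::
  "('a::topological_space, 'e::euclidean_space) chart set \<Rightarrow>
   (real \<Rightarrow> 'a \<Rightarrow> 'a) \<Rightarrow> (real \<Rightarrow> 'a \<Rightarrow> 'a) \<Rightarrow> ('a \<Rightarrow> real \<Rightarrow> real) \<Rightarrow> bool" where
  "C1_reparametrisation A \<phi> \<phi>' \<tau> \<longleftrightarrow>
     reparametrisation \<phi> \<phi>' \<tau> \<and>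
     C1_map (prod_atlas A std_atlas) std_atlas (\<lambda>(x, s). \<tau> x s) \<and>
     (\<forall>x. deriv (\<tau> x) 0 > 0)"

definition uniformly_expanding_parametrisation ::
  "(real \<Rightarrow> 'a::topological_space \<Rightarrow> 'a) \<Rightarrow> (real \<Rightarrow> 'a \<Rightarrow> 'a) \<Rightarrow> (real \<Rightarrow> 'a \<Rightarrow> 'a) \<Rightarrow> bool" where
  "uniformly_expanding_parametrisation f \<phi> \<phi>' \<longleftrightarrow>
     continuous_flow \<phi>' \<and>
     (\<exists>\<tau>. continuous_on UNIV (\<lambda>(x, s). \<tau> x s) \<and> reparametrisation \<phi> \<phi>' \<tau>) \<and>
     (\<exists>l>1. \<forall>s t x. f t (\<phi>' s x) = \<phi>' (l powr t * s) (f t x))"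

section \<open>Invariant measures\<close>

definition invariant_probability ::
  "(real \<Rightarrow> 'a::topological_space \<Rightarrow> 'a) \<Rightarrow> 'a measure \<Rightarrow> bool" where
  "invariant_probability \<phi> \<mu> \<longleftrightarrow>
     prob_space \<mu> \<and> sets \<mu> = sets borel \<and> (\<forall>s. distr \<mu> borel (\<phi> s) = \<mu>)"

definition unique_invariant_probability ::
  "(real \<Rightarrow> 'a::topological_space \<Rightarrow> 'a) \<Rightarrow> 'a measure \<Rightarrow> bool" where
  "unique_invariant_probability \<phi> \<mu> \<longleftrightarrow>
     invariant_probability \<phi> \<mu> \<and> (\<forall>\<nu>. invariant_probability \<phi> \<nu> \<longrightarrow> \<nu> = \<mu>)"

section \<open>Operators in \<open>L\<^sup>2\<close> and their spectral measures\<close>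

text \<open>Elements of \<open>L\<^sup>2\<close> are represented by functions; equality in \<open>L\<^sup>2\<close> is equality almost
  everywhere.\<close>

definition L2 :: "'a measure \<Rightarrow> ('a \<Rightarrow> complex) set" where
  "L2 M = {h \<in> borel_measurable M. integrable M (\<lambda>x. (cmod (h x))\<^sup>2)}"

definition l2_inner :: "'a measure \<Rightarrow> ('a \<Rightarrow> complex) \<Rightarrow> ('a \<Rightarrow> complex) \<Rightarrow> complex" where
  "l2_inner M h k = (LINT x|M. cnj (h x) * k x)"

definition l2_norm :: "'a measure \<Rightarrow> ('a \<Rightarrow> complex) \<Rightarrow> real" where
  "l2_norm M h = sqrt (LINT x|M. (cmod (h x))\<^sup>2)"

text \<open>Unbounded operators are given by their graphs.\<close>

type_synonym 'a l2_operator = "(('a \<Rightarrow> complex) \<times> ('a \<Rightarrow> complex)) set"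

text \<open>The self-adjoint generator \<open>H\<close> of the unitary group \<open>U\<^sub>s \<psi> = \<psi> \<circ> \<phi>\<^sub>s\<close>,
  with the convention \<open>U\<^sub>s = exp (- \<i> s H)\<close>, on its full domain (all \<open>\<psi>\<close> for which the limit
  exists in \<open>L\<^sup>2\<close>).\<close>

definition koopman_generator :: "'a measure \<Rightarrow> (real \<Rightarrow> 'a \<Rightarrow> 'a) \<Rightarrow> 'a l2_operator" where
  "koopman_generator M \<phi> =
     {(\<psi>, \<eta>). \<psi> \<in> L2 M \<and> \<eta> \<in> L2 M \<and>
        ((\<lambda>s. l2_norm M (\<lambda>x. \<i> / complex_of_real s * (\<psi> (\<phi> s x) - \<psi> x) - \<eta> x)) \<longlongrightarrow> 0) (at 0)}"

definition projection_valued_measure ::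
  "'a measure \<Rightarrow> (real set \<Rightarrow> ('a \<Rightarrow> complex) \<Rightarrow> ('a \<Rightarrow> complex)) \<Rightarrow> bool" where
  "projection_valued_measure M E \<longleftrightarrow>
     \<comment> \<open>each \<open>E B\<close> is a linear operator on \<open>L\<^sup>2\<close>, well defined modulo null sets\<close>
     (\<forall>B\<in>sets borel. \<forall>h\<in>L2 M. E B h \<in> L2 M) \<and>
     (\<forall>B\<in>sets borel. \<forall>h\<in>L2 M. \<forall>k\<in>L2 M.
        (AE x in M. h x = k x) \<longrightarrow> (AE x in M. E B h x = E B k x)) \<and>
     (\<forall>B\<in>sets borel. \<forall>h\<in>L2 M. \<forall>k\<in>L2 M. \<forall>a b.
        AE x in M. E B (\<lambda>x. a * h x + b * k x) x = a * E B h x + b * E B k x) \<and>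
     \<comment> \<open>orthogonal projections (idempotence: \<open>B = C\<close> in the second clause below)\<close>
     (\<forall>B\<in>sets borel. \<forall>h\<in>L2 M. \<forall>k\<in>L2 M. l2_inner M h (E B k) = l2_inner M (E B h) k) \<and>
     (\<forall>B\<in>sets borel. \<forall>C\<in>sets borel. \<forall>h\<in>L2 M. AE x in M. E (B \<inter> C) h x = E B (E C h) x) \<and>
     (\<forall>h\<in>L2 M. AE x in M. E UNIV h x = h x) \<and>
     \<comment> \<open>strong countable additivity\<close>
     (\<forall>B :: nat \<Rightarrow> real set. range B \<subseteq> sets borel \<longrightarrow> disjoint_family B \<longrightarrow>
        (\<forall>h\<in>L2 M.
          (\<lambda>n. l2_norm M (\<lambda>x. (\<Sum>i<n. E (B i) h x) - E (\<Union>i. B i) h x)) \<longlonglongrightarrow> 0))"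

text \<open>The measure \<open>B \<mapsto> \<langle>h, E(B) h\<rangle>\<close> on the line.\<close>

definition scalar_spectral_measure ::
  "'a measure \<Rightarrow> (real set \<Rightarrow> ('a \<Rightarrow> complex) \<Rightarrow> ('a \<Rightarrow> complex)) \<Rightarrow> ('a \<Rightarrow> complex) \<Rightarrow>
   real measure" where
  "scalar_spectral_measure M E h =
     measure_of UNIV (sets borel) (\<lambda>B. ennreal (Re (l2_inner M h (E B h))))"

text \<open>\<open>H = \<integral> \<lambda> dE(\<lambda>)\<close>: the domain of \<open>H\<close> consists of the \<open>h\<close> with
  \<open>\<integral> \<lambda>\<^sup>2 d\<langle>h, E(\<lambda>) h\<rangle> < \<infinity>\<close>, and \<open>\<langle>h, H h\<rangle> = \<integral> \<lambda> d\<langle>h, E(\<lambda>) h\<rangle>\<close> there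
  (by polarisation this determines \<open>H\<close>).\<close>

definition spectral_resolution ::
  "'a measure \<Rightarrow> 'a l2_operator \<Rightarrow> (real set \<Rightarrow> ('a \<Rightarrow> complex) \<Rightarrow> ('a \<Rightarrow> complex)) \<Rightarrow> bool" where
  "spectral_resolution M H E \<longleftrightarrow>
     projection_valued_measure M E \<and>
     (\<forall>h\<in>L2 M. h \<in> Domain H \<longleftrightarrow> integrable (scalar_spectral_measure M E h) (\<lambda>t. t\<^sup>2)) \<and>
     (\<forall>(h, k)\<in>H.
        l2_inner M h k = complex_of_real (LINT t|scalar_spectral_measure M E h. t))"

text \<open>For self-adjoint \<open>H\<close>, which by the spectral theorem has exactly one spectral resolution \<open>E\<close>
  (up to equality almost everywhere): on the Borel set \<open>J\<close>, all the measures \<open>\<langle>h, E(\<cdot>) h\<rangle>\<close>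
  are absolutely continuous with respect to Lebesgue measure.\<close>

definition purely_ac_spectrum_on :: "'a measure \<Rightarrow> 'a l2_operator \<Rightarrow> real set \<Rightarrow> bool" where
  "purely_ac_spectrum_on M H J \<longleftrightarrow>
     (\<forall>E. spectral_resolution M H E \<longrightarrow>
        (\<forall>h\<in>L2 M. absolutely_continuous lborel
           (density (scalar_spectral_measure M E h) (indicator J))))"

definition eigenspace :: "'a measure \<Rightarrow> 'a l2_operator \<Rightarrow> complex \<Rightarrow> ('a \<Rightarrow> complex) set" where
  "eigenspace M H z = {\<psi> \<in> L2 M. (\<psi>, \<lambda>x. z * \<psi> x) \<in> H}"

end

(*
Write X, V for the derivations along f and \<phi>, and a > 0 for the expansion rate of \<phi>'. The relation
f\<^sub>t \<phi>'\<^sub>s = \<phi>'\<^sub>(exp (a t) s) f\<^sub>t yields X (g \<circ> \<phi>\<^sub>s) = (X g) \<circ> \<phi>\<^sub>s - J\<^sub>s (V g) \<circ> \<phi>\<^sub>s, where J\<^sub>s is the integral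
over [0, s] of G \<circ> \<phi>\<^sub>q and G = a + X \<rho> / \<rho>. The measure \<mu> / \<rho>, normalised, is invariant under f,
so G has mean a > 0, and unique ergodicity makes J\<^sub>s grow linearly, uniformly in the base point; integration by
parts shows that X J\<^sub>s grows at most linearly too. For k = V g with g regular, solving the relation for
k \<circ> \<phi>\<^sub>s and integrating by parts along f gives \<langle>k, U\<^sub>s k\<rangle> = O(1/s). This correlation is the Fourier
transform of t\<^sup>2 d\<langle>g, E(t) g\<rangle>; being square integrable, it forces that measure to be absolutely
continuous, and such g are dense. The eigenspace at 0 is trivial because a nonconstant invariant function would
be the density of a second invariant measure.
*)

theory Submission
  imports Defs
begin

section \<open>The space of square-integrable functions\<close>

text \<open>The spectral claim concerns every \<open>E\<close> that reproduces the domain of the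
  generator \<open>H\<close> and its diagonal values \<open><h, H h>\<close>. To read correlations
  as Fourier transforms, \<open><h, U_s h> = \<integral> exp (- i s t) d<h, E(t) h>\<close> must
  first be derived from these data: polarisation shows that \<open>H\<close> respects spectral
  subspaces, a form bound over a short interval becomes a norm bound, and summing over short
  intervals gives the identity. The lower bound for \<open>J\<close> must be uniform in the base
  point: orbit segments violating it would accumulate at an invariant measure giving
  \<open>G\<close> a nonpositive mean. Integration by parts moves the derivative along
  \<open>f\<close> onto \<open>\<rho> V g\<close> and onto \<open>1 / J\<close>, so
  \<open>g\<close>, \<open>\<rho> V g\<close> and \<open>J\<close> must all be differentiable along
  \<open>f\<close>. Test functions are therefore averaged along \<open>\<phi>'\<close> rather than
  \<open>\<phi>\<close>: \<open>f\<close> rescales the time of \<open>\<phi>'\<close> by a constant,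
  so averaging along \<open>\<phi>'\<close> preserves differentiability along \<open>f\<close>. The
  decay controls only \<open>t^2 d<g, E(t) g>\<close>; removing the factor \<open>t^2\<close> is
  possible exactly away from 0.\<close>

lemma le_mult_of_weighted_am_gm:
  fixes P A B :: real
  assumes nonneg: "A \<ge> 0" "B \<ge> 0" and bound: "\<And>c. c > 0 \<Longrightarrow> 2 * P \<le> c * A\<^sup>2 + B\<^sup>2 / c"
  shows "P \<le> A * B"
proof (cases "A = 0 \<or> B = 0")
  case False
  then have "A > 0" "B > 0" using nonneg by auto
  \<comment> \<open>\<open>c = B / A\<close> minimises the right-hand side and makes each of its two
    terms equal to \<open>A * B\<close>.\<close>
  then have "2 * P \<le> (B / A) * A\<^sup>2 + B\<^sup>2 / (B / A)" using bound[of "B / A"] by simp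
  also have "\<dots> = 2 * (A * B)" using \<open>A > 0\<close> \<open>B > 0\<close> by (simp add: power2_eq_square field_simps)
  finally show ?thesis by simp
next
  case True
  have "P \<le> 0"
  proof (rule ccontr)
    assume "\<not> P \<le> 0"
    then have "P > 0" by simp
    show False
    proof (cases "A = 0")
      case True
      \<comment> \<open>No optimal \<open>c\<close> exists when \<open>A = 0\<close>. This one is
        large enough to push the right-hand side below \<open>P\<close>; the summand 1 keeps it
        positive when \<open>B = 0\<close>.\<close>
      have "2 * P \<le> B\<^sup>2 / ((B\<^sup>2 + 1) / P)" using bound[of "(B\<^sup>2 + 1) / P"] \<open>P > 0\<close> True
        by (auto simp: add_nonneg_pos)
      also have "\<dots> \<le> P" using \<open>P > 0\<close> by (simp add: divide_le_eq add_nonneg_pos)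
      finally show False using \<open>P > 0\<close> by simp
    next
      case False
      then have "B = 0" using \<open>A = 0 \<or> B = 0\<close> by simp
      have "2 * P \<le> P / (A\<^sup>2 + 1) * A\<^sup>2" using bound[of "P / (A\<^sup>2 + 1)"] \<open>P > 0\<close> \<open>B = 0\<close>
        by (auto simp: add_nonneg_pos)
      also have "\<dots> \<le> P" using \<open>P > 0\<close> by (simp add: divide_le_eq add_nonneg_pos)
      finally show False using \<open>P > 0\<close> by simp
    qed
  qed
  then show ?thesis using True by auto
qed

lemma borel_measurable_cnj [measurable (raw)]:
  assumes "h \<in> borel_measurable M"
  shows "(\<lambda>x. cnj (h x)) \<in> borel_measurable M"
  by (rule borel_measurable_continuous_on[OF _ assms]) (intro continuous_intros)

lemma L2_measurable [measurable_dest]: "h \<in> L2 M \<Longrightarrow> h \<in> borel_measurable M"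
  by (simp add: L2_def)

lemma L2_integrable_norm_mult:
  assumes "h \<in> L2 M" "k \<in> L2 M"
  shows "integrable M (\<lambda>x. cmod (h x) * cmod (k x))"
proof (rule Bochner_Integration.integrable_bound)
  show "integrable M (\<lambda>x. (cmod (h x))\<^sup>2 + (cmod (k x))\<^sup>2)"
    using assms by (simp add: L2_def)
  have [measurable]: "h \<in> borel_measurable M" "k \<in> borel_measurable M" using assms by (auto simp: L2_def)
  show "(\<lambda>x. cmod (h x) * cmod (k x)) \<in> borel_measurable M" by measurable
  show "AE x in M. norm (cmod (h x) * cmod (k x)) \<le> norm ((cmod (h x))\<^sup>2 + (cmod (k x))\<^sup>2)"
  proof (rule AE_I2)
    fix x
    have "2 * cmod (h x) * cmod (k x) \<le> (cmod (h x))\<^sup>2 + (cmod (k x))\<^sup>2" by (rule sum_squares_bound)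
    moreover have "0 \<le> cmod (h x) * cmod (k x)" by simp
    ultimately show "norm (cmod (h x) * cmod (k x)) \<le> norm ((cmod (h x))\<^sup>2 + (cmod (k x))\<^sup>2)"
      unfolding real_norm_def by linarith
  qed
qed

lemma L2_integrable_mult:
  assumes "h \<in> L2 M" "k \<in> L2 M"
  shows "integrable M (\<lambda>x. cnj (h x) * k x)"
proof (rule Bochner_Integration.integrable_bound[OF L2_integrable_norm_mult[OF assms]])
  have [measurable]: "h \<in> borel_measurable M" "k \<in> borel_measurable M" using assms by (auto simp: L2_def)
  show "(\<lambda>x. cnj (h x) * k x) \<in> borel_measurable M" by measurable
qed (simp add: norm_mult)

lemma L2_lincomb:
  assumes "h \<in> L2 M" "k \<in> L2 M"
  shows "(\<lambda>x. a * h x + b * k x) \<in> L2 M"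
proof -
  have [measurable]: "h \<in> borel_measurable M" "k \<in> borel_measurable M" using assms by (auto simp: L2_def)
  have "integrable M (\<lambda>x. (cmod (a * h x + b * k x))\<^sup>2)"
  proof (rule Bochner_Integration.integrable_bound)
    show "integrable M (\<lambda>x. 2 * (cmod a)\<^sup>2 * (cmod (h x))\<^sup>2 + 2 * (cmod b)\<^sup>2 * (cmod (k x))\<^sup>2)"
      using assms by (simp add: L2_def)
    show "AE x in M. norm ((cmod (a * h x + b * k x))\<^sup>2)
       \<le> norm (2 * (cmod a)\<^sup>2 * (cmod (h x))\<^sup>2 + 2 * (cmod b)\<^sup>2 * (cmod (k x))\<^sup>2)"
    proof (rule AE_I2)
      fix x
      have "(cmod (a * h x + b * k x))\<^sup>2 \<le> (cmod (a * h x) + cmod (b * k x))\<^sup>2"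
        by (intro power_mono norm_triangle_ineq) simp
      also have "\<dots> \<le> 2 * (cmod (a * h x))\<^sup>2 + 2 * (cmod (b * k x))\<^sup>2"
        using sum_squares_bound[of "cmod (a * h x)" "cmod (b * k x)"] by (simp add: power2_sum)
      finally show "norm ((cmod (a * h x + b * k x))\<^sup>2)
       \<le> norm (2 * (cmod a)\<^sup>2 * (cmod (h x))\<^sup>2 + 2 * (cmod b)\<^sup>2 * (cmod (k x))\<^sup>2)"
        by (simp add: norm_mult power_mult_distrib)
    qed
  qed measurable
  then show ?thesis by (simp add: L2_def)
qed

lemma L2_diff: "h \<in> L2 M \<Longrightarrow> k \<in> L2 M \<Longrightarrow> (\<lambda>x. h x - k x) \<in> L2 M"
  using L2_lincomb[of h M k 1 "-1"] by simp

lemma L2_add: "h \<in> L2 M \<Longrightarrow> k \<in> L2 M \<Longrightarrow> (\<lambda>x. h x + k x) \<in> L2 M"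
  using L2_lincomb[of h M k 1 1] by simp

lemma L2_scale: "h \<in> L2 M \<Longrightarrow> (\<lambda>x. a * h x) \<in> L2 M"
  using L2_lincomb[of h M h a 0] by simp

lemma L2_bounded:
  assumes "finite_measure M" "h \<in> borel_measurable M" "\<And>x. cmod (h x) \<le> C"
  shows "h \<in> L2 M"
proof -
  interpret finite_measure M by fact
  have "integrable M (\<lambda>x. (cmod (h x))\<^sup>2)"
    by (rule integrable_const_bound[where B = "C\<^sup>2"]) (use assms in \<open>auto intro!: power_mono\<close>)
  then show ?thesis using assms by (simp add: L2_def)
qed

lemma l2_norm_nonneg: "l2_norm M h \<ge> 0"
  by (simp add: l2_norm_def)

lemma l2_norm_square: "(l2_norm M h)\<^sup>2 = (LINT x|M. (cmod (h x))\<^sup>2)"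
  by (simp add: l2_norm_def)

lemma l2_inner_self: "l2_inner M h h = complex_of_real ((l2_norm M h)\<^sup>2)"
proof -
  have "cnj (h x) * h x = complex_of_real ((cmod (h x))\<^sup>2)" for x
    by (metis complex_norm_square mult.commute)
  then show ?thesis unfolding l2_inner_def l2_norm_square by (simp only: integral_complex_of_real)
qed

lemma l2_norm_le_bound:
  assumes "prob_space M" "h \<in> borel_measurable M" "\<And>x. cmod (h x) \<le> C" "C \<ge> 0"
  shows "l2_norm M h \<le> C"
proof -
  interpret prob_space M by fact
  have "(LINT x|M. (cmod (h x))\<^sup>2) \<le> (LINT x|M. C\<^sup>2)"
    by (rule integral_mono)
      (use L2_bounded[of M h C] assms finite_measure_axioms in \<open>auto simp: L2_def intro!: power_mono\<close>)
  then have "(l2_norm M h)\<^sup>2 \<le> C\<^sup>2" by (simp add: l2_norm_square prob_space)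
  then show ?thesis using assms(4) by (rule power2_le_imp_le)
qed

text \<open>The weighted inequality between arithmetic and geometric mean, integrated for every
  weight \<open>c\<close>, is the hypothesis of \<open>le_mult_of_weighted_am_gm\<close>; this way
  vanishing norms need no separate treatment.\<close>

lemma l2_cauchy_schwarz_norm:
  assumes "h \<in> L2 M" "k \<in> L2 M"
  shows "(LINT x|M. cmod (h x) * cmod (k x)) \<le> l2_norm M h * l2_norm M k"
proof (rule le_mult_of_weighted_am_gm[OF l2_norm_nonneg l2_norm_nonneg])
  fix c :: real assume c: "c > 0"
  have "2 * (LINT x|M. cmod (h x) * cmod (k x)) = (LINT x|M. 2 * (cmod (h x) * cmod (k x)))" by simp
  also have "\<dots> \<le> (LINT x|M. c * (cmod (h x))\<^sup>2 + (cmod (k x))\<^sup>2 / c)"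
  proof (rule integral_mono)
    show "integrable M (\<lambda>x. 2 * (cmod (h x) * cmod (k x)))"
      using L2_integrable_norm_mult[OF assms] by simp
    show "integrable M (\<lambda>x. c * (cmod (h x))\<^sup>2 + (cmod (k x))\<^sup>2 / c)"
      using assms by (simp add: L2_def)
    fix x
    have "0 \<le> (sqrt c * cmod (h x) - cmod (k x) / sqrt c)\<^sup>2" by simp
    also have "\<dots> = c * (cmod (h x))\<^sup>2 + (cmod (k x))\<^sup>2 / c - 2 * (cmod (h x) * cmod (k x))"
      using c by (simp add: power2_diff power_mult_distrib power_divide)
    finally show "2 * (cmod (h x) * cmod (k x)) \<le> c * (cmod (h x))\<^sup>2 + (cmod (k x))\<^sup>2 / c" by simp
  qed
  also have "\<dots> = c * (l2_norm M h)\<^sup>2 + (l2_norm M k)\<^sup>2 / c"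
    using assms by (simp add: L2_def l2_norm_square)
  finally show "2 * (LINT x|M. cmod (h x) * cmod (k x)) \<le> c * (l2_norm M h)\<^sup>2 + (l2_norm M k)\<^sup>2 / c" .
qed

lemma l2_cauchy_schwarz:
  assumes "h \<in> L2 M" "k \<in> L2 M"
  shows "cmod (l2_inner M h k) \<le> l2_norm M h * l2_norm M k"
proof -
  have "cmod (l2_inner M h k) \<le> (LINT x|M. cmod (cnj (h x) * k x))"
    unfolding l2_inner_def by (rule integral_norm_bound)
  also have "\<dots> \<le> l2_norm M h * l2_norm M k"
    using l2_cauchy_schwarz_norm[OF assms] by (simp add: norm_mult)
  finally show ?thesis .
qed

lemma l2_inner_cnj: "l2_inner M k h = cnj (l2_inner M h k)"
proof -
  have "(\<lambda>x. cnj (cnj (h x) * k x)) = (\<lambda>x. cnj (k x) * h x)" by (simp add: fun_eq_iff mult.commute)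
  then show ?thesis unfolding l2_inner_def using Bochner_Integration.integral_cnj[of M "\<lambda>x. cnj (h x) * k x"] by simp
qed

lemma l2_inner_lincomb_right:
  assumes "v \<in> L2 M" "h \<in> L2 M" "k \<in> L2 M"
  shows "l2_inner M v (\<lambda>x. a * h x + b * k x) = a * l2_inner M v h + b * l2_inner M v k"
proof -
  have "l2_inner M v (\<lambda>x. a * h x + b * k x)
      = (LINT x|M. a * (cnj (v x) * h x) + b * (cnj (v x) * k x))"
    unfolding l2_inner_def by (simp add: algebra_simps)
  also have "\<dots> = a * l2_inner M v h + b * l2_inner M v k"
    using L2_integrable_mult[OF assms(1,2)] L2_integrable_mult[OF assms(1,3)]
    by (simp add: l2_inner_def)
  finally show ?thesis .
qed

lemma l2_inner_lincomb_left:
  assumes "v \<in> L2 M" "h \<in> L2 M" "k \<in> L2 M"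
  shows "l2_inner M (\<lambda>x. a * h x + b * k x) v = cnj a * l2_inner M h v + cnj b * l2_inner M k v"
  using l2_inner_lincomb_right[OF assms, of a b] l2_inner_cnj[of M _ v]
  by (metis complex_cnj_add complex_cnj_mult)

lemma l2_inner_cong_AE:
  assumes "AE x in M. h x = h' x" "AE x in M. k x = k' x"
    "h \<in> L2 M" "h' \<in> L2 M" "k \<in> L2 M" "k' \<in> L2 M"
  shows "l2_inner M h k = l2_inner M h' k'"
  unfolding l2_inner_def
  by (rule integral_cong_AE) (use assms in \<open>auto simp: L2_def\<close>)

lemma l2_norm_cong_AE:
  assumes "AE x in M. h x = k x" "h \<in> L2 M" "k \<in> L2 M"
  shows "l2_norm M h = l2_norm M k"
proof -
  have "(LINT x|M. (cmod (h x))\<^sup>2) = (LINT x|M. (cmod (k x))\<^sup>2)"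
    by (rule integral_cong_AE) (use assms in \<open>auto simp: L2_def\<close>)
  then show ?thesis by (simp add: l2_norm_def)
qed

lemma l2_norm_eq_0_AE:
  assumes "h \<in> L2 M" "l2_norm M h = 0"
  shows "AE x in M. h x = 0"
proof -
  have "AE x in M. (cmod (h x))\<^sup>2 = 0"
    using integral_nonneg_eq_0_iff_AE[of M "\<lambda>x. (cmod (h x))\<^sup>2"] assms
    by (simp add: L2_def l2_norm_def)
  then show ?thesis by simp
qed

lemma l2_norm_scale: "l2_norm M (\<lambda>x. a * h x) = cmod a * l2_norm M h"
  by (simp add: l2_norm_def norm_mult power_mult_distrib real_sqrt_mult)

lemma l2_norm_square_lincomb:
  assumes "h \<in> L2 M" "k \<in> L2 M"
  shows "(l2_norm M (\<lambda>x. a * h x + b * k x))\<^sup>2 =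
    (cmod a)\<^sup>2 * (l2_norm M h)\<^sup>2 + (cmod b)\<^sup>2 * (l2_norm M k)\<^sup>2 + 2 * Re (cnj a * b * l2_inner M h k)"
proof -
  let ?s = "\<lambda>x. a * h x + b * k x"
  have "complex_of_real ((l2_norm M ?s)\<^sup>2) = l2_inner M ?s ?s" by (simp add: l2_inner_self)
  also have "\<dots> = a * (cnj a * l2_inner M h h + cnj b * l2_inner M k h)
      + b * (cnj a * l2_inner M h k + cnj b * l2_inner M k k)"
    using assms by (simp add: l2_inner_lincomb_right l2_inner_lincomb_left L2_lincomb)
  also have "\<dots> = (a * cnj a) * l2_inner M h h + (b * cnj b) * l2_inner M k k +
      (cnj a * b * l2_inner M h k + cnj (cnj a * b * l2_inner M h k))"
    by (simp add: algebra_simps l2_inner_cnj[of M k h])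
  also have "\<dots> = complex_of_real ((cmod a)\<^sup>2 * (l2_norm M h)\<^sup>2 + (cmod b)\<^sup>2 * (l2_norm M k)\<^sup>2
      + 2 * Re (cnj a * b * l2_inner M h k))"
    by (simp only: complex_add_cnj l2_inner_self complex_norm_square[symmetric] flip: of_real_mult of_real_add)
  finally show ?thesis by (simp only: of_real_eq_iff)
qed

lemma l2_norm_triangle:
  assumes "h \<in> L2 M" "k \<in> L2 M"
  shows "l2_norm M (\<lambda>x. h x + k x) \<le> l2_norm M h + l2_norm M k"
proof (rule power2_le_imp_le)
  have "Re (l2_inner M h k) \<le> l2_norm M h * l2_norm M k"
    using l2_cauchy_schwarz[OF assms] complex_Re_le_cmod[of "l2_inner M h k"] by linarith
  then show "(l2_norm M (\<lambda>x. h x + k x))\<^sup>2 \<le> (l2_norm M h + l2_norm M k)\<^sup>2"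
    using l2_norm_square_lincomb[OF assms, of 1 1] by (simp add: power2_sum)
qed (simp add: l2_norm_nonneg)

lemma AE_zero_if_l2_inner_zero:
  assumes "h \<in> L2 M" "\<And>v. v \<in> L2 M \<Longrightarrow> l2_inner M v h = 0"
  shows "AE x in M. h x = 0"
proof (rule l2_norm_eq_0_AE[OF assms(1)])
  have "complex_of_real ((l2_norm M h)\<^sup>2) = 0" 
    using assms by (simp only: l2_inner_self[symmetric])
  then show "l2_norm M h = 0" by simp
qed


lemma L2_zero: "(\<lambda>x. 0) \<in> L2 M"
  by (simp add: L2_def)

lemma L2_sum:
  assumes "\<And>i. i \<in> I \<Longrightarrow> h i \<in> L2 M"
  shows "(\<lambda>x. \<Sum>i\<in>I. h i x) \<in> L2 M"
  using assms by (induction I rule: infinite_finite_induct) (auto simp: L2_zero intro: L2_add)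

lemma l2_inner_sum_right:
  assumes "v \<in> L2 M" "\<And>i. i \<in> I \<Longrightarrow> h i \<in> L2 M"
  shows "l2_inner M v (\<lambda>x. \<Sum>i\<in>I. h i x) = (\<Sum>i\<in>I. l2_inner M v (h i))"
  using assms(2)
proof (induction I rule: infinite_finite_induct)
  case (insert i I)
  then show ?case
    using l2_inner_lincomb_right[OF assms(1), of "h i" "\<lambda>x. \<Sum>i\<in>I. h i x" 1 1] by (simp add: L2_sum)
qed (auto simp: l2_inner_def)

lemma l2_inner_diff_right:
  assumes "v \<in> L2 M" "h \<in> L2 M" "k \<in> L2 M"
  shows "l2_inner M v (\<lambda>x. h x - k x) = l2_inner M v h - l2_inner M v k"
  using l2_inner_lincomb_right[OF assms, of 1 "-1"] by simp

lemma l2_inner_tendsto: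
  assumes "v \<in> L2 M" "h \<in> L2 M" "\<And>s. k s \<in> L2 M"
    and lim: "((\<lambda>s. l2_norm M (\<lambda>x. k s x - h x)) \<longlongrightarrow> 0) F"
  shows "((\<lambda>s. l2_inner M v (k s)) \<longlongrightarrow> l2_inner M v h) F"
proof (rule LIM_zero_cancel, rule Lim_null_comparison)
  show "\<forall>\<^sub>F s in F. norm (l2_inner M v (k s) - l2_inner M v h) \<le> l2_norm M v * l2_norm M (\<lambda>x. k s x - h x)"
    using l2_cauchy_schwarz[OF assms(1) L2_diff[OF assms(3,2)]] assms
    by (simp add: l2_inner_diff_right)
  show "((\<lambda>s. l2_norm M v * l2_norm M (\<lambda>x. k s x - h x)) \<longlongrightarrow> 0) F"
    using tendsto_mult_left[OF lim, of "l2_norm M v"] by simp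
qed

section \<open>Projection-valued measures\<close>

locale pvm =
  fixes M :: "'a measure" and E :: "real set \<Rightarrow> ('a \<Rightarrow> complex) \<Rightarrow> ('a \<Rightarrow> complex)"
  assumes pvm: "projection_valued_measure M E"
begin

lemmas E_in_L2 = pvm[unfolded projection_valued_measure_def, THEN conjunct1, rule_format]
  and E_linear = pvm[unfolded projection_valued_measure_def, THEN conjunct2, THEN conjunct2, THEN conjunct1, rule_format]
  and E_symmetric = pvm[unfolded projection_valued_measure_def, THEN conjunct2, THEN conjunct2, THEN conjunct2, THEN conjunct1, rule_format]
  and E_Int = pvm[unfolded projection_valued_measure_def, THEN conjunct2, THEN conjunct2, THEN conjunct2, THEN conjunct2, THEN conjunct1, rule_format]
  and E_UNIV = pvm[unfolded projection_valued_measure_def, THEN conjunct2, THEN conjunct2, THEN conjunct2, THEN conjunct2, THEN conjunct2, THEN conjunct1, rule_format]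
  and E_sums = pvm[unfolded projection_valued_measure_def, THEN conjunct2, THEN conjunct2, THEN conjunct2, THEN conjunct2, THEN conjunct2, THEN conjunct2, rule_format]

lemma L2_E [intro]: "B \<in> sets borel \<Longrightarrow> h \<in> L2 M \<Longrightarrow> E B h \<in> L2 M"
  by (rule E_in_L2)

lemma inner_E:
  assumes "B \<in> sets borel" "h \<in> L2 M" "k \<in> L2 M"
  shows "l2_inner M (E B h) k = l2_inner M h (E B k)"
  by (rule E_symmetric[OF assms, symmetric])

text \<open>Identities between projections hold only almost everywhere. Pairing with a vector
  \<open>v\<close> turns them into equations between numbers, and all later rules for
  \<open>E\<close> are phrased in this form.\<close>

lemma inner_E_E:
  assumes "B \<in> sets borel" "C \<in> sets borel" "v \<in> L2 M" "h \<in> L2 M"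
  shows "l2_inner M v (E B (E C h)) = l2_inner M v (E (B \<inter> C) h)"
proof (rule l2_inner_cong_AE)
  have "AE x in M. E (B \<inter> C) h x = E B (E C h) x"
    using assms by (intro E_Int)
  then show "AE x in M. E B (E C h) x = E (B \<inter> C) h x" by eventually_elim simp
qed (use assms in auto)

lemma inner_E_cross:
  assumes "B \<in> sets borel" "C \<in> sets borel" "v \<in> L2 M" "h \<in> L2 M"
  shows "l2_inner M (E B v) (E C h) = l2_inner M v (E (B \<inter> C) h)"
  by (simp only: inner_E[OF assms(1,3) L2_E[OF assms(2,4)]] inner_E_E[OF assms])

lemma inner_E_UNIV:
  assumes "v \<in> L2 M" "h \<in> L2 M"
  shows "l2_inner M v (E UNIV h) = l2_inner M v h"
proof (rule l2_inner_cong_AE)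
  show "AE x in M. E UNIV h x = h x"
    using assms by (intro E_UNIV)
qed (use assms in auto)

lemma inner_E_lincomb:
  assumes "B \<in> sets borel" "v \<in> L2 M" "h \<in> L2 M" "k \<in> L2 M"
  shows "l2_inner M v (E B (\<lambda>x. a * h x + b * k x)) = a * l2_inner M v (E B h) + b * l2_inner M v (E B k)"
proof -
  have "l2_inner M v (E B (\<lambda>x. a * h x + b * k x)) = l2_inner M v (\<lambda>x. a * E B h x + b * E B k x)"
  proof (rule l2_inner_cong_AE)
    show "AE x in M. E B (\<lambda>x. a * h x + b * k x) x = a * E B h x + b * E B k x"
      using assms by (intro E_linear)
  qed (use assms in \<open>auto intro!: L2_lincomb L2_E\<close>)
  then show ?thesis using assms by (simp add: l2_inner_lincomb_right L2_E)
qed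

lemma inner_E_sums:
  assumes "range B \<subseteq> sets borel" "disjoint_family B" "v \<in> L2 M" "h \<in> L2 M"
  shows "(\<lambda>i. l2_inner M v (E (B i) h)) sums l2_inner M v (E (\<Union>i. B i) h)"
proof -
  have *: "(\<Union>i. B i) \<in> sets borel" "\<And>i. B i \<in> sets borel" using assms(1) by auto
  have "(\<lambda>n. l2_norm M (\<lambda>x. (\<Sum>i<n. E (B i) h x) - E (\<Union>i. B i) h x)) \<longlonglongrightarrow> 0"
    using assms by (intro E_sums)
  then have "(\<lambda>n. l2_inner M v (\<lambda>x. \<Sum>i<n. E (B i) h x)) \<longlonglongrightarrow> l2_inner M v (E (\<Union>i. B i) h)"
    using assms * by (intro l2_inner_tendsto) (auto intro!: L2_sum L2_E)
  then show ?thesis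
    unfolding sums_def using assms * by (simp add: l2_inner_sum_right L2_E)
qed

text \<open>The empty set is the disjoint union of countably many copies of itself, and a constant
  series converges only if its term vanishes.\<close>

lemma inner_E_empty:
  assumes "v \<in> L2 M" "h \<in> L2 M"
  shows "l2_inner M v (E {} h) = 0"
proof -
  have "(\<lambda>i::nat. l2_inner M v (E {} h)) sums l2_inner M v (E (\<Union>i::nat. {}) h)"
    by (rule inner_E_sums[where B = "\<lambda>_. {}"]) (use assms in \<open>auto simp: disjoint_family_on_def\<close>)
  then have "(\<lambda>i::nat. l2_inner M v (E {} h)) \<longlonglongrightarrow> 0"
    by (intro summable_LIMSEQ_zero) (rule sums_summable)
  then show ?thesis by (simp add: LIMSEQ_const_iff)
qed

text \<open>Padding the family with empty sets reduces this to countable additivity.\<close>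

lemma inner_E_finite_Union:
  fixes B :: "nat \<Rightarrow> real set"
  assumes "\<And>i. i < n \<Longrightarrow> B i \<in> sets borel" "disjoint_family_on B {..<n}" "v \<in> L2 M" "h \<in> L2 M"
  shows "l2_inner M v (E (\<Union>i<n. B i) h) = (\<Sum>i<n. l2_inner M v (E (B i) h))"
proof -
  define C where "C i = (if i < n then B i else {})" for i
  have U: "(\<Union>i. C i) = (\<Union>i<n. B i)" by (auto simp: C_def split: if_splits)
  have "(\<lambda>i. l2_inner M v (E (C i) h)) sums l2_inner M v (E (\<Union>i. C i) h)"
    by (rule inner_E_sums) (use assms in \<open>auto simp: disjoint_family_on_def C_def\<close>)
  moreover have "(\<lambda>i. l2_inner M v (E (C i) h)) sums (\<Sum>i<n. l2_inner M v (E (C i) h))"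
    by (rule sums_finite) (use assms in \<open>auto simp: C_def inner_E_empty\<close>)
  ultimately have "l2_inner M v (E (\<Union>i. C i) h) = (\<Sum>i<n. l2_inner M v (E (C i) h))"
    by (rule sums_unique2)
  also have "\<dots> = (\<Sum>i<n. l2_inner M v (E (B i) h))" by (simp add: C_def)
  finally show ?thesis by (simp add: U)
qed

lemma inner_E_Un:
  assumes "B \<in> sets borel" "C \<in> sets borel" "B \<inter> C = {}" "v \<in> L2 M" "h \<in> L2 M"
  shows "l2_inner M v (E (B \<union> C) h) = l2_inner M v (E B h) + l2_inner M v (E C h)"
proof -
  let ?B = "\<lambda>i::nat. if i = 0 then B else C"
  have "{..<2::nat} = {0, 1}" by auto
  then have "(\<Union>i<2. ?B i) = B \<union> C" "(\<Sum>i<2. l2_inner M v (E (?B i) h)) = l2_inner M v (E B h) + l2_inner M v (E C h)"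
    by auto
  moreover have "disjoint_family_on ?B {..<2}" using assms(3) by (auto simp: disjoint_family_on_def)
  ultimately show ?thesis using inner_E_finite_Union[of 2 ?B v h] assms by auto
qed

lemma inner_E_self:
  assumes "B \<in> sets borel" "h \<in> L2 M"
  shows "l2_inner M h (E B h) = complex_of_real ((l2_norm M (E B h))\<^sup>2)"
  using inner_E_cross[OF assms(1,1,2,2)] by (simp add: l2_inner_self)

abbreviation spec :: "('a \<Rightarrow> complex) \<Rightarrow> real measure" where
  "spec h \<equiv> scalar_spectral_measure M E h"

lemma space_spec [simp]: "space (spec h) = UNIV"
  and sets_spec [simp, measurable_cong]: "sets (spec h) = sets borel"
  by (auto simp: scalar_spectral_measure_def space_measure_of_conv)
    (use sets.sigma_sets_eq[of "borel :: real measure"] in auto)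

text \<open>\<open>measure_of\<close> returns the given set function only if it is countably
  additive. This is checked here, from strong additivity of \<open>E\<close> paired with
  \<open>h\<close>.\<close>

lemma emeasure_spec:
  assumes h: "h \<in> L2 M" and B: "B \<in> sets borel"
  shows "emeasure (spec h) B = ennreal ((l2_norm M (E B h))\<^sup>2)"
proof -
  let ?m = "\<lambda>B. ennreal (Re (l2_inner M h (E B h)))"
  have "emeasure (measure_of UNIV (sets borel) ?m) B = ?m B"
  proof (rule emeasure_measure_of_sigma)
    show "sigma_algebra UNIV (sets (borel :: real measure))"
      using sets.sigma_algebra_axioms[of "borel :: real measure"] by simp
    show "positive (sets borel) ?m" using h by (simp add: positive_def inner_E_empty)
    show "countably_additive (sets borel) ?m"
    proof (rule countably_additiveI)
      fix A :: "nat \<Rightarrow> real set"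
      assume A: "range A \<subseteq> sets borel" "disjoint_family A" "(\<Union>i. A i) \<in> sets borel"
      have *: "A i \<in> sets borel" for i using A by auto
      have "(\<lambda>i. Re (l2_inner M h (E (A i) h))) sums Re (l2_inner M h (E (\<Union>i. A i) h))"
        using inner_E_sums[OF A(1,2) h h] by (rule sums_Re)
      then show "(\<Sum>i. ?m (A i)) = ?m (\<Union>i. A i)"
        using * h by (intro suminf_ennreal_eq) (auto simp: inner_E_self)
    qed
  qed (use B in auto)
  then show ?thesis
    using h B by (simp add: scalar_spectral_measure_def inner_E_self)
qed

lemma measure_spec:
  assumes h: "h \<in> L2 M" and B: "B \<in> sets borel"
  shows "measure (spec h) B = (l2_norm M (E B h))\<^sup>2"
  using emeasure_spec[OF assms] by (simp add: measure_def)

lemma inner_E_self_spec: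
  assumes "B \<in> sets borel" "h \<in> L2 M"
  shows "l2_inner M h (E B h) = complex_of_real (measure (spec h) B)"
  using assms by (simp add: inner_E_self measure_spec)

lemma finite_measure_spec: "h \<in> L2 M \<Longrightarrow> finite_measure (spec h)"
  by (rule finite_measureI) (simp add: emeasure_spec)

lemma measure_spec_UNIV: "h \<in> L2 M \<Longrightarrow> measure (spec h) UNIV = (l2_norm M h)\<^sup>2"
proof -
  assume "h \<in> L2 M"
  then have "complex_of_real (measure (spec h) UNIV) = complex_of_real ((l2_norm M h)\<^sup>2)"
    by (simp only: inner_E_self_spec[symmetric] inner_E_UNIV l2_inner_self sets.space_closed[of borel] space_borel
      sets.top[of "borel :: real measure", unfolded space_borel])
  then show ?thesis by (simp only: of_real_eq_iff)
qed

lemma measure_spec_le: "h \<in> L2 M \<Longrightarrow> B \<in> sets borel \<Longrightarrow> measure (spec h) B \<le> (l2_norm M h)\<^sup>2"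
  using finite_measure.finite_measure_mono[OF finite_measure_spec, of h B UNIV] by (simp add: measure_spec_UNIV)

lemma E_AE_0:
  assumes "h \<in> L2 M" "B \<in> sets borel"
  shows "emeasure (spec h) B = 0 \<Longrightarrow> AE x in M. E B h x = 0"
  using assms by (intro l2_norm_eq_0_AE) (auto simp: emeasure_spec ennreal_eq_0_iff)

text \<open>Symmetry moves one \<open>E B\<close> across the inner product and the product rule
  collapses the three projections. In other words, cutting \<open>h\<close> down by
  \<open>E B\<close> restricts its spectral measure to \<open>B\<close>.\<close>

lemma spec_E_subset:
  assumes h: "h \<in> L2 M" and B: "B \<in> sets borel" "C \<in> sets borel"
  shows "measure (spec (E B h)) C = measure (spec h) (B \<inter> C)"
proof -
  have "complex_of_real (measure (spec (E B h)) C) = l2_inner M (E B h) (E C (E B h))"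
    using assms by (simp add: inner_E_self_spec L2_E)
  also have "\<dots> = l2_inner M h (E (B \<inter> (C \<inter> B)) h)"
    using assms by (simp add: inner_E inner_E_E L2_E)
  also have "\<dots> = complex_of_real (measure (spec h) (B \<inter> C))"
    using assms by (simp add: inner_E_self_spec Int_ac)
  finally show ?thesis by simp
qed

text \<open>The cross terms contain the projection of \<open>B \<inter> (S \<inter> C) = {}\<close>.
  The scalar \<open>z\<close> is left free for polarisation.\<close>

lemma spec_add_orthogonal:
  assumes h: "h \<in> L2 M" "k \<in> L2 M" and B: "B \<in> sets borel" "C \<in> sets borel" "B \<inter> C = {}" "S \<in> sets borel"
  shows "emeasure (spec (\<lambda>x. E B h x + z * E C k x)) S =
    emeasure (spec (E B h)) S + ennreal ((cmod z)\<^sup>2) * emeasure (spec (E C k)) S"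
proof -
  let ?g = "E B h" and ?w = "E C k"
  let ?s = "\<lambda>x. 1 * ?g x + z * ?w x"
  have L: "?g \<in> L2 M" "?w \<in> L2 M" "?s \<in> L2 M" using h B L2_lincomb[of "E B h" M "E C k" 1 z] by auto
  have c1: "l2_inner M ?g (E S ?w) = 0"
  proof -
    have "l2_inner M ?g (E S ?w) = l2_inner M h (E (B \<inter> (S \<inter> C)) k)"
      using h B by (simp add: inner_E inner_E_E L2_E)
    also have "B \<inter> (S \<inter> C) = {}" using B(3) by auto
    finally show ?thesis using h by (simp add: inner_E_empty)
  qed
  have c2: "l2_inner M ?w (E S ?g) = 0"
    using inner_E[OF B(4) L(2,1)] l2_inner_cnj[of M "E S ?w" ?g] c1 by simp
  have "complex_of_real (measure (spec ?s) S) = l2_inner M ?s (E S ?s)"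
    using L B by (simp add: inner_E_self_spec)
  also have "\<dots> = l2_inner M ?s (E S ?g) + z * l2_inner M ?s (E S ?w)"
    using L B inner_E_lincomb[OF B(4) L(3) L(1) L(2), of 1 z] by simp
  also have "\<dots> = l2_inner M ?g (E S ?g) + z * cnj z * l2_inner M ?w (E S ?w)"
    using L B c1 c2 l2_inner_lincomb_left[of "E S ?g" M ?g ?w 1 z] l2_inner_lincomb_left[of "E S ?w" M ?g ?w 1 z]
    by (simp add: L2_E)
  also have "\<dots> = complex_of_real (measure (spec ?g) S + (cmod z)\<^sup>2 * measure (spec ?w) S)"
    using L B by (simp add: inner_E_self_spec complex_norm_square[of z, unfolded of_real_power])
  finally have "measure (spec ?s) S = measure (spec ?g) S + (cmod z)\<^sup>2 * measure (spec ?w) S"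
    by (simp only: of_real_eq_iff)
  then show ?thesis
    using L finite_measure.emeasure_eq_measure[OF finite_measure_spec]
    by (simp add: ennreal_mult)
qed

lemma AE_spec_E:
  assumes "h \<in> L2 M" "B \<in> sets borel"
  shows "AE t in spec (E B h). t \<in> B"
proof (rule AE_I)
  show "{t \<in> space (spec (E B h)). t \<notin> B} \<subseteq> - B" by auto
  show "emeasure (spec (E B h)) (- B) = 0"
    using assms finite_measure.emeasure_eq_measure[OF finite_measure_spec[OF L2_E[OF assms(2,1)]]]
    by (simp add: spec_E_subset Compl_eq_Diff_UNIV)
  show "- B \<in> sets (spec (E B h))" using assms by (simp add: Compl_eq_Diff_UNIV)
qed

text \<open>Countable additivity over the shells \<open>n \<le> \<bar>t\<bar> < n + 1\<close>.
  Vectors of bounded spectral support always lie in the domain of the generator, so arguments are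
  carried out for them and extended by this limit.\<close>

lemma inner_E_bounded_tendsto:
  assumes "v \<in> L2 M" "h \<in> L2 M" and B: "B \<in> sets borel"
  shows "(\<lambda>n. l2_inner M v (E (B \<inter> {t. \<bar>t\<bar> < real n}) h)) \<longlonglongrightarrow> l2_inner M v (E B h)"
proof -
  define C where "C n = B \<inter> {t. real n \<le> \<bar>t\<bar> \<and> \<bar>t\<bar> < real (Suc n)}" for n
  have C [measurable]: "C n \<in> sets borel" for n using B unfolding C_def by measurable
  have dis: "disjoint_family C"
    unfolding disjoint_family_on_def
  proof (intro ballI impI)
    fix m n :: nat assume "m \<noteq> n"
    then consider "Suc m \<le> n" | "Suc n \<le> m" by linarith
    then show "C m \<inter> C n = {}"
    proof cases
      case 1
      then have "real (Suc m) \<le> real n" by (simp only: of_nat_le_iff)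
      then show ?thesis by (auto simp: C_def)
    next
      case 2
      then have "real (Suc n) \<le> real m" by (simp only: of_nat_le_iff)
      then show ?thesis by (auto simp: C_def)
    qed
  qed
  have part: "(\<Union>i<n. C i) = B \<inter> {t. \<bar>t\<bar> < real n}" for n
    by (induction n) (auto simp: C_def lessThan_Suc)
  have "(\<Union>i. C i) = B"
  proof
    show "B \<subseteq> (\<Union>i. C i)"
    proof
      fix t assume t: "t \<in> B"
      obtain n :: nat where "\<bar>t\<bar> < real n" using reals_Archimedean2 by blast
      then have "t \<in> (\<Union>i<n. C i)" using t part by auto
      then show "t \<in> (\<Union>i. C i)" by auto
    qed
  qed (auto simp: C_def)
  then have "(\<lambda>i. l2_inner M v (E (C i) h)) sums l2_inner M v (E B h)"
    using inner_E_sums[of C v h] dis assms C by (simp add: image_subset_iff)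
  then have "(\<lambda>n. \<Sum>i<n. l2_inner M v (E (C i) h)) \<longlonglongrightarrow> l2_inner M v (E B h)"
    by (simp add: sums_def)
  moreover have "(\<Sum>i<n. l2_inner M v (E (C i) h)) = l2_inner M v (E (B \<inter> {t. \<bar>t\<bar> < real n}) h)" for n
    using inner_E_finite_Union[of n C v h] dis assms
    by (auto simp: part disjoint_family_on_def)
  ultimately show ?thesis by simp
qed

end

section \<open>The spectral resolution of a Koopman generator\<close>

lemma has_vector_derivative_at_0I:
  fixes f :: "real \<Rightarrow> 'b::real_normed_vector"
  assumes "((\<lambda>t. (f (s + t) - f s) /\<^sub>R t) \<longlongrightarrow> D) (at 0)"
  shows "(f has_vector_derivative D) (at s)"
  unfolding has_vector_derivative_def has_derivative_at
proof
  have "((\<lambda>t. norm ((f (s + t) - f s) /\<^sub>R t - D)) \<longlongrightarrow> 0) (at 0)"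
    using assms by (intro tendsto_norm_zero) (simp add: LIM_zero_iff)
  then show "(\<lambda>t. norm (f (s + t) - f s - t *\<^sub>R D) / norm t) \<midarrow>0\<rightarrow> 0"
  proof (rule Lim_transform_eventually)
    show "\<forall>\<^sub>F t in at 0. norm ((f (s + t) - f s) /\<^sub>R t - D) = norm (f (s + t) - f s - t *\<^sub>R D) / norm t"
    proof (unfold eventually_at_filter, intro always_eventually allI impI)
      fix t :: real assume "t \<noteq> 0"
      then have "f (s + t) - f s - t *\<^sub>R D = t *\<^sub>R ((f (s + t) - f s) /\<^sub>R t - D)"
        by (simp add: scaleR_diff_right)
      then show "norm ((f (s + t) - f s) /\<^sub>R t - D) = norm (f (s + t) - f s - t *\<^sub>R D) / norm t"
        using \<open>t \<noteq> 0\<close> by simp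
    qed
  qed
qed (rule bounded_linear_scaleR_left)

locale mp_flow = prob_space M for M :: "'a measure" +
  fixes \<phi> :: "real \<Rightarrow> 'a \<Rightarrow> 'a"
  assumes flow: "is_flow \<phi>"
    and measurable_flow [measurable]: "\<And>s. \<phi> s \<in> measurable M M"
    and distr_flow: "\<And>s. distr M M (\<phi> s) = M"
begin

lemma flow_0: "\<phi> 0 x = x" and flow_add: "\<phi> (s + t) x = \<phi> s (\<phi> t x)"
  using flow by (auto simp: is_flow_def)

lemma flow_inverse: "\<phi> (- s) (\<phi> s x) = x" "\<phi> s (\<phi> (- s) x) = x"
  using flow_add[of "- s" s x] flow_add[of s "- s" x] by (simp_all add: flow_0)

lemma integral_flow:
  fixes h :: "'a \<Rightarrow> 'b::{banach, second_countable_topology}"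
  assumes "h \<in> borel_measurable M"
  shows "(\<integral>x. h (\<phi> s x) \<partial>M) = (\<integral>x. h x \<partial>M)"
  using integral_distr[of "\<phi> s" M M h] assms by (simp add: distr_flow)

lemma integrable_flow:
  fixes h :: "'a \<Rightarrow> 'b::{banach, second_countable_topology}"
  assumes "integrable M h"
  shows "integrable M (\<lambda>x. h (\<phi> s x))"
  using integrable_distr[of "\<phi> s" M M h] assms by (simp add: distr_flow)

lemma L2_flow [intro]: "h \<in> L2 M \<Longrightarrow> (\<lambda>x. h (\<phi> s x)) \<in> L2 M"
  using integrable_flow[of "\<lambda>x. (cmod (h x))\<^sup>2" s] by (auto simp: L2_def)

lemma l2_norm_flow: "h \<in> L2 M \<Longrightarrow> l2_norm M (\<lambda>x. h (\<phi> s x)) = l2_norm M h"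
  using integral_flow[of "\<lambda>x. (cmod (h x))\<^sup>2" s] L2_measurable[of h M] by (simp add: l2_norm_def)

lemma l2_inner_flow:
  assumes "v \<in> L2 M" "h \<in> L2 M"
  shows "l2_inner M v (\<lambda>x. h (\<phi> s x)) = l2_inner M (\<lambda>x. v (\<phi> (- s) x)) h"
  using integral_flow[of "\<lambda>x. cnj (v (\<phi> (- s) x)) * h x" s] L2_flow[OF assms(1), of "- s"] assms
  by (simp add: l2_inner_def flow_inverse)

abbreviation "gen \<equiv> koopman_generator M \<phi>"

lemma gen_L2: "(g, k) \<in> gen \<Longrightarrow> g \<in> L2 M" "(g, k) \<in> gen \<Longrightarrow> k \<in> L2 M"
  by (auto simp: koopman_generator_def)

lemma L2_difference_quotient:
  "g \<in> L2 M \<Longrightarrow> (\<lambda>x. c * (g (\<phi> s x) - g x)) \<in> L2 M"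
  by (intro L2_scale L2_diff L2_flow)

lemma gen_inner_tendsto:
  assumes "(g, k) \<in> gen" "v \<in> L2 M"
  shows "((\<lambda>s. l2_inner M v (\<lambda>x. \<i> / complex_of_real s * (g (\<phi> s x) - g x))) \<longlongrightarrow> l2_inner M v k) (at 0)"
  by (rule l2_inner_tendsto)
    (use assms in \<open>auto simp: koopman_generator_def intro!: L2_difference_quotient simp del: times_divide_eq_left\<close>)

lemma gen_lincomb:
  assumes gk: "(g, k) \<in> gen" "(g', k') \<in> gen"
  shows "((\<lambda>x. a * g x + b * g' x), (\<lambda>x. a * k x + b * k' x)) \<in> gen"
proof -
  note L = gen_L2[OF gk(1)] gen_L2[OF gk(2)]
  let ?d = "\<lambda>g k s x. \<i> / complex_of_real s * (g (\<phi> s x) - g x) - k x"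
  have dL: "(\<lambda>x. ?d g k s x) \<in> L2 M" if "g \<in> L2 M" "k \<in> L2 M" for g k s
    by (intro L2_diff L2_scale L2_flow that)
  have eq: "?d (\<lambda>x. a * g x + b * g' x) (\<lambda>x. a * k x + b * k' x) s = (\<lambda>x. a * ?d g k s x + b * ?d g' k' s x)" for s
    by (auto simp: fun_eq_iff algebra_simps)
  have "((\<lambda>s. cmod a * l2_norm M (?d g k s) + cmod b * l2_norm M (?d g' k' s)) \<longlongrightarrow> cmod a * 0 + cmod b * 0) (at 0)"
    using gk by (intro tendsto_intros) (auto simp: koopman_generator_def)
  then have "((\<lambda>s. l2_norm M (?d (\<lambda>x. a * g x + b * g' x) (\<lambda>x. a * k x + b * k' x) s)) \<longlongrightarrow> 0) (at 0)"
    unfolding mult_zero_right add_0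
  proof (rule Lim_null_comparison[rotated])
    show "\<forall>\<^sub>F s in at 0. norm (l2_norm M (?d (\<lambda>x. a * g x + b * g' x) (\<lambda>x. a * k x + b * k' x) s))
      \<le> cmod a * l2_norm M (?d g k s) + cmod b * l2_norm M (?d g' k' s)"
      unfolding eq using l2_norm_triangle[OF L2_scale[OF dL] L2_scale[OF dL]] L
      by (simp add: l2_norm_scale l2_norm_nonneg)
  qed
  then show ?thesis using L by (auto simp: koopman_generator_def intro!: L2_lincomb)
qed

text \<open>Moving \<open>\<phi> s\<close> over to \<open>v\<close> turns the difference quotient at
  time \<open>s\<close> into the one at time 0, which converges in norm. The factor
  \<open>- \<i>\<close> reflects the convention \<open>U_s = exp (- i s H)\<close>.\<close>

lemma inner_flow_derivative:
  assumes gk: "(g, k) \<in> gen" and v: "v \<in> L2 M"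
  shows "((\<lambda>s. l2_inner M v (\<lambda>x. g (\<phi> s x))) has_vector_derivative - \<i> * l2_inner M v (\<lambda>x. k (\<phi> s x))) (at s)"
proof -
  note L = gen_L2[OF gk]
  define v' where "v' x = v (\<phi> (- s) x)" for x
  have v': "v' \<in> L2 M" unfolding v'_def using v by (rule L2_flow)
  have shift: "l2_inner M v (\<lambda>x. g (\<phi> (s + t) x)) = l2_inner M v' (\<lambda>x. g (\<phi> t x))" for t
    using l2_inner_flow[where h = "\<lambda>x. g (\<phi> t x)" and s = s, OF v L2_flow[OF L(1)]]
    by (simp add: flow_add[symmetric] v'_def[abs_def] add.commute)
  have quot: "(l2_inner M v (\<lambda>x. g (\<phi> (s + t) x)) - l2_inner M v (\<lambda>x. g (\<phi> s x))) /\<^sub>R t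
      = - \<i> * l2_inner M v' (\<lambda>x. \<i> / complex_of_real t * (g (\<phi> t x) - g x))" if "t \<noteq> 0" for t
  proof -
    have "(\<lambda>x. \<i> / complex_of_real t * (g (\<phi> t x) - g x))
       = (\<lambda>x. (\<i> / complex_of_real t) * g (\<phi> t x) + (- \<i> / complex_of_real t) * g x)"
      by (auto simp: fun_eq_iff algebra_simps diff_divide_distrib)
    then have X: "l2_inner M v' (\<lambda>x. \<i> / complex_of_real t * (g (\<phi> t x) - g x))
       = (\<i> / complex_of_real t) * l2_inner M v' (\<lambda>x. g (\<phi> t x)) + (- \<i> / complex_of_real t) * l2_inner M v' g"
      using v' L by (simp only: l2_inner_lincomb_right L2_flow)
    have "l2_inner M v (\<lambda>x. g (\<phi> s x)) = l2_inner M v' g" using shift[of 0] by (simp add: flow_0)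
    then show ?thesis
      unfolding X shift using that by (simp add: scaleR_conv_of_real field_simps)
  qed
  have lim: "((\<lambda>t. - \<i> * l2_inner M v' (\<lambda>x. \<i> / complex_of_real t * (g (\<phi> t x) - g x))) \<longlongrightarrow> - \<i> * l2_inner M v' k) (at 0)"
    by (intro tendsto_intros gen_inner_tendsto gk v')
  have "((\<lambda>t. (l2_inner M v (\<lambda>x. g (\<phi> (s + t) x)) - l2_inner M v (\<lambda>x. g (\<phi> s x))) /\<^sub>R t) \<longlongrightarrow> - \<i> * l2_inner M v' k) (at 0)"
    by (rule Lim_transform_eventually[OF lim]) (auto simp: eventually_at_filter quot)
  moreover have "l2_inner M v' k = l2_inner M v (\<lambda>x. k (\<phi> s x))"
    using l2_inner_flow[OF v L(2), of s] by (simp add: v'_def[abs_def])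
  ultimately show ?thesis by (intro has_vector_derivative_at_0I) simp
qed

end

section \<open>Integration against a linear combination of measures\<close>

lemma nn_integral_measure_add:
  assumes sets: "sets P = sets borel" "sets Q = sets borel" "sets R = sets borel"
    and add: "\<And>S. S \<in> sets borel \<Longrightarrow> emeasure P S = emeasure Q S + c * emeasure R S"
    and f: "f \<in> borel_measurable (borel :: 'b::topological_space measure)"
  shows "(\<integral>\<^sup>+x. f x \<partial>P) = (\<integral>\<^sup>+x. f x \<partial>Q) + c * (\<integral>\<^sup>+x. f x \<partial>R)"
  using f
proof (induction rule: borel_measurable_induct)
  case (cong f g)
  then have "f = g" by auto
  then show ?case using cong by simp
next
  case (set A)
  then show ?case using add sets by simp
next
  case (mult u a)
  have [measurable]: "u \<in> borel_measurable P" "u \<in> borel_measurable Q" "u \<in> borel_measurable R"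
    using mult(2) sets by (simp_all cong: measurable_cong_sets)
  show ?case using mult by (simp add: nn_integral_cmult distrib_left ac_simps)
next
  case (add u v)
  have [measurable]: "u \<in> borel_measurable P" "u \<in> borel_measurable Q" "u \<in> borel_measurable R"
    "v \<in> borel_measurable P" "v \<in> borel_measurable Q" "v \<in> borel_measurable R"
    using add sets by (simp_all cong: measurable_cong_sets)
  show ?case using add by (simp add: nn_integral_add distrib_left ac_simps)
next
  case (seq U)
  have [measurable]: "U i \<in> borel_measurable P" "U i \<in> borel_measurable Q" "U i \<in> borel_measurable R" for i
    using seq(1) sets by (simp_all cong: measurable_cong_sets)
  have inc: "incseq (\<lambda>i. \<integral>\<^sup>+x. U i x \<partial>Q)" "incseq (\<lambda>i. c * (\<integral>\<^sup>+x. U i x \<partial>R))"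
    using incseqD[OF \<open>incseq U\<close>, THEN le_funD] by (auto intro!: incseq_SucI nn_integral_mono mult_left_mono)
  have "(SUP i. U i) = (\<lambda>x. SUP i. U i x)" by (simp add: fun_eq_iff image_comp)
  then show ?case
    using seq inc
    by (simp add: nn_integral_monotone_convergence_SUP ennreal_SUP_add SUP_mult_left_ennreal)
qed

lemma integral_measure_add:
  fixes f :: "'b::topological_space \<Rightarrow> real"
  assumes sets: "sets P = sets borel" "sets Q = sets borel" "sets R = sets borel"
    and add: "\<And>S. S \<in> sets borel \<Longrightarrow> emeasure P S = emeasure Q S + ennreal c * emeasure R S" and c: "c \<ge> 0"
    and f: "integrable P f" "integrable Q f" "integrable R f"
  shows "(\<integral>x. f x \<partial>P) = (\<integral>x. f x \<partial>Q) + c * (\<integral>x. f x \<partial>R)"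
proof -
  have m: "f \<in> borel_measurable borel"
    using borel_measurable_integrable[OF f(1)] sets(1) by (simp cong: measurable_cong_sets)
  have "enn2real (\<integral>\<^sup>+x. g x \<partial>P) = enn2real (\<integral>\<^sup>+x. g x \<partial>Q) + c * enn2real (\<integral>\<^sup>+x. g x \<partial>R)"
    if "(\<integral>\<^sup>+x. g x \<partial>Q) < \<infinity>" "(\<integral>\<^sup>+x. g x \<partial>R) < \<infinity>" "g \<in> borel_measurable borel" for g
    using that nn_integral_measure_add[OF sets add that(3)] c
    by (simp add: enn2real_plus ennreal_mult_less_top enn2real_mult)
  note * = this
  have fin: "(\<integral>\<^sup>+x. ennreal (f x) \<partial>N) < \<infinity>" "(\<integral>\<^sup>+x. ennreal (- f x) \<partial>N) < \<infinity>" if "integrable N f" for N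
    using that by (auto simp: real_integrable_def top.not_eq_extremum)
  show ?thesis
    unfolding real_lebesgue_integral_def[OF f(1)] real_lebesgue_integral_def[OF f(2)] real_lebesgue_integral_def[OF f(3)]
    using m by (subst (1 2) *) (auto simp: fin[OF f(2), simplified] fin[OF f(3), simplified] algebra_simps)
qed

section \<open>From the quadratic form of the generator to the unitary group\<close>

locale koopman_resolution = mp_flow M \<phi> + pvm M E
  for M :: "'a measure" and \<phi> :: "real \<Rightarrow> 'a \<Rightarrow> 'a"
    and E :: "real set \<Rightarrow> ('a \<Rightarrow> complex) \<Rightarrow> ('a \<Rightarrow> complex)" +
  assumes resolution: "spectral_resolution M (koopman_generator M \<phi>) E"
begin

lemma Domain_gen_iff: "h \<in> L2 M \<Longrightarrow> h \<in> Domain gen \<longleftrightarrow> integrable (spec h) (\<lambda>t. t\<^sup>2)"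
  using resolution unfolding spectral_resolution_def by blast

lemma inner_gen: "(h, k) \<in> gen \<Longrightarrow> l2_inner M h k = complex_of_real (LINT t|spec h. t)"
  using resolution unfolding spectral_resolution_def by blast

text \<open>Diagonal values are real, also at every combination \<open>g + a h\<close>. The choices
  \<open>a = 1\<close> and \<open>a = \<i>\<close> compare the imaginary and the real parts of the
  two off-diagonal terms.\<close>

lemma gen_symmetric:
  assumes gk: "(g, k) \<in> gen" "(h, m) \<in> gen"
  shows "l2_inner M g m = l2_inner M k h"
proof -
  note L = gen_L2[OF gk(1)] gen_L2[OF gk(2)]
  have *: "Im (a * l2_inner M g m + cnj a * l2_inner M h k) = 0" for a
  proof -
    let ?s = "\<lambda>x. 1 * g x + a * h x" and ?t = "\<lambda>x. 1 * k x + a * m x"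
    have "l2_inner M ?s ?t = l2_inner M g k + a * l2_inner M g m + cnj a * l2_inner M h k + cnj a * a * l2_inner M h m"
      using L l2_inner_lincomb_right[of ?s M k m 1 a] l2_inner_lincomb_left[of k M g h 1 a]
        l2_inner_lincomb_left[of m M g h 1 a] L2_lincomb[of g M h 1 a]
      by (simp add: algebra_simps)
    moreover have "Im (l2_inner M ?s ?t) = 0" "Im (l2_inner M g k) = 0" "Im (l2_inner M h m) = 0"
      by (simp_all only: inner_gen[OF gen_lincomb[OF gk, of 1 a]] inner_gen[OF gk(1)] inner_gen[OF gk(2)] Im_complex_of_real)
    moreover have "Im (cnj a * a * l2_inner M h m) = 0"
      by (simp add: inner_gen[OF gk(2)] mult.commute)
    ultimately show ?thesis by simp
  qed
  have "l2_inner M g m = cnj (l2_inner M h k)"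
    using *[of 1] *[of \<i>] by (simp add: complex_eq_iff)
  then show ?thesis using l2_inner_cnj[of M k h] by simp
qed

lemma integrable_spec_bounded:
  assumes h: "h \<in> L2 M" and ae: "AE t in spec h. \<bar>t\<bar> \<le> R"
  shows "integrable (spec h) (\<lambda>t. t)" "integrable (spec h) (\<lambda>t. t\<^sup>2)"
proof -
  interpret S: finite_measure "spec h" using h by (rule finite_measure_spec)
  show "integrable (spec h) (\<lambda>t. t)"
    by (rule S.integrable_const_bound[where B = R]) (use ae in auto)
  show "integrable (spec h) (\<lambda>t. t\<^sup>2)"
  proof (rule S.integrable_const_bound[where B = "R\<^sup>2"])
    show "AE t in spec h. norm (t\<^sup>2) \<le> R\<^sup>2"
      using ae by eventually_elim (metis abs_le_square_iff abs_ge_zero norm_power power2_abs real_norm_def abs_of_nonneg order_trans)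
  qed auto
qed

lemma Domain_gen_E:
  assumes "h \<in> L2 M" "B \<in> sets borel" "B \<subseteq> {t. \<bar>t\<bar> \<le> R}"
  shows "E B h \<in> Domain gen"
  using AE_spec_E[OF assms(1,2)] assms(3)
  by (subst Domain_gen_iff) (auto intro!: integrable_spec_bounded(2)[where R = R] L2_E assms(1,2))

text \<open>The diagonal form is the mean of the spectral measure, and the spectral measures of
  vectors living on disjoint sets add up without a cross term; so the form has none either.
  Boundedness makes all the means finite and puts \<open>E C v\<close> into the domain.\<close>

lemma gen_orthogonal:
  assumes h: "h \<in> L2 M" "v \<in> L2 M" and B: "B \<in> sets borel" "C \<in> sets borel" "B \<inter> C = {}"
    and bdd: "B \<subseteq> {t. \<bar>t\<bar> \<le> R}" "C \<subseteq> {t. \<bar>t\<bar> \<le> R}"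
    and gk: "(E B h, k) \<in> gen"
  shows "l2_inner M (E C v) k = 0"
proof -
  let ?g = "E B h" and ?w = "E C v"
  obtain m where wm: "(?w, m) \<in> gen" using Domain_gen_E[OF h(2) B(2) bdd(2)] by auto
  note L = gen_L2[OF gk] gen_L2[OF wm]
  have i: "integrable (spec ?g) (\<lambda>t. t)" "integrable (spec ?w) (\<lambda>t. t)"
    using AE_spec_E[OF h(1) B(1)] AE_spec_E[OF h(2) B(2)] bdd L
    by (auto intro!: integrable_spec_bounded(1)[where R = R])
  \<comment> \<open>The form at \<open>?g + a ?w\<close> is computed twice: from its spectral
    measure, where no cross term appears, and from sesquilinearity, where two do.\<close>
  have *: "a * l2_inner M ?g m + cnj a * l2_inner M ?w k = 0" for a
  proof -
    let ?s = "\<lambda>x. 1 * ?g x + a * ?w x" and ?t = "\<lambda>x. 1 * k x + a * m x"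
    have sL: "?s \<in> L2 M" using L by (intro L2_lincomb)
    have em: "emeasure (spec ?s) S = emeasure (spec ?g) S + ennreal ((cmod a)\<^sup>2) * emeasure (spec ?w) S"
      if "S \<in> sets borel" for S
      using spec_add_orthogonal[OF h B(1,2,3) that, of a] by simp
    have "AE t in spec ?s. \<bar>t\<bar> \<le> R"
    proof (rule AE_I)
      have "AE t in spec ?g. \<not> \<not> \<bar>t\<bar> \<le> R" "AE t in spec ?w. \<not> \<not> \<bar>t\<bar> \<le> R"
        using AE_spec_E[OF h(1) B(1)] AE_spec_E[OF h(2) B(2)] bdd by auto
      then have "emeasure (spec ?g) {t. \<not> \<bar>t\<bar> \<le> R} = 0" "emeasure (spec ?w) {t. \<not> \<bar>t\<bar> \<le> R} = 0"
        using emeasure_eq_0_AE[of "\<lambda>t. \<not> \<bar>t\<bar> \<le> R" "spec ?g"] emeasure_eq_0_AE[of "\<lambda>t. \<not> \<bar>t\<bar> \<le> R" "spec ?w"]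
        by simp_all
      then show "emeasure (spec ?s) {t. \<not> \<bar>t\<bar> \<le> R} = 0" by (subst em) auto
    qed auto
    then have ints: "integrable (spec ?s) (\<lambda>t. t)" using sL by (rule integrable_spec_bounded(1)[rotated])
    have "(LINT t|spec ?s. t) = (LINT t|spec ?g. t) + (cmod a)\<^sup>2 * (LINT t|spec ?w. t)"
      by (rule integral_measure_add) (use em i ints in auto)
    then have "l2_inner M ?s ?t = l2_inner M ?g k + (cmod a)\<^sup>2 * l2_inner M ?w m"
      by (simp only: inner_gen[OF gen_lincomb[OF gk wm, of 1 a]] inner_gen[OF gk] inner_gen[OF wm] of_real_add of_real_mult)
    moreover have "l2_inner M ?s ?t = l2_inner M ?g k + a * l2_inner M ?g m + cnj a * l2_inner M ?w k
        + a * cnj a * l2_inner M ?w m"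
      using L sL l2_inner_lincomb_right[of ?s M k m 1 a] l2_inner_lincomb_left[of k M ?g ?w 1 a]
        l2_inner_lincomb_left[of m M ?g ?w 1 a]
      by (simp add: algebra_simps)
    ultimately show ?thesis by (simp add: complex_norm_square[of a, unfolded of_real_power])
  qed
  show ?thesis using *[of 1] *[of \<i>] by (simp add: complex_eq_iff)
qed

text \<open>\<open>E B\<close> and \<open>E (- B)\<close> add up to the identity, and by symmetry
  the hypothesis kills the second summand of \<open>r\<close>.\<close>

lemma E_range:
  assumes r: "r \<in> L2 M" and B: "B \<in> sets borel"
    and orth: "\<And>v. v \<in> L2 M \<Longrightarrow> l2_inner M r (E (- B) v) = 0"
  shows "AE x in M. E B r x = r x"
proof -
  have B': "- B \<in> sets borel" using B by (simp add: Compl_eq_Diff_UNIV)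
  have "AE x in M. E B r x - r x = 0"
  proof (rule AE_zero_if_l2_inner_zero)
    show "(\<lambda>x. E B r x - r x) \<in> L2 M" using r B by (intro L2_diff L2_E)
    fix v assume v: "v \<in> L2 M"
    have "l2_inner M v r = l2_inner M v (E (B \<union> - B) r)" using v r by (simp add: inner_E_UNIV)
    also have "\<dots> = l2_inner M v (E B r) + l2_inner M v (E (- B) r)"
      using v r B B' by (intro inner_E_Un) auto
    also have "l2_inner M v (E (- B) r) = l2_inner M (E (- B) v) r" using v r B' by (simp add: inner_E)
    also have "\<dots> = 0" using orth[OF v] l2_inner_cnj[of M "E (- B) v" r] by simp
    finally show "l2_inner M v (\<lambda>x. E B r x - r x) = 0"
      using v r B by (simp add: l2_inner_diff_right L2_E)
  qed
  then show ?thesis by eventually_elim simp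
qed

text \<open>The last hypothesis says that the spectral measure of \<open>p\<close> gives no mass to
  \<open>- B\<close>. The quantity to be bounded is the integral of \<open>t - \<alpha>\<close>
  against it.\<close>

lemma gen_localized_form_bound:
  assumes pk: "(p, k) \<in> gen" and B: "B \<in> sets borel" "\<And>t. t \<in> B \<Longrightarrow> \<bar>t - \<alpha>\<bar> \<le> \<delta>"
    and supp: "l2_inner M p (E (- B) p) = 0"
  shows "\<bar>Re (l2_inner M p k) - \<alpha> * (l2_norm M p)\<^sup>2\<bar> \<le> \<delta> * (l2_norm M p)\<^sup>2"
proof -
  note L = gen_L2[OF pk]
  interpret S: finite_measure "spec p" using L(1) by (rule finite_measure_spec)
  have B': "- B \<in> sets borel" using B by (simp add: Compl_eq_Diff_UNIV)
  have ae: "AE t in spec p. t \<in> B"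
  proof (rule AE_I)
    show "emeasure (spec p) (- B) = 0"
      using supp L B' by (simp add: inner_E_self_spec S.emeasure_eq_measure)
  qed (use B' in auto)
  then have ae': "AE t in spec p. \<bar>t - \<alpha>\<bar> \<le> \<delta>" by eventually_elim (rule B(2))
  then have "AE t in spec p. \<bar>t\<bar> \<le> \<bar>\<alpha>\<bar> + \<delta>" by eventually_elim arith
  then have i: "integrable (spec p) (\<lambda>t. t)" using L by (intro integrable_spec_bounded(1))
  have "(LINT t|spec p. t - \<alpha>) = (LINT t|spec p. t) - \<alpha> * (l2_norm M p)\<^sup>2"
    using i L by (simp add: measure_spec_UNIV mult.commute)
  then have eq: "Re (l2_inner M p k) - \<alpha> * (l2_norm M p)\<^sup>2 = (LINT t|spec p. t - \<alpha>)"
    using inner_gen[OF pk] by simp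
  have "norm (LINT t|spec p. t - \<alpha>) \<le> (LINT t|spec p. norm (t - \<alpha>))" by (rule integral_norm_bound)
  also have "\<dots> \<le> (LINT t|spec p. \<delta>)"
    using i ae' by (intro integral_mono_AE) auto
  also have "\<dots> = \<delta> * (l2_norm M p)\<^sup>2" using L by (simp add: measure_spec_UNIV mult.commute)
  finally show ?thesis unfolding eq by simp
qed

text \<open>On the range of \<open>E B\<close>, a Hermitian form bounded by \<open>\<delta>\<close> on the diagonal is bounded by \<open>\<delta>\<close>;
  since \<open>H - \<alpha>\<close> maps this range to itself, this bounds the operator norm.\<close>

lemma gen_localized_norm_bound:
  assumes h: "h \<in> L2 M" and B: "B \<in> sets borel" "\<And>t. t \<in> B \<Longrightarrow> \<bar>t - \<alpha>\<bar> \<le> \<delta>" and \<delta>: "\<delta> \<ge> 0"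
    and gk: "(E B h, k) \<in> gen"
  shows "l2_norm M (\<lambda>x. k x - complex_of_real \<alpha> * E B h x) \<le> \<delta> * l2_norm M (E B h)"
proof -
  let ?g = "E B h"
  define r where "r x = k x - complex_of_real \<alpha> * ?g x" for x
  note L = gen_L2[OF gk]
  have rL: "r \<in> L2 M" using L2_lincomb[OF L(2,1), of 1 "- complex_of_real \<alpha>"] by (simp add: r_def[abs_def])
  have B': "- B \<in> sets borel" using B by (simp add: Compl_eq_Diff_UNIV)
  have Bb: "B \<subseteq> {t. \<bar>t\<bar> \<le> \<bar>\<alpha>\<bar> + \<delta>}" using B(2) by fastforce
  have inner_r: "l2_inner M v r = l2_inner M v k - complex_of_real \<alpha> * l2_inner M v ?g" if "v \<in> L2 M" for v
    using l2_inner_lincomb_right[OF that L(2,1), of 1 "- complex_of_real \<alpha>"] by (simp add: r_def[abs_def])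
  \<comment> \<open>\<open>gen_orthogonal\<close> speaks of bounded sets, so \<open>- B\<close> is
    exhausted by its bounded parts.\<close>
  have orth: "l2_inner M r (E (- B) v) = 0" if v: "v \<in> L2 M" for v
  proof (rule LIMSEQ_unique)
    show "(\<lambda>n. l2_inner M r (E (- B \<inter> {t. \<bar>t\<bar> < real n}) v)) \<longlonglongrightarrow> l2_inner M r (E (- B) v)"
      using rL v B' by (rule inner_E_bounded_tendsto)
    have "l2_inner M r (E (- B \<inter> {t. \<bar>t\<bar> < real n}) v) = 0" for n
    proof -
      let ?C = "- B \<inter> {t. \<bar>t\<bar> < real n}"
      have C: "?C \<in> sets borel" using B' by measurable
      have "l2_inner M (E ?C v) k = 0"
        by (rule gen_orthogonal[OF h v B(1) C _ _ _ gk, where R = "max (real n) (\<bar>\<alpha>\<bar> + \<delta>)"]) (use Bb in auto)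
      moreover have "B \<inter> ?C = {}" by auto
      then have "l2_inner M ?g (E ?C v) = 0"
        using h v B(1) C by (simp add: inner_E_cross inner_E_empty)
      then have "l2_inner M (E ?C v) ?g = 0" using l2_inner_cnj[of M "E ?C v" ?g] by simp
      ultimately have "l2_inner M (E ?C v) r = 0" using v C by (simp add: inner_r L2_E)
      then show ?thesis using l2_inner_cnj[of M r "E ?C v"] by simp
    qed
    then show "(\<lambda>n. l2_inner M r (E (- B \<inter> {t. \<bar>t\<bar> < real n}) v)) \<longlonglongrightarrow> 0" by simp
  qed
  \<comment> \<open>The representative \<open>E B r\<close> of the class of \<open>r\<close> is the
    one that \<open>Domain_gen_E\<close> puts into the domain.\<close>
  define r' where "r' = E B r"
  have r': "AE x in M. r' x = r x" unfolding r'_def using rL B(1) orth by (rule E_range)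
  have r'L: "r' \<in> L2 M" using rL B by (auto simp: r'_def)
  obtain m where r'm: "(r', m) \<in> gen" using Domain_gen_E[OF rL B(1) Bb] by (auto simp: r'_def)
  have norm_r': "l2_norm M r' = l2_norm M r" using r' r'L rL by (rule l2_norm_cong_AE)
  have rr: "l2_inner M r' r = complex_of_real ((l2_norm M r)\<^sup>2)"
    using l2_inner_cong_AE[OF r' _ r'L rL rL rL] by (simp add: l2_inner_self)
  \<comment> \<open>Polarisation: the form of \<open>H - \<alpha>\<close> at \<open>r' + c g\<close>
    minus its value at \<open>r' - c g\<close> equals \<open>4 c\<close> times the square of the
    norm of \<open>r\<close>, and each value is at most \<open>\<delta>\<close> times a squared
    norm. The weight \<open>c\<close> stays free so that it can be optimised.\<close>
  have "(l2_norm M r)\<^sup>2 \<le> (sqrt \<delta> * l2_norm M ?g) * (sqrt \<delta> * l2_norm M r)"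
  proof (rule le_mult_of_weighted_am_gm)
    fix c :: real assume c: "c > 0"
    define Q where "Q a = Re (l2_inner M (\<lambda>x. 1 * r' x + complex_of_real a * ?g x) (\<lambda>x. 1 * m x + complex_of_real a * k x))
       - \<alpha> * (l2_norm M (\<lambda>x. 1 * r' x + complex_of_real a * ?g x))\<^sup>2" for a
    define N where "N a = (l2_norm M (\<lambda>x. 1 * r' x + complex_of_real a * ?g x))\<^sup>2" for a
    have Q: "\<bar>Q a\<bar> \<le> \<delta> * N a" for a
      unfolding Q_def N_def
    proof (rule gen_localized_form_bound[OF gen_lincomb[OF r'm gk] B])
      let ?p = "\<lambda>x. 1 * r' x + complex_of_real a * ?g x"
      have pL: "?p \<in> L2 M" using r'L L by (intro L2_lincomb)
      have "l2_inner M ?p (E (- B) r') = 0" "l2_inner M ?p (E (- B) ?g) = 0"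
        using pL rL h B B' by (simp_all add: r'_def inner_E_E inner_E_empty)
      then show "l2_inner M ?p (E (- B) ?p) = 0"
        using inner_E_lincomb[OF B' pL r'L L(1), of 1 "complex_of_real a"] by simp
    qed
    have Nexp: "N a = (l2_norm M r)\<^sup>2 + a\<^sup>2 * (l2_norm M ?g)\<^sup>2 + 2 * a * Re (l2_inner M r' ?g)" for a
      unfolding N_def using l2_norm_square_lincomb[OF r'L L(1), of 1 "complex_of_real a"]
      by (simp add: norm_r')
    have "l2_inner M r' k - complex_of_real \<alpha> * l2_inner M r' ?g = complex_of_real ((l2_norm M r)\<^sup>2)"
      using inner_r[OF r'L] rr by simp
    then have "Re (l2_inner M r' k - complex_of_real \<alpha> * l2_inner M r' ?g) = Re (complex_of_real ((l2_norm M r)\<^sup>2))"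
      by (rule arg_cong)
    then have re: "Re (l2_inner M r' k) - \<alpha> * Re (l2_inner M r' ?g) = (l2_norm M r)\<^sup>2" by simp
    have sym: "Re (l2_inner M ?g m) = Re (l2_inner M r' k)"
      using gen_symmetric[OF gk r'm] l2_inner_cnj[of M k r'] by simp
    have Qexp: "Re (l2_inner M (\<lambda>x. 1 * r' x + complex_of_real a * ?g x) (\<lambda>x. 1 * m x + complex_of_real a * k x))
       = Re (l2_inner M r' m) + a\<^sup>2 * Re (l2_inner M ?g k) + 2 * a * Re (l2_inner M r' k)" for a
    proof -
      let ?p = "\<lambda>x. 1 * r' x + complex_of_real a * ?g x"
      have pL: "?p \<in> L2 M" using r'L L by (intro L2_lincomb)
      have mL: "m \<in> L2 M" using r'm by (rule gen_L2)
      show ?thesis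
        using l2_inner_lincomb_right[OF pL mL L(2), of 1 "complex_of_real a"]
          l2_inner_lincomb_left[OF mL r'L L(1), of 1 "complex_of_real a"]
          l2_inner_lincomb_left[OF L(2) r'L L(1), of 1 "complex_of_real a"]
        by (simp add: sym algebra_simps power2_eq_square)
    qed
    have "Q c - Q (- c) = 4 * c * (Re (l2_inner M r' k) - \<alpha> * Re (l2_inner M r' ?g))"
      unfolding Q_def Qexp N_def[symmetric] Nexp by (simp add: algebra_simps)
    also have "\<dots> = 4 * c * (l2_norm M r)\<^sup>2" by (simp add: re)
    finally have "4 * c * (l2_norm M r)\<^sup>2 \<le> \<delta> * N c + \<delta> * N (- c)" using Q[of c] Q[of "- c"] by linarith
    also have "\<dots> = 2 * \<delta> * ((l2_norm M r)\<^sup>2 + c\<^sup>2 * (l2_norm M ?g)\<^sup>2)" by (simp add: Nexp algebra_simps)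
    finally show "2 * (l2_norm M r)\<^sup>2 \<le> c * (sqrt \<delta> * l2_norm M ?g)\<^sup>2 + (sqrt \<delta> * l2_norm M r)\<^sup>2 / c"
      using c \<delta> unfolding power_mult_distrib real_sqrt_pow2[OF \<delta>] by (simp add: field_simps power2_eq_square)
  qed (use \<delta> in \<open>auto simp: l2_norm_nonneg\<close>)
  also have "\<dots> = \<delta> * l2_norm M ?g * l2_norm M r" using \<delta> by simp
  finally have "l2_norm M r * l2_norm M r \<le> \<delta> * l2_norm M ?g * l2_norm M r" by (simp add: power2_eq_square)
  then have "l2_norm M r \<le> \<delta> * l2_norm M ?g"
    using \<delta> l2_norm_nonneg[of M r] l2_norm_nonneg[of M ?g] by (cases "l2_norm M r = 0") auto
  then show ?thesis by (simp add: r_def[abs_def])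
qed

text \<open>After multiplication by \<open>exp (i s \<alpha>)\<close> the derivative of the
  correlation involves only \<open>(H - \<alpha>) (E B h)\<close>, whose norm is at most
  \<open>\<delta>\<close> times that of \<open>E B h\<close>. The mean value inequality then bounds
  the change since time 0.\<close>

lemma inner_flow_localized:
  assumes h: "h \<in> L2 M" "v \<in> L2 M" and B: "B \<in> sets borel" "\<And>t. t \<in> B \<Longrightarrow> \<bar>t - \<alpha>\<bar> \<le> \<delta>" and \<delta>: "\<delta> \<ge> 0"
  shows "cmod (l2_inner M v (\<lambda>x. E B h (\<phi> s x)) - iexp (- (s * \<alpha>)) * l2_inner M v (E B h))
    \<le> \<bar>s\<bar> * \<delta> * l2_norm M v * l2_norm M (E B h)"
proof -
  let ?g = "E B h"
  have "B \<subseteq> {t. \<bar>t\<bar> \<le> \<bar>\<alpha>\<bar> + \<delta>}" using B(2) by fastforce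
  then obtain k where gk: "(?g, k) \<in> gen" using Domain_gen_E[OF h(1) B(1)] by blast
  note L = gen_L2[OF gk]
  define r where "r x = k x - complex_of_real \<alpha> * ?g x" for x
  have rL: "r \<in> L2 M" using L2_lincomb[OF L(2,1), of 1 "- complex_of_real \<alpha>"] by (simp add: r_def[abs_def])
  have rn: "l2_norm M r \<le> \<delta> * l2_norm M ?g"
    unfolding r_def using gen_localized_norm_bound[OF h(1) B \<delta> gk] .
  define w where "w s = iexp (s * \<alpha>) * l2_inner M v (\<lambda>x. ?g (\<phi> s x))" for s
  have inner_r: "l2_inner M v (\<lambda>x. r (\<phi> s x)) = l2_inner M v (\<lambda>x. k (\<phi> s x)) - complex_of_real \<alpha> * l2_inner M v (\<lambda>x. ?g (\<phi> s x))" for s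
    using l2_inner_lincomb_right[OF h(2) L2_flow[OF L(2)] L2_flow[OF L(1)], of 1 s "- complex_of_real \<alpha>" s]
    by (simp add: r_def)
  have D_iexp: "((\<lambda>s. iexp (s * \<alpha>)) has_vector_derivative \<i> * complex_of_real \<alpha> * iexp (s * \<alpha>)) (at s)" for s
  proof -
    have "((\<lambda>z. exp (\<i> * (z * complex_of_real \<alpha>))) has_field_derivative
        \<i> * complex_of_real \<alpha> * exp (\<i> * (complex_of_real s * complex_of_real \<alpha>))) (at (complex_of_real s))"
      by (auto intro!: derivative_eq_intros)
    from has_vector_derivative_real_field[OF this] show ?thesis by (simp only: of_real_mult)
  qed
  have D: "(w has_vector_derivative - \<i> * iexp (s * \<alpha>) * l2_inner M v (\<lambda>x. r (\<phi> s x))) (at s)" for s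
    unfolding w_def
    by (rule has_vector_derivative_eq_rhs[OF has_vector_derivative_mult[OF D_iexp inner_flow_derivative[OF gk h(2)]]])
      (simp add: inner_r algebra_simps)
  have "norm (w s - w 0) \<le> (l2_norm M v * l2_norm M r) * norm (s - 0)"
  proof (rule differentiable_bound[where S = UNIV and f' = "\<lambda>s y. y *\<^sub>R (- \<i> * iexp (s * \<alpha>) * l2_inner M v (\<lambda>x. r (\<phi> s x)))"])
    fix t :: real
    show "(w has_derivative (\<lambda>y. y *\<^sub>R (- \<i> * iexp (t * \<alpha>) * l2_inner M v (\<lambda>x. r (\<phi> t x))))) (at t within UNIV)"
      using D[of t] by (simp add: has_vector_derivative_def)
    have "cmod (l2_inner M v (\<lambda>x. r (\<phi> t x))) \<le> l2_norm M v * l2_norm M r"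
      using l2_cauchy_schwarz[OF h(2) L2_flow[OF rL]] by (simp add: l2_norm_flow rL)
    then show "onorm (\<lambda>y. y *\<^sub>R (- \<i> * iexp (t * \<alpha>) * l2_inner M v (\<lambda>x. r (\<phi> t x)))) \<le> l2_norm M v * l2_norm M r"
      by (intro onorm_le) (auto simp: norm_mult mult.commute intro!: mult_left_mono)
  qed auto
  moreover have "w 0 = l2_inner M v ?g" by (simp add: w_def flow_0)
  moreover have "w s - l2_inner M v ?g = iexp (s * \<alpha>) * (l2_inner M v (\<lambda>x. ?g (\<phi> s x)) - iexp (- (s * \<alpha>)) * l2_inner M v ?g)"
    by (simp add: w_def algebra_simps flip: exp_add)
  ultimately have "cmod (l2_inner M v (\<lambda>x. ?g (\<phi> s x)) - iexp (- (s * \<alpha>)) * l2_inner M v ?g) \<le> l2_norm M v * l2_norm M r * \<bar>s\<bar>"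
    by (simp add: norm_mult)
  also have "\<dots> \<le> l2_norm M v * (\<delta> * l2_norm M ?g) * \<bar>s\<bar>"
    by (intro mult_right_mono mult_left_mono rn l2_norm_nonneg) auto
  finally show ?thesis by (simp add: ac_simps)
qed

end

context koopman_resolution
begin

lemma iexp_diff_bound: "cmod (iexp x - iexp y) \<le> \<bar>x - y\<bar>"
proof -
  have "cmod (iexp (x - y) - 1) \<le> \<bar>x - y\<bar>" using iexp_approx1[of "x - y" 0] by simp
  moreover have "iexp x - iexp y = iexp y * (iexp (x - y) - 1)" by (simp add: algebra_simps flip: exp_add)
  ultimately show ?thesis by (simp add: norm_mult)
qed

lemma integrable_iexp_spec: "h \<in> L2 M \<Longrightarrow> integrable (spec h) (\<lambda>t. iexp (s * t))"
  by (rule finite_measure.integrable_const_bound[OF finite_measure_spec, where B = 1]) auto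

text \<open>The window is cut into \<open>N\<close> cells of width
  \<open>\<delta> = 2 n / N\<close>. On each cell both sides are close to the same oscillating
  factor times the mass of the cell, and the total error tends to 0 as \<open>N\<close>
  grows.\<close>

lemma inner_flow_bounded_support:
  assumes h: "h \<in> L2 M" and n: "n > (0::nat)"
  shows "l2_inner M (\<lambda>x. h (\<phi> (- s) x)) (E {t. \<bar>t\<bar> < real n} h) = (\<integral>t\<in>{t. \<bar>t\<bar> < real n}. iexp (- (s * t)) \<partial>spec h)"
proof -
  let ?v = "\<lambda>x. h (\<phi> (- s) x)" and ?B = "{t::real. \<bar>t\<bar> < real n}"
  interpret S: finite_measure "spec h" using h by (rule finite_measure_spec)
  have v: "?v \<in> L2 M" using h by (rule L2_flow)
  let ?D = "l2_inner M ?v (E ?B h) - (\<integral>t\<in>?B. iexp (- (s * t)) \<partial>spec h)"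
  have bound: "cmod ?D \<le> \<bar>s\<bar> * (2 * n / N) * (sqrt N + 1) * (l2_norm M h)\<^sup>2" if N: "N > 0" for N :: nat
  proof -
    define \<delta> where "\<delta> = 2 * real n / real N"
    have \<delta>: "\<delta> > 0" using n N by (simp add: \<delta>_def)
    define a where "a j = - real n + \<delta> * real j" for j :: nat
    define C where "C j = ?B \<inter> {t. a j \<le> t \<and> t < a (Suc j)}" for j
    have C [measurable]: "C j \<in> sets borel" for j unfolding C_def by measurable
    have a_mono: "a i \<le> a j" if "i \<le> j" for i j using that \<delta> by (simp add: a_def)
    have aS: "a (Suc j) = a j + \<delta>" for j by (simp add: a_def algebra_simps)
    have dis: "disjoint_family C"
      unfolding disjoint_family_on_def
    proof (intro ballI impI)
      fix i j :: nat assume "i \<noteq> j"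
      then consider "Suc i \<le> j" | "Suc j \<le> i" by linarith
      then show "C i \<inter> C j = {}"
      proof cases
        case 1
        show ?thesis using a_mono[OF 1] by (auto simp: C_def)
      next
        case 2
        show ?thesis using a_mono[OF 2] by (auto simp: C_def)
      qed
    qed
    have part: "(\<Union>j<m. C j) = ?B \<inter> {t. t < a m}" for m
    proof (induction m)
      case 0 show ?case by (force simp: a_def)
    next
      case (Suc m)
      have "a m \<le> a (Suc m)" by (rule a_mono) simp
      then have "C m \<union> (?B \<inter> {t. t < a m}) = ?B \<inter> {t. t < a (Suc m)}" unfolding C_def by auto
      then show ?case using Suc by (simp add: lessThan_Suc)
    qed
    have aN: "a N = real n" using N by (simp add: a_def \<delta>_def)
    have U: "(\<Union>j<N. C j) = ?B" unfolding part aN by auto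
    have near: "\<bar>t - a j\<bar> \<le> \<delta>" if "t \<in> C j" for t j using that by (auto simp: C_def aS)
    let ?m = "\<lambda>j. measure (spec h) (C j)"
    have m: "?m j = (l2_norm M (E (C j) h))\<^sup>2" for j using h by (simp add: measure_spec)
    have lhs: "l2_inner M ?v (E ?B h) = (\<Sum>j<N. l2_inner M ?v (E (C j) h))"
      using inner_E_finite_Union[OF C disjoint_family_on_mono[OF _ dis] v h, of N] U by simp
    have "(\<integral>t\<in>(\<Union>j<N. C j). iexp (- (s * t)) \<partial>spec h) = (\<Sum>j<N. \<integral>t\<in>C j. iexp (- (s * t)) \<partial>spec h)"
    proof (rule set_integral_finite_Union)
      show "disjoint_family_on C {..<N}" using dis by (auto simp: disjoint_family_on_def)
      show "set_integrable (spec h) (C j) (\<lambda>t. iexp (- (s * t)))" for j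
        unfolding set_integrable_def
        by (rule integrable_mult_indicator) (use integrable_iexp_spec[OF h, of "- s"] in auto)
    qed auto
    then have rhs: "(\<integral>t\<in>?B. iexp (- (s * t)) \<partial>spec h) = (\<Sum>j<N. \<integral>t\<in>C j. iexp (- (s * t)) \<partial>spec h)"
      by (simp only: U)
    have e1: "cmod (l2_inner M ?v (E (C j) h) - iexp (- (s * a j)) * complex_of_real (?m j))
        \<le> \<bar>s\<bar> * \<delta> * l2_norm M h * sqrt (?m j)" for j
    proof -
      have "l2_inner M ?v (E (C j) h) = l2_inner M h (\<lambda>x. E (C j) h (\<phi> s x))"
        by (rule l2_inner_flow[OF h L2_E[OF C h], symmetric])
      moreover have "l2_inner M h (E (C j) h) = complex_of_real (?m j)"
        using h by (simp add: inner_E_self_spec)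
      moreover have "sqrt (?m j) = l2_norm M (E (C j) h)" by (simp add: m l2_norm_nonneg)
      ultimately show ?thesis
        using inner_flow_localized[where s = s and \<alpha> = "a j", OF h h C[of j] near[of _ j]] \<delta> by simp
    qed
    have e2: "cmod ((\<integral>t\<in>C j. iexp (- (s * t)) \<partial>spec h) - iexp (- (s * a j)) * complex_of_real (?m j))
        \<le> \<bar>s\<bar> * \<delta> * ?m j" for j
    proof -
      have i1: "set_integrable (spec h) (C j) (\<lambda>t. iexp (- (s * t)))"
        unfolding set_integrable_def
        by (rule integrable_mult_indicator) (use integrable_iexp_spec[OF h, of "- s"] in auto)
      have i2: "set_integrable (spec h) (C j) (\<lambda>t. iexp (- (s * a j)))"
        unfolding set_integrable_def by (rule integrable_mult_indicator) auto
      have "(\<integral>t\<in>C j. iexp (- (s * a j)) \<partial>spec h) = iexp (- (s * a j)) * complex_of_real (?m j)"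
        by (simp add: set_lebesgue_integral_def scaleR_conv_of_real mult.commute)
      then have "(\<integral>t\<in>C j. iexp (- (s * t)) \<partial>spec h) - iexp (- (s * a j)) * complex_of_real (?m j)
          = (\<integral>t\<in>C j. iexp (- (s * t)) - iexp (- (s * a j)) \<partial>spec h)"
        using i1 i2 by (simp add: set_integral_diff)
      also have "cmod \<dots> \<le> (\<integral>t\<in>C j. cmod (iexp (- (s * t)) - iexp (- (s * a j))) \<partial>spec h)"
        using i1 i2 by (intro set_integral_norm_bound set_integral_diff)
      also have "\<dots> \<le> (\<integral>t\<in>C j. \<bar>s\<bar> * \<delta> \<partial>spec h)"
      proof (rule set_integral_mono)
        show "set_integrable (spec h) (C j) (\<lambda>t. cmod (iexp (- (s * t)) - iexp (- (s * a j))))"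
          using i1 i2 by (intro set_integrable_norm set_integral_diff)
        show "set_integrable (spec h) (C j) (\<lambda>t. \<bar>s\<bar> * \<delta>)"
          unfolding set_integrable_def by (rule integrable_mult_indicator) auto
        fix t assume "t \<in> C j"
        have "cmod (iexp (- (s * t)) - iexp (- (s * a j))) \<le> \<bar>- (s * t) - - (s * a j)\<bar>" by (rule iexp_diff_bound)
        also have "\<dots> = \<bar>s\<bar> * \<bar>t - a j\<bar>" by (simp add: abs_mult[symmetric] algebra_simps)
        also have "\<dots> \<le> \<bar>s\<bar> * \<delta>" using near[OF \<open>t \<in> C j\<close>] by (intro mult_left_mono) auto
        finally show "cmod (iexp (- (s * t)) - iexp (- (s * a j))) \<le> \<bar>s\<bar> * \<delta>" .
      qed
      also have "\<dots> = \<bar>s\<bar> * \<delta> * ?m j" by (simp add: set_lebesgue_integral_def)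
      finally show ?thesis .
    qed
    have summ: "(\<Sum>j<N. ?m j) \<le> (l2_norm M h)\<^sup>2"
    proof -
      have "(\<Sum>j<N. ?m j) = measure (spec h) (\<Union>j<N. C j)"
        using dis by (intro S.finite_measure_finite_Union[symmetric]) (auto simp: disjoint_family_on_def)
      also have "\<dots> \<le> (l2_norm M h)\<^sup>2" by (intro measure_spec_le h) auto
      finally show ?thesis .
    qed
    \<comment> \<open>Only one argument of the inner product is localised, so the error in a cell is
      proportional to the square root of its mass. By Cauchy-Schwarz, summing the roots costs a
      factor \<open>sqrt N\<close>, which the cell width \<open>2 n / N\<close> outweighs.\<close>
    have "(\<Sum>j<N. sqrt (?m j))\<^sup>2 \<le> (\<Sum>j<N. (sqrt (?m j))\<^sup>2) * real (card {..<N})"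
      by (rule sum_squared_le_sum_of_squares)
    also have "\<dots> \<le> (l2_norm M h)\<^sup>2 * real N" using summ by (simp add: mult_right_mono)
    also have "\<dots> = (sqrt N * l2_norm M h)\<^sup>2" by (simp add: power_mult_distrib)
    finally have sums: "(\<Sum>j<N. sqrt (?m j)) \<le> sqrt N * l2_norm M h"
      by (rule power2_le_imp_le) (simp add: l2_norm_nonneg)
    have D_eq: "?D = (\<Sum>j<N. (l2_inner M ?v (E (C j) h) - iexp (- (s * a j)) * complex_of_real (?m j))
        - ((\<integral>t\<in>C j. iexp (- (s * t)) \<partial>spec h) - iexp (- (s * a j)) * complex_of_real (?m j)))"
      unfolding lhs rhs by (simp add: sum_subtractf)
    have "cmod ?D \<le> (\<Sum>j<N. \<bar>s\<bar> * \<delta> * l2_norm M h * sqrt (?m j) + \<bar>s\<bar> * \<delta> * ?m j)"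
      unfolding D_eq by (rule sum_norm_le) (rule order.trans[OF norm_triangle_ineq4 add_mono[OF e1 e2]])
    also have "\<dots> = \<bar>s\<bar> * \<delta> * l2_norm M h * (\<Sum>j<N. sqrt (?m j)) + \<bar>s\<bar> * \<delta> * (\<Sum>j<N. ?m j)"
      by (simp only: sum.distrib sum_distrib_left)
    also have "\<dots> \<le> \<bar>s\<bar> * \<delta> * l2_norm M h * (sqrt N * l2_norm M h) + \<bar>s\<bar> * \<delta> * (l2_norm M h)\<^sup>2"
      using \<delta> by (intro add_mono mult_left_mono sums summ) (auto simp: l2_norm_nonneg)
    also have "\<dots> = \<bar>s\<bar> * (2 * n / N) * (sqrt N + 1) * (l2_norm M h)\<^sup>2"
      by (simp add: \<delta>_def power2_eq_square algebra_simps add_divide_distrib)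
    finally show ?thesis .
  qed
  have "(\<lambda>N. \<bar>s\<bar> * (2 * n / real N) * (sqrt (real N) + 1) * (l2_norm M h)\<^sup>2) \<longlonglongrightarrow> 0"
  proof -
    have "(\<lambda>N. 2 * n / real N * (sqrt (real N) + 1)) \<longlonglongrightarrow> 0"
    proof (rule Lim_transform_eventually)
      have "(\<lambda>N. sqrt (1 / real N)) \<longlonglongrightarrow> sqrt 0" by (intro tendsto_intros lim_1_over_n)
      then show "(\<lambda>N. 2 * n * (sqrt (1 / real N) + 1 / real N)) \<longlonglongrightarrow> 0"
        using tendsto_mult_left[OF tendsto_add[OF _ lim_1_over_n], of "\<lambda>N. sqrt (1 / real N)" 0 "2 * real n"] by simp
      show "\<forall>\<^sub>F N in sequentially. 2 * n * (sqrt (1 / real N) + 1 / real N) = 2 * n / real N * (sqrt (real N) + 1)"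
        unfolding eventually_sequentially
        by (intro exI[of _ 1]) (auto simp: field_simps real_sqrt_divide simp flip: real_sqrt_mult)
    qed
    from tendsto_mult_left[OF tendsto_mult_right[OF this, of "(l2_norm M h)\<^sup>2"], of "\<bar>s\<bar>"]
    show ?thesis by (simp add: mult.assoc)
  qed
  then have "(\<lambda>N::nat. cmod ?D) \<longlonglongrightarrow> 0"
  proof (rule tendsto_sandwich[rotated 2, OF tendsto_const])
    show "\<forall>\<^sub>F N in sequentially. cmod ?D \<le> \<bar>s\<bar> * (2 * n / real N) * (sqrt (real N) + 1) * (l2_norm M h)\<^sup>2"
      by (rule eventually_sequentiallyI[of 1], rule bound) simp
  qed simp
  then show ?thesis by (simp add: LIMSEQ_const_iff)
qed

text \<open>The cutoff \<open>n\<close> is removed on both sides, on the right by dominated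
  convergence. The minus sign appears because \<open>char\<close> integrates
  \<open>exp (i t x)\<close> while \<open>U_s = exp (- i s H)\<close>.\<close>

theorem inner_flow_eq_char:
  assumes h: "h \<in> L2 M"
  shows "l2_inner M h (\<lambda>x. h (\<phi> s x)) = char (spec h) (- s)"
proof -
  let ?v = "\<lambda>x. h (\<phi> (- s) x)" and ?B = "\<lambda>n::nat. {t::real. \<bar>t\<bar> < real n}"
  interpret S: finite_measure "spec h" using h by (rule finite_measure_spec)
  have v: "?v \<in> L2 M" using h by (rule L2_flow)
  have "(\<lambda>n. l2_inner M ?v (E (?B n) h)) \<longlonglongrightarrow> l2_inner M ?v (E UNIV h)"
    using inner_E_bounded_tendsto[OF v h, of UNIV] by simp
  also have "l2_inner M ?v (E UNIV h) = l2_inner M h (\<lambda>x. h (\<phi> s x))"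
    using inner_E_UNIV[OF v h] l2_inner_flow[OF h h, of s] by simp
  finally have 1: "(\<lambda>n. l2_inner M ?v (E (?B n) h)) \<longlonglongrightarrow> l2_inner M h (\<lambda>x. h (\<phi> s x))" .
  have "(\<lambda>n. \<integral>t\<in>?B n. iexp (- (s * t)) \<partial>spec h) \<longlonglongrightarrow> char (spec h) (- s)"
    unfolding set_lebesgue_integral_def char_def
  proof (rule integral_dominated_convergence[where w = "\<lambda>_. 1"])
    show "AE t in spec h. (\<lambda>n. indicat_real (?B n) t *\<^sub>R iexp (- (s * t))) \<longlonglongrightarrow> iexp (- s * t)"
    proof (rule AE_I2)
      fix t
      obtain N :: nat where N: "\<bar>t\<bar> < real N" using reals_Archimedean2 by blast
      show "(\<lambda>n. indicat_real (?B n) t *\<^sub>R iexp (- (s * t))) \<longlonglongrightarrow> iexp (- s * t)"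
        by (rule tendsto_eventually) (use N in \<open>auto simp: eventually_sequentially intro!: exI[of _ N]\<close>)
    qed
    show "(\<lambda>t. iexp (- s * t)) \<in> borel_measurable (spec h)" by measurable
    show "(\<lambda>t. indicat_real (?B n) t *\<^sub>R iexp (- (s * t))) \<in> borel_measurable (spec h)" for n by measurable
  qed (auto simp: indicator_def)
  then have 2: "(\<lambda>n. l2_inner M ?v (E (?B n) h)) \<longlonglongrightarrow> char (spec h) (- s)"
    by (rule Lim_transform_eventually)
      (auto simp: eventually_sequentially inner_flow_bounded_support[OF h] intro!: exI[of _ 1])
  show ?thesis by (rule LIMSEQ_unique[OF 1 2])
qed

end

section \<open>Square-integrable characteristic functions\<close>

context
  fixes \<beta> :: "real measure"
  assumes fin: "finite_measure \<beta>" and sets_\<beta>: "sets \<beta> = sets borel"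
begin

interpretation B: finite_measure \<beta> by (rule fin)

declare sets_\<beta> [measurable_cong, simp]

lemma space_\<beta> [simp]: "space \<beta> = UNIV"
  using sets_eq_imp_space_eq[OF sets_\<beta>] by simp

text \<open>For \<open>\<sigma> > 0\<close>, the density of the convolution of
  \<open>\<beta>\<close> with the centred normal law of standard deviation \<open>\<sigma>\<close>.
  Values in \<open>ennreal\<close> make Tonelli and Fatou available without integrability
  conditions.\<close>

definition mollified :: "real \<Rightarrow> real \<Rightarrow> ennreal" where
  "mollified \<sigma> l = (\<integral>\<^sup>+x. ennreal (normal_density x \<sigma> l) \<partial>\<beta>)"

lemma measurable_normal_density_pair [measurable]:
  "(\<lambda>(x, l). normal_density x \<sigma> l) \<in> borel_measurable (borel \<Otimes>\<^sub>M borel)"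
  unfolding normal_density_def by measurable

lemma normal_density_shift: "normal_density x \<sigma> l = normal_density 0 \<sigma> (l - x)"
  by (simp add: normal_density_def)

lemma normal_density_uminus: "normal_density 0 \<sigma> (- z) = normal_density 0 \<sigma> z"
  by (simp add: normal_density_def)

lemma normal_density_affine_point: "\<sigma> > 0 \<Longrightarrow> \<sigma> * normal_density x \<sigma> (x + \<sigma> * u) = std_normal_density u"
  by (simp add: normal_density_def real_sqrt_mult power_mult_distrib)

lemma measurable_mollified [measurable]: "mollified \<sigma> \<in> borel_measurable borel"
  unfolding mollified_def by measurable

lemma measurable_char_\<beta> [measurable]: "char \<beta> \<in> borel_measurable borel"
  unfolding char_def by measurable

lemma cmod_char_le: "cmod (char \<beta> t) \<le> measure \<beta> UNIV"
proof -
  have "cmod (char \<beta> t) \<le> (\<integral>x. norm (iexp (t * x)) \<partial>\<beta>)"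
    unfolding char_def by (rule integral_norm_bound)
  then show ?thesis by simp
qed

text \<open>By Tonelli the inner integral is a convolution of two centred normal densities of
  variance \<open>\<sigma>\<^sup>2\<close>, hence the normal density of variance
  \<open>2 \<sigma>\<^sup>2\<close>.\<close>

lemma nn_integral_mollified_square:
  assumes \<sigma>: "\<sigma> > 0"
  shows "(\<integral>\<^sup>+l. mollified \<sigma> l * mollified \<sigma> l \<partial>lborel) =
    (\<integral>\<^sup>+x. \<integral>\<^sup>+y. ennreal (normal_density 0 (sqrt 2 * \<sigma>) (x - y)) \<partial>\<beta> \<partial>\<beta>)"
proof -
  interpret P: pair_sigma_finite \<beta> lborel by standard
  have inner: "(\<integral>\<^sup>+l. ennreal (normal_density x \<sigma> l) * ennreal (normal_density y \<sigma> l) \<partial>lborel)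
      = ennreal (normal_density 0 (sqrt 2 * \<sigma>) (x - y))" for x y
  proof -
    have "(\<integral>\<^sup>+l. ennreal (normal_density x \<sigma> l) * ennreal (normal_density y \<sigma> l) \<partial>lborel)
      = (\<integral>\<^sup>+u. ennreal (normal_density 0 \<sigma> ((x - y) - u) * normal_density 0 \<sigma> u) \<partial>lborel)"
    proof (subst nn_integral_real_affine[where c = 1 and t = y])
      show "ennreal \<bar>1\<bar> * (\<integral>\<^sup>+u. ennreal (normal_density x \<sigma> (y + 1 * u)) * ennreal (normal_density y \<sigma> (y + 1 * u)) \<partial>lborel)
        = (\<integral>\<^sup>+u. ennreal (normal_density 0 \<sigma> ((x - y) - u) * normal_density 0 \<sigma> u) \<partial>lborel)"
        using normal_density_uminus[of \<sigma> "x - y - _"]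
        by (auto intro!: nn_integral_cong simp: normal_density_shift[of x] normal_density_shift[of y] algebra_simps simp flip: ennreal_mult)
    qed measurable
    also have "\<dots> = ennreal (normal_density 0 (sqrt (\<sigma>\<^sup>2 + \<sigma>\<^sup>2)) (x - y))"
      using fun_cong[OF conv_normal_density_zero_mean[OF \<sigma> \<sigma>], of "x - y"] by simp
    also have "sqrt (\<sigma>\<^sup>2 + \<sigma>\<^sup>2) = sqrt 2 * \<sigma>" using \<sigma> by (simp add: real_sqrt_mult flip: mult_2)
    finally show ?thesis .
  qed
  have "(\<integral>\<^sup>+l. mollified \<sigma> l * mollified \<sigma> l \<partial>lborel)
     = (\<integral>\<^sup>+l. \<integral>\<^sup>+x. ennreal (normal_density x \<sigma> l) * mollified \<sigma> l \<partial>\<beta> \<partial>lborel)"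
    by (subst (1) mollified_def) (simp add: nn_integral_multc)
  also have "\<dots> = (\<integral>\<^sup>+x. \<integral>\<^sup>+l. ennreal (normal_density x \<sigma> l) * mollified \<sigma> l \<partial>lborel \<partial>\<beta>)"
    by (rule P.Fubini') measurable
  also have "\<dots> = (\<integral>\<^sup>+x. \<integral>\<^sup>+l. \<integral>\<^sup>+y. ennreal (normal_density x \<sigma> l) * ennreal (normal_density y \<sigma> l) \<partial>\<beta> \<partial>lborel \<partial>\<beta>)"
    by (subst mollified_def) (simp add: nn_integral_cmult)
  also have "\<dots> = (\<integral>\<^sup>+x. \<integral>\<^sup>+y. \<integral>\<^sup>+l. ennreal (normal_density x \<sigma> l) * ennreal (normal_density y \<sigma> l) \<partial>lborel \<partial>\<beta> \<partial>\<beta>)"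
    by (intro nn_integral_cong P.Fubini') measurable
  finally show ?thesis by (simp add: inner)
qed

text \<open>The Gaussian kernel is itself the Fourier transform of a Gaussian, so Fubini rewrites
  its energy as a Gaussian average of \<open>\<bar>char \<beta> (t / \<sigma>)\<bar>^2\<close>.
  Rescaling \<open>t\<close> costs the factor \<open>\<sigma>\<close>, which cancels that of
  \<open>\<kappa>\<close>: \<open>\<kappa> \<sigma> = 1 / sqrt (2 \<pi>) \<le> 1\<close>, so the
  bound is uniform in \<open>\<sigma>\<close>.\<close>

lemma energy_normal_density:
  assumes \<sigma>: "\<sigma> > 0" and int: "integrable lborel (\<lambda>s. (cmod (char \<beta> s))\<^sup>2)"
  shows "(\<integral>\<^sup>+x. \<integral>\<^sup>+y. ennreal (normal_density 0 \<sigma> (x - y)) \<partial>\<beta> \<partial>\<beta>) \<le> ennreal (LINT s|lborel. (cmod (char \<beta> s))\<^sup>2)"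
proof -
  interpret N: real_distribution std_normal_distribution by (rule real_dist_normal_dist)
  interpret BB: pair_sigma_finite \<beta> \<beta> by standard
  interpret BN: pair_sigma_finite \<beta> std_normal_distribution by standard
  interpret FBB: finite_measure "\<beta> \<Otimes>\<^sub>M \<beta>" by (rule finite_measure_pair_measure) (rule fin)+
  interpret FBN: finite_measure "\<beta> \<Otimes>\<^sub>M std_normal_distribution"
    by (intro finite_measure_pair_measure fin N.finite_measure_axioms)
  \<comment> \<open>The maximum of the kernel, attained at 0.\<close>
  define \<kappa> where "\<kappa> = 1 / sqrt (2 * pi * \<sigma>\<^sup>2)"
  have \<kappa>: "\<kappa> > 0" using \<sigma> by (simp add: \<kappa>_def)
  let ?n = "\<lambda>x y. normal_density 0 \<sigma> (x - y)"
  let ?e = "\<lambda>x t. iexp (t / \<sigma> * x)"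
  have nd: "complex_of_real (?n x y) = complex_of_real \<kappa> * (CLINT t|std_normal_distribution. ?e x t * cnj (?e y t))" for x y
  proof -
    have "(CLINT t|std_normal_distribution. ?e x t * cnj (?e y t)) = char std_normal_distribution ((x - y) / \<sigma>)"
      unfolding char_def
      by (intro Bochner_Integration.integral_cong refl)
        (simp add: exp_cnj diff_divide_distrib right_diff_distrib left_diff_distrib mult.commute flip: exp_add)
    also have "\<dots> = complex_of_real (exp (- ((x - y) / \<sigma>)\<^sup>2 / 2))"
      by (rule fun_cong[OF char_std_normal_distribution])
    finally show ?thesis
      by (simp only:) (simp add: normal_density_def \<kappa>_def power_divide flip: of_real_mult)
  qed
  have ndle: "?n x y \<le> \<kappa>" "0 \<le> ?n x y" for x y
    using \<kappa> by (auto simp: normal_density_def \<kappa>_def[symmetric] mult_left_le)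
  have i1: "integrable \<beta> (\<lambda>y. ?n x y)" for x
    by (rule B.integrable_const_bound[where B = \<kappa>]) (use ndle in auto)
  have i2: "integrable \<beta> (\<lambda>x. LINT y|\<beta>. ?n x y)"
  proof (rule B.integrable_const_bound[where B = "\<kappa> * measure \<beta> UNIV"])
    show "AE x in \<beta>. norm (LINT y|\<beta>. ?n x y) \<le> \<kappa> * measure \<beta> UNIV"
    proof (rule AE_I2)
      fix x
      have "norm (LINT y|\<beta>. ?n x y) \<le> (LINT y|\<beta>. norm (?n x y))" by (rule integral_norm_bound)
      also have "\<dots> \<le> (LINT y|\<beta>. \<kappa>)" using i1 ndle by (intro integral_mono) auto
      finally show "norm (LINT y|\<beta>. ?n x y) \<le> \<kappa> * measure \<beta> UNIV" by (simp add: mult.commute)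
    qed
  qed measurable
  have "(\<integral>\<^sup>+x. \<integral>\<^sup>+y. ennreal (?n x y) \<partial>\<beta> \<partial>\<beta>) = (\<integral>\<^sup>+x. ennreal (LINT y|\<beta>. ?n x y) \<partial>\<beta>)"
    using i1 by (intro nn_integral_cong nn_integral_eq_integral) (auto simp: ndle)
  also have "\<dots> = ennreal (LINT x|\<beta>. LINT y|\<beta>. ?n x y)"
    using i2 by (intro nn_integral_eq_integral) (auto intro!: integral_nonneg_AE simp: ndle)
  finally have nn: "(\<integral>\<^sup>+x. \<integral>\<^sup>+y. ennreal (?n x y) \<partial>\<beta> \<partial>\<beta>) = ennreal (LINT x|\<beta>. LINT y|\<beta>. ?n x y)" .
  have chr: "(CLINT x|\<beta>. ?e x t) = char \<beta> (t / \<sigma>)" for t by (simp add: char_def)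
  let ?X = "CLINT x|\<beta>. CLINT y|\<beta>. CLINT t|std_normal_distribution. ?e x t * cnj (?e y t)"
  have "complex_of_real (LINT x|\<beta>. LINT y|\<beta>. ?n x y) = (CLINT x|\<beta>. CLINT y|\<beta>. complex_of_real (?n x y))"
    by simp
  also have "\<dots> = complex_of_real \<kappa> * ?X"
    by (simp add: nd)
  finally have X: "complex_of_real (LINT x|\<beta>. LINT y|\<beta>. ?n x y) = complex_of_real \<kappa> * ?X" .
  have "?X = (CLINT x|\<beta>. CLINT t|std_normal_distribution. CLINT y|\<beta>. ?e x t * cnj (?e y t))"
  proof (rule Bochner_Integration.integral_cong[OF refl])
    fix x
    show "(CLINT y|\<beta>. CLINT t|std_normal_distribution. ?e x t * cnj (?e y t))
     = (CLINT t|std_normal_distribution. CLINT y|\<beta>. ?e x t * cnj (?e y t))"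
      by (rule BN.Fubini_integral[symmetric], rule FBN.integrable_const_bound[where B = 1])
        (auto simp: norm_mult split_beta')
  qed
  also have "\<dots> = (CLINT x|\<beta>. CLINT t|std_normal_distribution. ?e x t * cnj (char \<beta> (t / \<sigma>)))"
    by (simp only: integral_mult_right_zero Bochner_Integration.integral_cnj chr)
  also have "\<dots> = (CLINT t|std_normal_distribution. CLINT x|\<beta>. ?e x t * cnj (char \<beta> (t / \<sigma>)))"
    by (rule BN.Fubini_integral[symmetric], rule FBN.integrable_const_bound[where B = "measure \<beta> UNIV"])
      (auto simp: norm_mult split_beta' cmod_char_le)
  also have "\<dots> = (CLINT t|std_normal_distribution. complex_of_real ((cmod (char \<beta> (t / \<sigma>)))\<^sup>2))"
    by (simp only: integral_mult_left_zero chr complex_norm_square)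
  also have "\<dots> = complex_of_real (LINT t|std_normal_distribution. (cmod (char \<beta> (t / \<sigma>)))\<^sup>2)"
    by (rule integral_complex_of_real)
  finally have X': "?X = complex_of_real (LINT t|std_normal_distribution. (cmod (char \<beta> (t / \<sigma>)))\<^sup>2)" .
  have eq: "(LINT x|\<beta>. LINT y|\<beta>. ?n x y) = \<kappa> * (LINT t|std_normal_distribution. (cmod (char \<beta> (t / \<sigma>)))\<^sup>2)"
    using X unfolding X' by (simp only: of_real_mult[symmetric] of_real_eq_iff)
  have int': "integrable lborel (\<lambda>t. (cmod (char \<beta> (t / \<sigma>)))\<^sup>2)"
    using lborel_integrable_real_affine[OF int, of "1 / \<sigma>" 0] \<sigma> by simp
  have sub: "(LINT t|lborel. (cmod (char \<beta> (t / \<sigma>)))\<^sup>2) = \<sigma> * (LINT s|lborel. (cmod (char \<beta> s))\<^sup>2)"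
    using lborel_integral_real_affine[of "1 / \<sigma>" "\<lambda>s. (cmod (char \<beta> s))\<^sup>2" 0] \<sigma> by simp
  have stdle: "std_normal_density t \<le> 1" for t
  proof -
    have "1 / sqrt (2 * pi) \<le> 1" using pi_ge_two by (simp add: real_le_rsqrt)
    then show ?thesis unfolding std_normal_density_def by (intro mult_le_one) auto
  qed
  have "(LINT t|std_normal_distribution. (cmod (char \<beta> (t / \<sigma>)))\<^sup>2) = (LINT t|lborel. std_normal_density t * (cmod (char \<beta> (t / \<sigma>)))\<^sup>2)"
    by (subst integral_density) auto
  also have "\<dots> \<le> (LINT t|lborel. (cmod (char \<beta> (t / \<sigma>)))\<^sup>2)"
  proof (rule integral_mono)
    show "integrable lborel (\<lambda>t. std_normal_density t * (cmod (char \<beta> (t / \<sigma>)))\<^sup>2)"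
      by (rule Bochner_Integration.integrable_bound[OF int'])
        (use stdle in \<open>auto simp: mult_left_le_one_le\<close>)
    show "std_normal_density t * (cmod (char \<beta> (t / \<sigma>)))\<^sup>2 \<le> (cmod (char \<beta> (t / \<sigma>)))\<^sup>2" for t
      using stdle[of t] by (simp add: mult_left_le_one_le)
  qed (rule int')
  finally have "(LINT x|\<beta>. LINT y|\<beta>. ?n x y) \<le> \<kappa> * (\<sigma> * (LINT s|lborel. (cmod (char \<beta> s))\<^sup>2))"
    unfolding eq sub using \<kappa> by (simp add: mult_left_mono)
  also have "\<dots> \<le> 1 * (LINT s|lborel. (cmod (char \<beta> s))\<^sup>2)"
  proof -
    have "sqrt (2 * pi) \<ge> 1" using pi_ge_two by (simp add: real_le_rsqrt)
    then have "\<kappa> * \<sigma> \<le> 1" using \<sigma> by (simp add: \<kappa>_def real_sqrt_mult)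
    then show ?thesis unfolding mult.assoc[symmetric] by (intro mult_right_mono) (auto intro!: integral_nonneg_AE)
  qed
  finally show ?thesis unfolding nn by (intro ennreal_leI) simp
qed

text \<open>Convolution with a shrinking Gaussian converges weakly to \<open>\<beta>\<close>, and
  mass of open sets is lower semicontinuous. Concretely, for \<open>x\<close> in \<open>G\<close>
  and fixed \<open>u\<close>, the point \<open>x + u / (n + 1)\<close> eventually lies in
  \<open>G\<close>; Fatou is applied to \<open>u\<close> and then to \<open>x\<close>.\<close>

lemma mollified_open_Fatou:
  assumes G: "open G"
  shows "emeasure \<beta> G \<le> liminf (\<lambda>n. \<integral>\<^sup>+l\<in>G. mollified (1 / Suc n) l \<partial>lborel)"
proof -
  interpret P: pair_sigma_finite \<beta> lborel by standard
  have [measurable]: "G \<in> sets borel" using G by simp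
  let ?s = "\<lambda>n. 1 / real (Suc n)"
  define F where "F n x = (\<integral>\<^sup>+l\<in>G. ennreal (normal_density x (?s n) l) \<partial>lborel)" for n x
  have [measurable]: "F n \<in> borel_measurable borel" for n unfolding F_def by measurable
  have swap: "(\<integral>\<^sup>+l\<in>G. mollified (?s n) l \<partial>lborel) = (\<integral>\<^sup>+x. F n x \<partial>\<beta>)" for n
  proof -
    have "(\<integral>\<^sup>+l\<in>G. mollified (?s n) l \<partial>lborel) = (\<integral>\<^sup>+l. \<integral>\<^sup>+x. ennreal (normal_density x (?s n) l) * indicator G l \<partial>\<beta> \<partial>lborel)"
      unfolding mollified_def by (simp add: nn_integral_multc)
    also have "\<dots> = (\<integral>\<^sup>+x. F n x \<partial>\<beta>)" unfolding F_def by (rule P.Fubini') measurable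
    finally show ?thesis .
  qed
  have F: "F n x = (\<integral>\<^sup>+u. ennreal (std_normal_density u) * indicator G (x + ?s n * u) \<partial>lborel)" for n x
  proof -
    have "F n x = ennreal \<bar>?s n\<bar> * (\<integral>\<^sup>+u. ennreal (normal_density x (?s n) (x + ?s n * u)) * indicator G (x + ?s n * u) \<partial>lborel)"
      unfolding F_def by (rule nn_integral_real_affine) auto
    also have "\<dots> = (\<integral>\<^sup>+u. ennreal \<bar>?s n\<bar> * (ennreal (normal_density x (?s n) (x + ?s n * u)) * indicator G (x + ?s n * u)) \<partial>lborel)"
      by (subst nn_integral_cmult) auto
    also have "\<dots> = (\<integral>\<^sup>+u. ennreal (std_normal_density u) * indicator G (x + ?s n * u) \<partial>lborel)"
    proof (rule nn_integral_cong)
      fix u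
      have "?s n * normal_density x (?s n) (x + ?s n * u) = std_normal_density u"
        by (rule normal_density_affine_point) simp
      then have "ennreal \<bar>?s n\<bar> * ennreal (normal_density x (?s n) (x + ?s n * u)) = ennreal (std_normal_density u)"
        by (subst ennreal_mult[symmetric]) auto
      then show "ennreal \<bar>?s n\<bar> * (ennreal (normal_density x (?s n) (x + ?s n * u)) * indicator G (x + ?s n * u))
        = ennreal (std_normal_density u) * indicator G (x + ?s n * u)"
        by (simp only: mult.assoc[symmetric])
    qed
    finally show ?thesis .
  qed
  have "indicator G x \<le> liminf (\<lambda>n. F n x)" for x
  proof (cases "x \<in> G")
    case True
    interpret N: real_distribution std_normal_distribution by (rule real_dist_normal_dist)
    have "1 = (\<integral>\<^sup>+u. ennreal (std_normal_density u) \<partial>lborel)"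
      using N.emeasure_space_1 by (simp add: emeasure_density)
    also have "\<dots> \<le> (\<integral>\<^sup>+u. liminf (\<lambda>n. ennreal (std_normal_density u) * indicator G (x + ?s n * u)) \<partial>lborel)"
    proof (rule nn_integral_mono)
      fix u
      have "(\<lambda>n. x + ?s n * u) \<longlonglongrightarrow> x + 0 * u"
        by (intro tendsto_add tendsto_mult tendsto_const LIMSEQ_Suc[OF lim_1_over_n])
      then have "\<forall>\<^sub>F n in sequentially. x + ?s n * u \<in> G"
        using G True by (auto dest: topological_tendstoD)
      then have "\<forall>\<^sub>F n in sequentially. ennreal (std_normal_density u) \<le> ennreal (std_normal_density u) * indicator G (x + ?s n * u)"
        by eventually_elim simp
      then show "ennreal (std_normal_density u) \<le> liminf (\<lambda>n. ennreal (std_normal_density u) * indicator G (x + ?s n * u))"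
        by (rule Liminf_bounded)
    qed
    also have "\<dots> \<le> liminf (\<lambda>n. F n x)" unfolding F by (rule nn_integral_liminf) measurable
    finally show ?thesis using True by simp
  qed simp
  then have "(\<integral>\<^sup>+x. indicator G x \<partial>\<beta>) \<le> (\<integral>\<^sup>+x. liminf (\<lambda>n. F n x) \<partial>\<beta>)" by (intro nn_integral_mono)
  also have "\<dots> \<le> liminf (\<lambda>n. \<integral>\<^sup>+x. F n x \<partial>\<beta>)" by (rule nn_integral_liminf) measurable
  finally show ?thesis by (simp only: swap nn_integral_indicator[of G \<beta>] sets_\<beta> \<open>G \<in> sets borel\<close>)
qed

text \<open>The mollified densities have squared norms bounded by a common \<open>L\<close>. Since
  \<open>q \<le> c + q^2 / c\<close>, their mass on an open \<open>G\<close>, and in the limit that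
  of \<open>\<beta>\<close>, is at most \<open>c\<close> times the Lebesgue measure of
  \<open>G\<close> plus \<open>L / c\<close>.\<close>

theorem absolutely_continuous_of_char_square_integrable:
  assumes int: "integrable lborel (\<lambda>s. (cmod (char \<beta> s))\<^sup>2)"
  shows "absolutely_continuous lborel \<beta>"
  unfolding absolutely_continuous_def
proof
  fix N :: "real set" assume N: "N \<in> null_sets lborel"
  define L where "L = (LINT s|lborel. (cmod (char \<beta> s))\<^sup>2)"
  have L: "L \<ge> 0" unfolding L_def by (auto intro!: integral_nonneg_AE)
  have bound: "emeasure \<beta> G \<le> ennreal c * emeasure lborel G + ennreal (L / c)"
    if G: "open G" and c: "c > 0" for G c
  proof -
    have [measurable]: "G \<in> sets borel" using G by simp
    have pt: "q \<le> ennreal c + q * q * ennreal (1 / c)" for q :: ennreal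
    proof (cases q)
      case (real r)
      have "0 \<le> (sqrt c - r / sqrt c)\<^sup>2" by simp
      also have "\<dots> = c + r * r * (1 / c) - 2 * r" using c by (simp add: power2_diff power_divide) (simp add: power2_eq_square)
      finally have "r \<le> c + r * r * (1 / c)" using real by simp
      then have "ennreal r \<le> ennreal (c + r * r * (1 / c))" by (rule ennreal_leI)
      also have "\<dots> = ennreal c + ennreal r * ennreal r * ennreal (1 / c)"
        using real c by (simp add: ennreal_plus) (simp flip: ennreal_mult)
      finally show ?thesis using real by simp
    qed (use c in \<open>simp add: ennreal_top_mult ennreal_mult_top\<close>)
    have "(\<integral>\<^sup>+l\<in>G. mollified (1 / Suc n) l \<partial>lborel) \<le> ennreal c * emeasure lborel G + ennreal (L / c)" for n
    proof -
      let ?m = "mollified (1 / real (Suc n))"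
      have "(\<integral>\<^sup>+l\<in>G. ?m l \<partial>lborel) \<le> (\<integral>\<^sup>+l. ennreal c * indicator G l + ?m l * ?m l * ennreal (1 / c) \<partial>lborel)"
        using pt by (intro nn_integral_mono) (auto simp: indicator_def)
      also have "\<dots> = ennreal c * emeasure lborel G + (\<integral>\<^sup>+l. ?m l * ?m l \<partial>lborel) * ennreal (1 / c)"
        by (subst nn_integral_add) (auto simp: nn_integral_multc nn_integral_cmult_indicator)
      also have "\<dots> \<le> ennreal c * emeasure lborel G + ennreal L * ennreal (1 / c)"
        using energy_normal_density[OF _ int, of "sqrt 2 * (1 / Suc n)"]
        by (intro add_mono mult_right_mono) (auto simp: nn_integral_mollified_square L_def)
      also have "ennreal L * ennreal (1 / c) = ennreal (L / c)" using L c by (simp flip: ennreal_mult)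
      finally show ?thesis .
    qed
    then show ?thesis
      by (intro order_trans[OF mollified_open_Fatou[OF G]] Liminf_le always_eventually allI) auto
  qed
  have [measurable]: "N \<in> sets borel" using N by auto
  have small: "measure \<beta> N \<le> (1 + L) / c" if c: "c > 0" for c
  proof -
    \<comment> \<open>Excess measure below \<open>1 / c^2\<close> balances the bound: both of its
      terms become multiples of \<open>1 / c\<close>, and \<open>c\<close> is arbitrary.\<close>
    obtain U where U: "open U" "N \<subseteq> U" "emeasure lborel (U - N) < ennreal (1 / c\<^sup>2)"
      using outer_regular_lborel[of N "1 / c\<^sup>2"] c by auto
    have "emeasure lborel U = emeasure lborel (U - N)"
      using N U(1) by (simp add: emeasure_Diff_null_set)
    then have "emeasure lborel U \<le> ennreal (1 / c\<^sup>2)" using U(3) by simp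
    then have "ennreal c * emeasure lborel U \<le> ennreal c * ennreal (1 / c\<^sup>2)" by (rule mult_left_mono) simp
    also have "\<dots> = ennreal (1 / c)" using c by (simp add: power2_eq_square flip: ennreal_mult)
    finally have *: "ennreal c * emeasure lborel U \<le> ennreal (1 / c)" .
    have "ennreal (measure \<beta> N) = emeasure \<beta> N" by (simp add: B.emeasure_eq_measure)
    also have "\<dots> \<le> emeasure \<beta> U" using U by (intro emeasure_mono) auto
    also have "\<dots> \<le> ennreal (1 / c) + ennreal (L / c)" by (rule order_trans[OF bound[OF U(1) c] add_right_mono[OF *]])
    also have "\<dots> = ennreal ((1 + L) / c)" using L c by (simp add: add_divide_distrib flip: ennreal_plus)
    finally show ?thesis using L c by (subst (asm) ennreal_le_iff) auto
  qed
  have "measure \<beta> N = 0"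
  proof (rule ccontr)
    assume "measure \<beta> N \<noteq> 0"
    then have m: "measure \<beta> N > 0" by (simp add: zero_less_measure_iff)
    have "(1 + L) / (2 * (1 + L) / measure \<beta> N) = measure \<beta> N / 2" using m L by (simp add: field_simps)
    then have "measure \<beta> N \<le> measure \<beta> N / 2" using small[of "2 * (1 + L) / measure \<beta> N"] m L by simp
    then show False using m by simp
  qed
  then show "N \<in> null_sets \<beta>" by (simp add: null_sets_def B.emeasure_eq_measure)
qed

end

section \<open>Weak compactness of probability measures on a compact metric space\<close>

text \<open>The itineraries of the tent-like map below realise every sequence of bits, so that a compact
  metric space, coded by the balls of a countable family containing a point, is a continuous image of
  a compact set of reals. Helly's selection theorem on the line can then be transported.\<close>

definition tent :: "real \<Rightarrow> real" where "tent c = min (3 * c) (3 - 3 * c)"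

text \<open>Each outer third is mapped by \<open>tent\<close> onto the unit interval, so bits can be
  prescribed freely; the gap between the thirds makes the two cells closed and disjoint at
  once.\<close>

definition itinerary_cell :: "bool \<Rightarrow> nat \<Rightarrow> real set" where
  "itinerary_cell b n = {c. (tent ^^ n) c \<in> (if b then {2/3..1} else {0..1/3})}"

lemma continuous_tent_power: "continuous_on UNIV (tent ^^ n)"
proof (induction n)
  case (Suc n)
  have "continuous_on UNIV tent" unfolding tent_def by (intro continuous_intros)
  then have "continuous_on UNIV (tent \<circ> (tent ^^ n))"
    by (intro continuous_on_compose Suc) (rule continuous_on_subset, auto)
  then show ?case by simp
qed (simp add: id_def)

lemma closed_itinerary_cell: "closed (itinerary_cell b n)"
proof -
  have "closed ((tent ^^ n) -` (if b then {2/3..1} else {0..1/3}))"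
    by (rule closed_vimage[OF _ continuous_tent_power]) auto
  then show ?thesis by (simp add: itinerary_cell_def vimage_def)
qed

lemma itinerary_cell_disjoint: "c \<in> itinerary_cell True n \<Longrightarrow> c \<notin> itinerary_cell False n"
  by (auto simp: itinerary_cell_def)

text \<open>A point \<open>d\<close> realising the shifted sequence is pulled back through the
  branch of \<open>tent\<close> selected by the first bit.\<close>

lemma itinerary_prefix: "\<exists>c\<in>{0..1}. \<forall>n<N. c \<in> itinerary_cell (b n) n"
proof (induction N arbitrary: b)
  case 0 show ?case by (auto intro: bexI[of _ 0])
next
  case (Suc N)
  obtain d where d: "d \<in> {0..1}" "\<And>n. n < N \<Longrightarrow> d \<in> itinerary_cell (b (Suc n)) n"
    using Suc[of "\<lambda>n. b (Suc n)"] by auto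
  define c where "c = (if b 0 then 1 - d / 3 else d / 3)"
  have tc: "tent c = d" using d(1) by (auto simp: c_def tent_def min_def)
  have "c \<in> itinerary_cell (b n) n" if "n < Suc N" for n
  proof (cases n)
    case 0 then show ?thesis using d(1) by (auto simp: itinerary_cell_def c_def)
  next
    case (Suc m)
    then show ?thesis using d(2)[of m] that tc
      by (simp add: itinerary_cell_def funpow_Suc_right del: funpow.simps)
  qed
  moreover have "c \<in> {0..1}" using d(1) by (auto simp: c_def)
  ultimately show ?case by blast
qed

lemma itinerary_exists: "\<exists>c\<in>{0..1}. \<forall>n. c \<in> itinerary_cell (b n) n"
proof -
  have "{0..1::real} \<inter> (\<Inter>n. itinerary_cell (b n) n) \<noteq> {}"
  proof (rule compact_imp_fip_image)
    fix I :: "nat set" assume "finite I" 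
    \<comment> \<open>Inserting 0 keeps the maximum meaningful when \<open>I\<close> is
      empty.\<close>
    obtain c where "c \<in> {0..1}" "\<And>n. n < Suc (Max (insert 0 I)) \<Longrightarrow> c \<in> itinerary_cell (b n) n"
      using itinerary_prefix[of "Suc (Max (insert 0 I))" b] by auto
    moreover have "n < Suc (Max (insert 0 I))" if "n \<in> I" for n
      using that \<open>finite I\<close> by (simp add: less_Suc_eq_le)
    ultimately show "{0..1::real} \<inter> (\<Inter>n\<in>I. itinerary_cell (b n) n) \<noteq> {}" by auto
  qed (auto intro: closed_itinerary_cell)
  then show ?thesis by auto
qed

text \<open>A code is a real whose \<open>n\<close>-th bit tells on which side of the
  \<open>n\<close>-th ball the point lies. The relation \<open>R\<close> between codes and points is
  compact, and it is the graph of a function of the code because balls separate points. Compactness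
  of \<open>R\<close> yields continuity of decoding and measurability of encoding.\<close>

lemma compact_real_coding:
  assumes compact: "compact (UNIV :: 'a::metric_space set)"
  obtains C :: "real set" and \<pi> :: "real \<Rightarrow> 'a::metric_space" and \<xi> :: "'a::metric_space \<Rightarrow> real"
  where "compact C" "C \<subseteq> {0..1}" "continuous_on C \<pi>" "\<xi> \<in> borel_measurable borel"
    "\<And>x. \<xi> x \<in> C" "\<And>x. \<pi> (\<xi> x) = x"
proof -
  have "\<exists>k. finite k \<and> (UNIV :: 'a set) \<subseteq> (\<Union>x\<in>k. ball x (1 / Suc n))" for n
    using compact unfolding compact_eq_totally_bounded by (elim conjE allE[of _ "1 / real (Suc n)"]) auto
  then obtain K where K: "\<And>n. finite (K n)" "\<And>n. (UNIV :: 'a set) \<subseteq> (\<Union>x\<in>K n. ball x (1 / Suc n))"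
    by metis
  define Q where "Q = (\<Union>n. K n \<times> {1 / real (Suc n)})"
  have "countable (K n \<times> {1 / real (Suc n)})" for n
    by (intro countable_finite finite_cartesian_product K) simp
  then have "countable Q" unfolding Q_def by simp
  moreover have "K 0 \<noteq> {}" using K(2)[of 0] by auto
  then have "Q \<noteq> {}" unfolding Q_def by blast
  ultimately obtain q :: "nat \<Rightarrow> 'a \<times> real" where q: "range q = Q"
    using range_from_nat_into[of Q] by blast
  \<comment> \<open>Both alternatives are closed and together they cover the space. They overlap
    where the distance equals the radius, so a point may have several codes.\<close>
  define S where "S b n = (if b then cball (fst (q n)) (snd (q n)) else - ball (fst (q n)) (snd (q n)))" for b n
  have cS: "closed (S b n)" for b n by (auto simp: S_def)
  \<comment> \<open>Because of that overlap, separation needs \<open>x\<close> in the open ball and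
    \<open>y\<close> outside the closed one; only then is the bit forced for both points.\<close>
  have ball_ex: "\<exists>n. x \<in> ball (fst (q n)) (snd (q n)) \<and> y \<notin> cball (fst (q n)) (snd (q n))" if "x \<noteq> y" for x y
  proof -
    have "0 < dist x y / 2" using that by simp
    then obtain n where n: "1 / real (Suc n) < dist x y / 2" by (meson nat_approx_posE)
    obtain z where z: "z \<in> K n" "x \<in> ball z (1 / Suc n)" using K(2)[of n] by blast
    have "(z, 1 / real (Suc n)) \<in> range q" using z by (auto simp: q Q_def)
    then obtain m where m: "q m = (z, 1 / real (Suc n))" by (metis imageE)
    have "dist x y \<le> dist z x + dist z y" by (metis dist_commute dist_triangle)
    then have "dist z y > 1 / real (Suc n)" using z(2) n by (simp add: mem_ball)
    then show ?thesis using z m by (intro exI[of _ m]) auto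
  qed
  define R where "R = {(c, x). c \<in> {0..1} \<and> (\<forall>n. \<exists>b. c \<in> itinerary_cell b n \<and> x \<in> S b n)}"
  have R_eq: "R = ({0..1} \<times> UNIV) \<inter> (\<Inter>n. (itinerary_cell True n \<times> S True n) \<union> (itinerary_cell False n \<times> S False n))"
    by (auto simp: R_def) (metis (full_types))+
  have "compact (({0..1::real} \<times> (UNIV :: 'a set)) \<inter> (\<Inter>n. (itinerary_cell True n \<times> S True n) \<union> (itinerary_cell False n \<times> S False n)))"
    by (intro compact_Int_closed compact_Times compact closed_INT closed_Un closed_Times cS closed_itinerary_cell ballI) auto
  then have cR: "compact R" by (simp only: R_eq)
  have uniq: "x = y" if "(c, x) \<in> R" "(c, y) \<in> R" for c x y
  proof (rule ccontr)
    assume "x \<noteq> y"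
    then obtain n where n: "x \<in> ball (fst (q n)) (snd (q n))" "y \<notin> cball (fst (q n)) (snd (q n))"
      using ball_ex by blast
    obtain b b' where b: "c \<in> itinerary_cell b n" "x \<in> S b n" "c \<in> itinerary_cell b' n" "y \<in> S b' n"
      using \<open>(c, x) \<in> R\<close> \<open>(c, y) \<in> R\<close> unfolding R_def by blast
    have "b" using b(2) n(1) by (cases b) (auto simp: S_def)
    moreover have "\<not> b'" using b(4) n(2) by (cases b') (auto simp: S_def)
    ultimately show False using b itinerary_cell_disjoint[of c n] by (cases b; cases b') auto
  qed
  have ex: "\<exists>c. (c, x) \<in> R" for x
  proof -
    define b where "b n = (x \<in> ball (fst (q n)) (snd (q n)))" for n
    obtain c where c: "c \<in> {0..1}" "\<And>n. c \<in> itinerary_cell (b n) n" using itinerary_exists[of b] by blast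
    have "x \<in> S (b n) n" for n by (auto simp: b_def S_def)
    then show ?thesis using c by (auto simp: R_def)
  qed
  define C where "C = fst ` R"
  define \<pi> where "\<pi> c = (THE x. (c, x) \<in> R)" for c
  \<comment> \<open>The least code of \<open>x\<close>. With this choice a sublevel set of
    \<open>\<xi>\<close> is the projection of a compact part of \<open>R\<close>, hence
    closed.\<close>
  define \<xi> where "\<xi> x = Inf {c. (c, x) \<in> R}" for x
  have \<pi>: "\<pi> c = x" if "(c, x) \<in> R" for c x unfolding \<pi>_def using uniq that by blast
  have C: "compact C" unfolding C_def by (intro compact_continuous_image cR continuous_intros)
  have fiber: "{c. (c, x) \<in> R} = (\<lambda>(c, y). c) ` (R \<inter> (UNIV \<times> {x}))" for x by force
  have fiber_compact: "compact {c. (c, x) \<in> R}" for x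
    unfolding fiber split_beta by (intro compact_continuous_image compact_Int_closed cR closed_Times continuous_intros)
  have bdd: "bdd_below {c. (c, x) \<in> R}" for x by (auto simp: R_def intro!: bdd_belowI[of _ 0])
  have \<xi>R: "(\<xi> x, x) \<in> R" for x
    using closed_contains_Inf[OF _ bdd compact_imp_closed[OF fiber_compact], of x] ex[of x]
    by (auto simp: \<xi>_def)
  show thesis
  proof
    show "compact C" by fact
    show "C \<subseteq> {0..1}" by (auto simp: C_def R_def)
    show "\<xi> x \<in> C" for x using \<xi>R[of x] by (force simp: C_def)
    show "\<pi> (\<xi> x) = x" for x using \<xi>R by (rule \<pi>)
    show "continuous_on C \<pi>"
      unfolding continuous_on_closed_vimage[OF compact_imp_closed[OF C]]
    proof (intro allI impI)
      fix T :: "'a set" assume T: "closed T"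
      have "\<pi> -` T \<inter> C = fst ` (R \<inter> (UNIV \<times> T))" using \<pi> by (force simp: C_def)
      moreover have "closed (fst ` (R \<inter> (UNIV \<times> T)))"
        by (rule compact_imp_closed, rule compact_continuous_image[OF continuous_on_fst[OF continuous_on_id]],
          rule compact_Int_closed[OF cR closed_Times[OF closed_UNIV T]])
      ultimately show "closed (\<pi> -` T \<inter> C)" by simp
    qed
    show "\<xi> \<in> borel_measurable borel"
      unfolding borel_measurable_iff_le
    proof
      fix t
      have "{x. \<xi> x \<le> t} = snd ` (R \<inter> ({..t} \<times> UNIV))"
      proof (intro set_eqI iffI)
        fix x assume "x \<in> {x. \<xi> x \<le> t}"
        then have "(\<xi> x, x) \<in> R \<inter> ({..t} \<times> UNIV)" using \<xi>R by auto
        then show "x \<in> snd ` (R \<inter> ({..t} \<times> UNIV))" by force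
      next
        fix x assume "x \<in> snd ` (R \<inter> ({..t} \<times> UNIV))"
        then obtain c where "(c, x) \<in> R" "c \<le> t" by auto
        then show "x \<in> {x. \<xi> x \<le> t}" using cInf_lower[of c "{c. (c, x) \<in> R}"] bdd[of x] by (auto simp: \<xi>_def)
      qed
      moreover have "closed (snd ` (R \<inter> ({..t} \<times> UNIV)))"
        by (rule compact_imp_closed, rule compact_continuous_image[OF continuous_on_snd[OF continuous_on_id]],
          rule compact_Int_closed[OF cR closed_Times[OF closed_atMost closed_UNIV]])
      ultimately show "{w \<in> space borel. \<xi> w \<le> t} \<in> sets borel" by simp
    qed
  qed
qed

text \<open>The coded measures live on a compact set of reals, where Helly's theorem provides a
  weakly convergent subsequence. The limit is carried back by \<open>\<pi>\<close>, which is defined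
  on \<open>C\<close> only, so it must be shown to live on \<open>C\<close>.\<close>

theorem compact_prob_measures_subsequence:
  fixes N :: "nat \<Rightarrow> 'a::metric_space measure"
  assumes compact: "compact (UNIV :: 'a set)"
    and N: "\<And>n. prob_space (N n)" "\<And>n. sets (N n) = sets borel"
  obtains r :: "nat \<Rightarrow> nat" and \<nu> :: "'a measure"
  where "strict_mono r" "prob_space \<nu>" "sets \<nu> = sets borel"
    "\<And>u :: 'a \<Rightarrow> real. continuous_on UNIV u \<Longrightarrow> (\<lambda>n. LINT x|N (r n). u x) \<longlonglongrightarrow> (LINT x|\<nu>. u x)"
proof -
  obtain C \<pi> \<xi> where C: "compact C" "C \<subseteq> {0..1::real}" and \<pi>: "continuous_on C \<pi>"
    and \<xi>: "\<xi> \<in> borel_measurable borel" "\<And>x. \<xi> x \<in> C" "\<And>x. \<pi> (\<xi> x) = (x :: 'a)"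
    using compact_real_coding[OF compact] by metis
  have \<xi>N: "\<xi> \<in> measurable (N n) borel" for n using \<xi>(1) N(2) by (simp cong: measurable_cong_sets)
  define m where "m n = distr (N n) borel \<xi>" for n
  have m: "real_distribution (m n)" for n
    unfolding m_def by (intro prob_space.real_distribution_distr N \<xi>N)
  have mC: "AE c in m n. c \<in> C" for n
    unfolding m_def using C(1) \<xi>(2) \<xi>N by (subst AE_distr_iff) (auto simp: compact_imp_closed)
  have "tight m"
    unfolding tight_def
  proof (intro conjI allI impI m)
    fix \<epsilon> :: real assume "\<epsilon> > 0"
    \<comment> \<open>Tightness is stated with intervals open on the left, so the left end must lie
      strictly below 0.\<close>
    have "measure (m n) {-1<..1} > 1 - \<epsilon>" for n
    proof -
      interpret m: real_distribution "m n" by (rule m)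
      have "AE c in m n. c \<in> {-1<..1}" using mC[of n] by eventually_elim (use C(2) in force)
      then have "measure (m n) {-1<..1} = 1" by (intro m.prob_eq_1[THEN iffD2]) auto
      then show ?thesis using \<open>\<epsilon> > 0\<close> by simp
    qed
    then show "\<exists>a b. a < b \<and> (\<forall>n. measure (m n) {a<..b} > 1 - \<epsilon>)"
      by (intro exI[of _ "-1"] exI[of _ 1]) auto
  qed
  then obtain r L where r: "strict_mono r" and L: "real_distribution L" and conv: "weak_conv_m (m \<circ> id \<circ> r) L"
    using tight_imp_convergent_subsubsequence[of m id] by (metis strict_mono_id)
  have conv_int: "(\<lambda>n. LINT c|m (r n). h c) \<longlonglongrightarrow> (LINT c|L. h c)"
    if "continuous_on UNIV h" "\<And>c. \<bar>h c\<bar> \<le> B" for h :: "real \<Rightarrow> real" and B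
    using weak_conv_imp_integral_bdd_continuous_conv[of "m \<circ> id \<circ> r" L h B] m L conv that
    by (simp add: continuous_on_eq_continuous_at)
  interpret L: real_distribution L by (rule L)
  have [measurable]: "C \<in> sets borel" using C by (simp add: compact_imp_closed)
  have C_ne: "C \<noteq> {}" using \<xi>(2) by blast
  \<comment> \<open>The bounded continuous function \<open>min 1 (infdist c C)\<close> vanishes
    exactly on the closed set \<open>C\<close>; its integrals are 0 along the sequence and therefore
    in the limit.\<close>
  have LC: "AE c in L. c \<in> C"
  proof -
    let ?h = "\<lambda>c. min 1 (infdist c C)"
    have "(\<lambda>n. LINT c|m (r n). ?h c) \<longlonglongrightarrow> (LINT c|L. ?h c)"
      by (rule conv_int[where B = 1]) (auto intro!: continuous_intros simp: infdist_nonneg)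
    moreover have "(LINT c|m (r n). ?h c) = 0" for n
      using mC[of "r n"] by (intro integral_eq_zero_AE) auto
    ultimately have "(LINT c|L. ?h c) = 0" by (simp add: LIMSEQ_const_iff)
    moreover have "continuous_on UNIV ?h" by (intro continuous_intros)
    then have "?h \<in> borel_measurable L" by (simp add: borel_measurable_continuous_onI)
    then have "integrable L ?h"
      by (intro L.integrable_const_bound[where B = 1]) (auto simp: infdist_nonneg)
    ultimately have "AE c in L. ?h c = 0"
      by (subst (asm) integral_nonneg_eq_0_iff_AE) (auto simp: infdist_nonneg)
    then show ?thesis
      by eventually_elim (use C C_ne in \<open>auto simp: min_def in_closed_iff_infdist_zero compact_imp_closed split: if_splits\<close>)
  qed
  \<comment> \<open>An arbitrary point, the value of \<open>\<pi>'\<close> on the null set outside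
    \<open>C\<close>.\<close>
  obtain x0 :: 'a where True by simp
  define \<pi>' where "\<pi>' c = (if c \<in> C then \<pi> c else x0)" for c
  have \<pi>'m: "\<pi>' \<in> measurable borel borel"
    unfolding \<pi>'_def
    using \<pi> by (subst measurable_If_restrict_space_iff)
      (auto intro: borel_measurable_continuous_on_restrict)
  define \<nu> where "\<nu> = distr L borel \<pi>'"
  show thesis
  proof
    show "strict_mono r" by fact
    show "prob_space \<nu>" unfolding \<nu>_def using \<pi>'m by (intro L.prob_space_distr) simp
    show "sets \<nu> = sets borel" by (simp add: \<nu>_def)
    fix u :: "'a \<Rightarrow> real" assume u: "continuous_on UNIV u"
    have um: "u \<in> borel_measurable borel" using u by (rule borel_measurable_continuous_onI)
    have "bounded (range u)" using compact_continuous_image[OF u compact] by (rule compact_imp_bounded)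
    then obtain B where B: "\<And>x. \<bar>u x\<bar> \<le> B" by (auto simp: bounded_iff)
    \<comment> \<open>Weak convergence tests functions on the whole line, so
      \<open>u \<circ> \<pi>\<close> is extended from \<open>C\<close> by Tietze without increasing
      its bound.\<close>
    have "continuous_on C (u \<circ> \<pi>)" using \<pi> u by (intro continuous_on_compose) (auto intro: continuous_on_subset)
    then obtain h where h: "continuous_on UNIV h" "\<And>c. c \<in> C \<Longrightarrow> h c = u (\<pi> c)" "\<And>c. \<bar>h c\<bar> \<le> B"
      using Tietze[of C "u \<circ> \<pi>" UNIV B] C(1) B order_trans[OF abs_ge_zero B[of x0]]
      by (auto simp: compact_imp_closed)
    have "(LINT c|m (r n). h c) = (LINT x|N (r n). u x)" for n
      unfolding m_def using \<xi> \<xi>N h by (subst integral_distr) (auto intro: borel_measurable_continuous_onI)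
    moreover have "(LINT c|L. h c) = (LINT c|L. u (\<pi>' c))"
    proof (rule integral_cong_AE)
      show "AE c in L. h c = u (\<pi>' c)" using LC by eventually_elim (simp add: h \<pi>'_def)
      show "h \<in> borel_measurable L" using h(1) by (simp add: borel_measurable_continuous_onI)
      show "(\<lambda>c. u (\<pi>' c)) \<in> borel_measurable L" using measurable_compose[OF \<pi>'m um] by simp
    qed
    moreover have "(LINT c|L. u (\<pi>' c)) = (LINT x|\<nu>. u x)"
      unfolding \<nu>_def using \<pi>'m um by (subst integral_distr) auto
    ultimately show "(\<lambda>n. LINT x|N (r n). u x) \<longlonglongrightarrow> (LINT x|\<nu>. u x)"
      using conv_int[OF h(1,3)] by simp
  qed
qed

section \<open>Measures and continuous functions on compact metric spaces\<close>

text \<open>Closed sets generate the Borel sets and are stable under intersection; the indicator of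
  a nonempty closed set is the limit of the continuous functions
  \<open>max 0 (1 - n infdist x X)\<close>.\<close>

lemma measure_eq_if_continuous_integrals_eq:
  fixes M N :: "'a::metric_space measure"
  assumes fin: "finite_measure M" "finite_measure N" and sets: "sets M = sets borel" "sets N = sets borel"
    and eq: "\<And>u :: 'a \<Rightarrow> real. continuous_on UNIV u \<Longrightarrow> (\<And>x. 0 \<le> u x \<and> u x \<le> 1) \<Longrightarrow> (LINT x|M. u x) = (LINT x|N. u x)"
  shows "M = N"
proof (rule measure_eqI_generator_eq[where \<Omega> = UNIV and E = "Collect closed" and A = "\<lambda>_. UNIV"])
  show "Int_stable (Collect (closed :: 'a set \<Rightarrow> bool))" by (auto simp: Int_stable_def)
  show "sets M = sigma_sets UNIV (Collect closed)" "sets N = sigma_sets UNIV (Collect closed)"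
    using sets by (simp_all add: borel_eq_closed)
  show "emeasure M UNIV \<noteq> \<infinity>" using finite_measure.emeasure_finite[OF fin(1)] by simp
  show "emeasure M X = emeasure N X" if "X \<in> Collect closed" for X
  proof (cases "X = {}")
    case False
    have X: "closed X" using that by simp
    define u where "u n x = max 0 (1 - real n * infdist x X)" for n :: nat and x
    have u: "continuous_on UNIV (u n)" "0 \<le> u n x" "u n x \<le> 1" for n x
      unfolding u_def by (auto intro!: continuous_intros simp: infdist_nonneg)
    have lim: "(\<lambda>n. u n x) \<longlonglongrightarrow> indicator X x" for x
    proof (cases "x \<in> X")
      case True
      then show ?thesis by (simp add: u_def)
    next
      case out: False
      then have pos: "infdist x X > 0"
        using in_closed_iff_infdist_zero[OF X False] infdist_nonneg[of x X] by (metis order_le_less)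
      obtain N :: nat where N: "1 / infdist x X < real N" using reals_Archimedean2 by blast
      have "u n x = 0" if "n \<ge> N" for n
      proof -
        have "1 < real N * infdist x X" using N pos by (simp add: field_simps)
        also have "\<dots> \<le> real n * infdist x X" using that pos by (intro mult_right_mono) auto
        finally show ?thesis by (simp add: u_def)
      qed
      then show ?thesis using out by (intro tendsto_eventually) (auto simp: eventually_sequentially intro!: exI[of _ N])
    qed
    have *: "(\<lambda>n. LINT x|L. u n x) \<longlonglongrightarrow> measure L X" if "finite_measure L" "sets L = sets borel" for L
    proof -
      interpret L: finite_measure L by fact
      have [measurable]: "X \<in> sets L" using X that by simp
      have "(\<lambda>n. LINT x|L. u n x) \<longlonglongrightarrow> (LINT x|L. indicator X x)"
      proof (rule integral_dominated_convergence[where w = "\<lambda>_. 1"])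
        show "u n \<in> borel_measurable L" for n
          using borel_measurable_continuous_onI[OF u(1)] that(2) by (simp cong: measurable_cong_sets)
      qed (use u lim in auto)
      then show ?thesis using sets_eq_imp_space_eq[OF that(2)] by simp
    qed
    have "measure M X = measure N X"
      by (rule LIMSEQ_unique[OF *[OF fin(1) sets(1)]]) (use *[OF fin(2) sets(2)] eq u in simp)
    then show ?thesis using fin by (simp add: finite_measure.emeasure_eq_measure)
  qed simp
qed auto

lemma continuous_bounded_compact:
  fixes u :: "'a::metric_space \<Rightarrow> real"
  assumes "compact (UNIV :: 'a set)" "continuous_on UNIV u"
  obtains B where "B > 0" "\<And>x. \<bar>u x\<bar> \<le> B"
proof -
  have "bounded (range u)" using compact_continuous_image[OF assms(2,1)] by (rule compact_imp_bounded)
  then obtain B where "B > 0" "\<And>x. \<bar>u x\<bar> \<le> B" unfolding bounded_pos by auto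
  then show thesis by (rule that)
qed

lemma continuous_integrable_compact:
  fixes u :: "'a::metric_space \<Rightarrow> real"
  assumes "compact (UNIV :: 'a set)" "continuous_on UNIV u" "finite_measure M" "sets M = sets borel"
  shows "integrable M u"
proof -
  obtain B where B: "\<And>x. \<bar>u x\<bar> \<le> B" using continuous_bounded_compact[OF assms(1,2)] by metis
  have "u \<in> borel_measurable M"
    using borel_measurable_continuous_onI[OF assms(2)] assms(4) by (simp cong: measurable_cong_sets)
  then show ?thesis
    using B assms(3) by (intro finite_measure.integrable_const_bound[where B = B]) auto
qed

text \<open>As \<open>ennreal\<close> truncates negative numbers to 0, the densities
  \<open>w\<close> and \<open>- w\<close> are the positive and the negative part. The hypothesis
  says that the two measures agree on continuous functions, so both parts coincide almost everywhere
  and vanish.\<close>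

lemma AE_zero_if_continuous_integrals_zero:
  fixes w :: "'a::metric_space \<Rightarrow> real"
  assumes compact: "compact (UNIV :: 'a set)" and M: "finite_measure M" "sets M = sets borel"
    and w: "integrable M w"
    and zero: "\<And>u :: 'a \<Rightarrow> real. continuous_on UNIV u \<Longrightarrow> (LINT x|M. w x * u x) = 0"
  shows "AE x in M. w x = 0"
proof -
  interpret finite_measure M by (rule M)
  have wm [measurable]: "w \<in> borel_measurable M" using w by (rule borel_measurable_integrable)
  let ?P = "density M (\<lambda>x. ennreal (w x))" and ?N = "density M (\<lambda>x. ennreal (- w x))"
  have fin: "finite_measure ?P" "finite_measure ?N"
  proof -
    have "(\<integral>\<^sup>+x. ennreal (w x) \<partial>M) \<noteq> \<infinity>" "(\<integral>\<^sup>+x. ennreal (- w x) \<partial>M) \<noteq> \<infinity>"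
      using w by (auto simp: real_integrable_def)
    then show "finite_measure ?P" "finite_measure ?N"
      by (auto intro!: finite_measureI simp: emeasure_density cong: nn_integral_cong)
  qed
  have "?P = ?N"
  proof (rule measure_eq_if_continuous_integrals_eq[OF fin])
    fix u :: "'a \<Rightarrow> real" assume u: "continuous_on UNIV u" "\<And>x. 0 \<le> u x \<and> u x \<le> 1"
    have [measurable]: "u \<in> borel_measurable M"
      using borel_measurable_continuous_onI[OF u(1)] M(2) by (simp cong: measurable_cong_sets)
    have d: "density M (\<lambda>x. ennreal (v x)) = density M (\<lambda>x. ennreal (max 0 (v x)))" for v :: "'a \<Rightarrow> real"
      by (simp add: ennreal_max_0)
    have i: "integrable M (\<lambda>x. max 0 (v x) * u x)" if "integrable M v" for v
    proof (rule Bochner_Integration.integrable_bound[OF that])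
      show "AE x in M. norm (max 0 (v x) * u x) \<le> norm (v x)"
        using u(2) by (intro AE_I2) (auto simp: abs_mult max_def intro!: mult_right_le_one_le)
    qed (use that in measurable)
    have "(LINT x|?P. u x) = (LINT x|M. max 0 (w x) * u x)"
      by (subst d, subst integral_density) auto
    moreover have "(LINT x|?N. u x) = (LINT x|M. max 0 (- w x) * u x)"
      by (subst d, subst integral_density) auto
    moreover have "(LINT x|M. max 0 (w x) * u x) - (LINT x|M. max 0 (- w x) * u x) = (LINT x|M. w x * u x)"
    proof -
      have "w x * u x = max 0 (w x) * u x - max 0 (- w x) * u x" for x by (auto simp: max_def)
      then show ?thesis using i[OF w] i[of "\<lambda>x. - w x"] w by simp
    qed
    ultimately show "(LINT x|?P. u x) = (LINT x|?N. u x)" using zero[OF u(1)] by simp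
  qed (use M in auto)
  then have "AE x in M. ennreal (w x) = ennreal (- w x)"
    by (subst (asm) density_unique_iff) auto
  then show ?thesis
  proof eventually_elim
    case (elim x)
    then show ?case by (cases "w x \<ge> 0") (auto simp: ennreal_neg ennreal_eq_0_iff)
  qed
qed

text \<open>A primitive on the whole line: its derivatives are two-sided everywhere, and integrals
  over shifted intervals are differences of its values.\<close>

lemma primitive_exists:
  fixes v :: "real \<Rightarrow> real"
  assumes "continuous_on UNIV v"
  obtains F where "\<And>z. (F has_real_derivative v z) (at z)"
  using einterval_antiderivative[of "-\<infinity>" "\<infinity>" v] assms
  by (auto simp: continuous_on_eq_continuous_at has_real_derivative_iff_has_vector_derivative)

lemma integral_primitive:
  fixes v :: "real \<Rightarrow> real"
  assumes "a \<le> b" "\<And>z. (F has_real_derivative v z) (at z)"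
  shows "(v has_integral (F b - F a)) {a..b}" "integral {a..b} v = F b - F a"
proof -
  show "(v has_integral (F b - F a)) {a..b}"
    by (rule fundamental_theorem_of_calculus)
      (use assms in \<open>auto simp flip: has_real_derivative_iff_has_vector_derivative intro: DERIV_subset\<close>)
  then show "integral {a..b} v = F b - F a" by (rule integral_unique)
qed

lemma abs_integral_le:
  fixes v :: "real \<Rightarrow> real"
  assumes "a \<le> b" "continuous_on {a..b} v" "\<And>z. z \<in> {a..b} \<Longrightarrow> \<bar>v z\<bar> \<le> B"
  shows "\<bar>integral {a..b} v\<bar> \<le> B * (b - a)"
  using integral_bound[of a b v B] assms by auto

section \<open>Flows on compact metric spaces\<close>

locale compact_flow =
  fixes \<phi> :: "real \<Rightarrow> 'a::metric_space \<Rightarrow> 'a"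
  assumes compact_space: "compact (UNIV :: 'a set)" and continuous_flow: "continuous_flow \<phi>"
begin

lemma flow_0 [simp]: "\<phi> 0 x = x" and flow_add: "\<phi> (s + t) x = \<phi> s (\<phi> t x)"
  using continuous_flow by (auto simp: continuous_flow_def is_flow_def)

lemma flow_inverse [simp]: "\<phi> (- s) (\<phi> s x) = x" "\<phi> s (\<phi> (- s) x) = x"
  using flow_add[of "- s" s x] flow_add[of s "- s" x] by simp_all

lemma continuous_on_flow [continuous_intros]:
  assumes "continuous_on S t" "continuous_on S y"
  shows "continuous_on S (\<lambda>z. \<phi> (t z) (y z))"
proof -
  have "continuous_on UNIV (\<lambda>p. \<phi> (fst p) (snd p))"
    using continuous_flow by (simp add: continuous_flow_def split_beta)
  from continuous_on_compose2[OF this continuous_on_Pair[OF assms]] show ?thesis by simp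
qed

lemma continuous_on_compose_flow:
  assumes "continuous_on UNIV u" "continuous_on S t" "continuous_on S y"
  shows "continuous_on S (\<lambda>z. u (\<phi> (t z) (y z)))"
  using continuous_on_compose2[OF assms(1) continuous_on_flow[OF assms(2,3)]] by simp

lemma measurable_flow: "\<phi> s \<in> measurable borel borel"
  by (intro borel_measurable_continuous_onI continuous_intros)

lemma invariant_integral:
  fixes u :: "'a \<Rightarrow> real"
  assumes "invariant_probability \<phi> \<nu>" "continuous_on UNIV u"
  shows "(LINT x|\<nu>. u (\<phi> s x)) = (LINT x|\<nu>. u x)"
proof -
  have "(LINT x|distr \<nu> borel (\<phi> s). u x) = (LINT x|\<nu>. u (\<phi> s x))"
    using assms measurable_flow borel_measurable_continuous_onI[OF assms(2)]
    by (intro integral_distr) (auto simp: invariant_probability_def cong: measurable_cong_sets)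
  then show ?thesis using assms by (simp add: invariant_probability_def)
qed

text \<open>Negative times follow by applying the hypothesis at time \<open>- s\<close> to
  \<open>u \<circ> \<phi> s\<close>. Restricting to \<open>s \<ge> 0\<close> suits integrals over
  \<open>{0..s}\<close>.\<close>

lemma invariant_probabilityI:
  assumes \<nu>: "prob_space \<nu>" "sets \<nu> = sets borel"
    and inv: "\<And>s (u :: 'a \<Rightarrow> real). s \<ge> 0 \<Longrightarrow> continuous_on UNIV u \<Longrightarrow> (LINT x|\<nu>. u (\<phi> s x)) = (LINT x|\<nu>. u x)"
  shows "invariant_probability \<phi> \<nu>"
proof -
  have m: "\<phi> s \<in> measurable \<nu> borel" for s using measurable_flow \<nu>(2) by (simp cong: measurable_cong_sets)
  have "distr \<nu> borel (\<phi> s) = \<nu>" for s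
  proof (rule measure_eq_if_continuous_integrals_eq)
    show "finite_measure (distr \<nu> borel (\<phi> s))"
      by (rule prob_space.axioms(1)[OF prob_space.prob_space_distr[OF \<nu>(1) m]])
    fix u :: "'a \<Rightarrow> real" assume u: "continuous_on UNIV u"
    have "(LINT x|\<nu>. u (\<phi> s x)) = (LINT x|\<nu>. u x)"
    proof (cases "s \<ge> 0")
      case False
      have "continuous_on UNIV (\<lambda>x. u (\<phi> s x))" by (intro continuous_on_compose_flow[OF u] continuous_intros)
      then show ?thesis using inv[of "- s" "\<lambda>x. u (\<phi> s x)"] False by simp
    qed (use inv u in simp)
    then show "(LINT x|distr \<nu> borel (\<phi> s). u x) = (LINT x|\<nu>. u x)"
      using m borel_measurable_continuous_onI[OF u] by (subst integral_distr) auto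
  qed (use \<nu> in \<open>auto intro: prob_space.axioms(1)\<close>)
  then show ?thesis using \<nu> by (simp add: invariant_probability_def)
qed

text \<open>For \<open>s > 0\<close>, the empirical measure of an orbit segment: the uniform law on
  \<open>[0, s]\<close> carried along the orbit of \<open>y\<close>.\<close>

definition orbit_measure :: "real \<Rightarrow> 'a \<Rightarrow> 'a measure" where
  "orbit_measure s y = distr (density lborel (\<lambda>q. ennreal (indicator {0..s} q / s))) borel (\<lambda>q. \<phi> q y)"

lemma orbit_measure:
  assumes s: "s > 0"
  shows "prob_space (orbit_measure s y)" "sets (orbit_measure s y) = sets borel"
    and "continuous_on UNIV u \<Longrightarrow> (LINT x|orbit_measure s y. u x) = integral {0..s} (\<lambda>q. u (\<phi> q y)) / s"
proof -
  let ?U = "density lborel (\<lambda>q. ennreal (indicator {0..s} q / s))"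
  have m: "(\<lambda>q. \<phi> q y) \<in> measurable ?U borel"
    by (simp, intro borel_measurable_continuous_onI continuous_intros)
  have "prob_space ?U"
  proof (rule prob_spaceI)
    have "emeasure ?U (space ?U) = (\<integral>\<^sup>+q. ennreal (1 / s) * indicator {0..s} q \<partial>lborel)"
      by (simp add: emeasure_density) (auto intro!: nn_integral_cong simp: indicator_def)
    also have "\<dots> = 1" using s by (simp add: nn_integral_cmult_indicator flip: ennreal_mult)
    finally show "emeasure ?U (space ?U) = 1" .
  qed
  then show "prob_space (orbit_measure s y)"
    unfolding orbit_measure_def using m by (rule prob_space.prob_space_distr)
  show "sets (orbit_measure s y) = sets borel" by (simp add: orbit_measure_def)
  show "(LINT x|orbit_measure s y. u x) = integral {0..s} (\<lambda>q. u (\<phi> q y)) / s" if u: "continuous_on UNIV u"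
  proof -
    have c: "continuous_on UNIV (\<lambda>q. u (\<phi> q y))" by (intro continuous_on_compose_flow[OF u] continuous_intros)
    have "(LINT x|orbit_measure s y. u x) = (LINT q|?U. u (\<phi> q y))"
      unfolding orbit_measure_def using m borel_measurable_continuous_onI[OF u] by (rule integral_distr)
    also have "\<dots> = (LINT q|lborel. indicator {0..s} q / s * u (\<phi> q y))"
      using s borel_measurable_continuous_onI[OF c] by (subst integral_density) auto
    also have "\<dots> = (LINT q:{0..s}|lborel. u (\<phi> q y)) / s"
      by (simp add: set_lebesgue_integral_def)
    also have "\<dots> = integral {0..s} (\<lambda>q. u (\<phi> q y)) / s"
      using borel_integrable_atLeastAtMost'[OF continuous_on_subset[OF c]]
      by (simp add: set_borel_integral_eq_integral)
    finally show ?thesis .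
  qed
qed

text \<open>Krylov-Bogoliubov by contradiction: the empirical measures of ever longer segments with
  small average of \<open>G\<close> accumulate at an invariant probability under which
  \<open>G\<close> has mean at most 0. By uniqueness it would be \<open>\<mu>\<close>.\<close>

lemma uniquely_ergodic_linear_growth:
  fixes G :: "'a \<Rightarrow> real"
  assumes ue: "unique_invariant_probability \<phi> \<mu>" and G: "continuous_on UNIV G" and pos: "(LINT x|\<mu>. G x) > 0"
  obtains c s\<^sub>0 where "c > 0" "s\<^sub>0 > 0" "\<And>s y. s \<ge> s\<^sub>0 \<Longrightarrow> integral {0..s} (\<lambda>q. G (\<phi> q y)) \<ge> c * s"
proof -
  \<comment> \<open>One \<open>n\<close> supplies both the slope \<open>1 / (n + 1)\<close> and the
    threshold \<open>n + 1\<close>, so that the negation yields a single sequence of bad segments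
    with lengths tending to infinity.\<close>
  have "\<exists>n::nat. \<forall>s\<ge>real (Suc n). \<forall>y. integral {0..s} (\<lambda>q. G (\<phi> q y)) \<ge> (1 / real (Suc n)) * s"
  proof (rule ccontr)
    assume "\<not> ?thesis"
    then have "\<forall>n. \<exists>s y. s \<ge> real (Suc n) \<and> integral {0..s} (\<lambda>q. G (\<phi> q y)) < (1 / real (Suc n)) * s"
      by (meson not_le)
    then obtain s y where sy: "\<And>n. s n \<ge> real (Suc n)" "\<And>n. integral {0..s n} (\<lambda>q. G (\<phi> q (y n))) < (1 / real (Suc n)) * s n"
      by metis
    have s0: "s n > 0" for n using sy(1)[of n] by (rule less_le_trans[rotated]) simp
    define N where "N n = orbit_measure (s n) (y n)" for n
    have N: "prob_space (N n)" "sets (N n) = sets borel"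
      "continuous_on UNIV u \<Longrightarrow> (LINT x|N n. u x) = integral {0..s n} (\<lambda>q. u (\<phi> q (y n))) / s n" for n and u :: "'a \<Rightarrow> real"
      using orbit_measure(1,2)[OF s0[of n], of "y n"] orbit_measure(3)[OF s0[of n], of u "y n"] by (simp_all add: N_def)
    obtain r \<nu> where r: "strict_mono (r :: nat \<Rightarrow> nat)" and \<nu>: "prob_space \<nu>" "sets \<nu> = sets borel"
      and conv: "\<And>u :: 'a \<Rightarrow> real. continuous_on UNIV u \<Longrightarrow> (\<lambda>n. LINT x|N (r n). u x) \<longlonglongrightarrow> (LINT x|\<nu>. u x)"
      by (rule compact_prob_measures_subsequence[of N, OF compact_space N(1,2)]) blast
    have rn: "real n \<le> s (r n)" for n
      using sy(1)[of "r n"] seq_suble[OF r, of n] by linarith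
    have inv_lim: "(\<lambda>n. C / s (r n)) \<longlonglongrightarrow> 0" for C
    proof (rule tendsto_divide_0[OF tendsto_const])
      have "filterlim (\<lambda>n. s (r n)) at_top sequentially"
        by (rule filterlim_at_top_mono[OF filterlim_real_sequentially]) (use rn in auto)
      then show "filterlim (\<lambda>n. s (r n)) at_infinity sequentially" by (rule filterlim_at_top_imp_at_infinity)
    qed
    have "invariant_probability \<phi> \<nu>"
    proof (rule invariant_probabilityI[OF \<nu>])
      fix t :: real and u :: "'a \<Rightarrow> real" assume t: "t \<ge> 0" and u: "continuous_on UNIV u"
      obtain B where B: "\<And>x. \<bar>u x\<bar> \<le> B" using continuous_bounded_compact[OF compact_space u] by metis
      have ut: "continuous_on UNIV (\<lambda>x. u (\<phi> t x))" by (intro continuous_on_compose_flow[OF u] continuous_intros)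
      \<comment> \<open>Shifting a segment by \<open>t\<close> changes it only in two end pieces of
        length \<open>t\<close>, a negligible share of a long segment.\<close>
      have diff: "\<bar>(LINT x|N n. u (\<phi> t x)) - (LINT x|N n. u x)\<bar> \<le> 2 * t * B / s n" for n
      proof -
        let ?v = "\<lambda>q. u (\<phi> q (y n))"
        have v: "continuous_on UNIV ?v" by (intro continuous_on_compose_flow[OF u] continuous_intros)
        obtain F where F: "\<And>z. (F has_real_derivative ?v z) (at z)" using primitive_exists[OF v] by blast
        have Ft: "((\<lambda>z. F (z + t)) has_real_derivative ?v (z + t)) (at z)" for z
          using DERIV_shift[of F "?v (z + t)" z t] F by simp
        have "integral {0..s n} (\<lambda>q. u (\<phi> t (\<phi> q (y n)))) = integral {0..s n} (\<lambda>q. ?v (q + t))"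
          by (simp add: flow_add[symmetric] add.commute)
        also have "\<dots> = F (s n + t) - F t"
          using integral_primitive(2)[OF less_imp_le[OF s0[of n]] Ft] by simp
        finally have 1: "integral {0..s n} (\<lambda>q. u (\<phi> t (\<phi> q (y n)))) = F (s n + t) - F t" .
        have "F (s n + t) - F (s n) = integral {s n..s n + t} ?v" "F t - F 0 = integral {0..t} ?v"
          using t by (simp_all add: integral_primitive(2)[OF _ F])
        moreover have "\<bar>integral {s n..s n + t} ?v\<bar> \<le> B * (s n + t - s n)" "\<bar>integral {0..t} ?v\<bar> \<le> B * (t - 0)"
          using t B by (intro abs_integral_le continuous_on_subset[OF v]; simp)+
        ultimately have "\<bar>(F (s n + t) - F t) - (F (s n) - F 0)\<bar> \<le> 2 * t * B"
          by (simp add: mult.commute)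
        then have "\<bar>((F (s n + t) - F t) - (F (s n) - F 0)) / s n\<bar> \<le> 2 * t * B / s n"
          using s0[of n] by (simp add: abs_divide divide_right_mono)
        then show ?thesis
          using N(3)[OF ut] N(3)[OF u] 1 integral_primitive(2)[OF less_imp_le[OF s0[of n]] F]
          by (simp add: diff_divide_distrib)
      qed
      have "(\<lambda>n. (LINT x|N (r n). u (\<phi> t x)) - (LINT x|N (r n). u x)) \<longlonglongrightarrow> 0"
        by (rule Lim_null_comparison[OF _ inv_lim[of "2 * t * B"]]) (use diff in auto)
      moreover have "(\<lambda>n. (LINT x|N (r n). u (\<phi> t x)) - (LINT x|N (r n). u x)) \<longlonglongrightarrow> (LINT x|\<nu>. u (\<phi> t x)) - (LINT x|\<nu>. u x)"
        by (intro tendsto_diff conv u ut)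
      ultimately show "(LINT x|\<nu>. u (\<phi> t x)) = (LINT x|\<nu>. u x)"
        using LIMSEQ_unique by fastforce
    qed
    then have "\<nu> = \<mu>" using ue by (simp add: unique_invariant_probability_def)
    have "(LINT x|\<nu>. G x) \<le> 0"
    proof (rule LIMSEQ_le[OF conv[OF G] LIMSEQ_Suc[OF lim_1_over_n]])
      have "(LINT x|N (r n). G x) \<le> 1 / real (Suc n)" for n
      proof -
        have "(LINT x|N (r n). G x) \<le> 1 / real (Suc (r n))"
          using sy(2)[of "r n"] s0[of "r n"] N(3)[OF G] by (simp add: pos_divide_le_eq)
        also have "\<dots> \<le> 1 / real (Suc n)" using seq_suble[OF r, of n] by (intro divide_left_mono) auto
        finally show ?thesis .
      qed
      then show "\<exists>N'. \<forall>n\<ge>N'. (LINT x|N (r n). G x) \<le> 1 / real (Suc n)" by blast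
    qed
    then show False using pos \<open>\<nu> = \<mu>\<close> by simp
  qed
  then obtain n :: nat where "\<And>s y. s \<ge> real (Suc n) \<Longrightarrow> integral {0..s} (\<lambda>q. G (\<phi> q y)) \<ge> (1 / real (Suc n)) * s"
    by blast
  then show thesis using that[of "1 / real (Suc n)" "real (Suc n)"] by simp
qed

end

section \<open>Differentiation along flows\<close>

text \<open>Differentiability is required along orbits only and at time 0; the flow property carries
  it to all times. Orbit averages of continuous functions qualify, which makes smoothing along a
  flow easy.\<close>

definition C1_along :: "(real \<Rightarrow> 'a \<Rightarrow> 'a) \<Rightarrow> ('a::topological_space \<Rightarrow> real) \<Rightarrow> ('a \<Rightarrow> real) \<Rightarrow> bool" where
  "C1_along \<phi> g g' \<longleftrightarrow> continuous_on UNIV g \<and> continuous_on UNIV g' \<and>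
     (\<forall>x. ((\<lambda>t. g (\<phi> t x)) has_real_derivative g' x) (at 0))"

lemma C1_along_continuous: "C1_along \<phi> g g' \<Longrightarrow> continuous_on UNIV g" "C1_along \<phi> g g' \<Longrightarrow> continuous_on UNIV g'"
  by (auto simp: C1_along_def)

lemma C1_along_0: "C1_along \<phi> g g' \<Longrightarrow> ((\<lambda>t. g (\<phi> t x)) has_real_derivative g' x) (at 0)"
  by (auto simp: C1_along_def)

text \<open>A substitute for joint differentiability: \<open>H\<close> is differentiable in
  \<open>p\<close>, and the mean value theorem writes an increment in \<open>p\<close> as the
  increment of \<open>T\<close> times a factor that converges because \<open>B\<close> is jointly
  continuous.\<close>

lemma mean_value_factor:
  fixes H B :: "real \<Rightarrow> real \<Rightarrow> real"
  assumes D: "\<And>r p. (H r has_real_derivative B r p) (at p)"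
    and B: "continuous_on UNIV (\<lambda>(r, p). B r p)" and T: "isCont T 0"
  obtains b where "\<And>r. H r (T r) - H r (T 0) = (T r - T 0) * b r" "(b \<longlongrightarrow> B 0 (T 0)) (at 0)"
proof -
  have "\<exists>\<xi>. \<bar>\<xi> - T 0\<bar> \<le> \<bar>T r - T 0\<bar> \<and> H r (T r) - H r (T 0) = (T r - T 0) * B r \<xi>" for r
  proof (cases "T r" "T 0" rule: linorder_cases)
    case less
    obtain z where "T r < z" "z < T 0" "H r (T 0) - H r (T r) = (T 0 - T r) * B r z"
      using MVT2[OF less, of "H r" "B r"] D by blast
    then show ?thesis by (intro exI[of _ z]) (auto simp: algebra_simps)
  next
    case greater
    obtain z where "T 0 < z" "z < T r" "H r (T r) - H r (T 0) = (T r - T 0) * B r z"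
      using MVT2[OF greater, of "H r" "B r"] D by blast
    then show ?thesis by (intro exI[of _ z]) auto
  qed auto
  then obtain \<xi> where \<xi>: "\<And>r. \<bar>\<xi> r - T 0\<bar> \<le> \<bar>T r - T 0\<bar>" "\<And>r. H r (T r) - H r (T 0) = (T r - T 0) * B r (\<xi> r)"
    by metis
  have T0: "((\<lambda>r. \<bar>T r - T 0\<bar>) \<longlongrightarrow> 0) (at 0)"
    using T by (intro tendsto_rabs_zero) (simp add: isCont_def LIM_zero)
  have "((\<lambda>r. \<xi> r - T 0) \<longlongrightarrow> 0) (at 0)"
    by (rule Lim_null_comparison[OF _ T0]) (simp add: \<xi>)
  then have "(\<xi> \<longlongrightarrow> T 0) (at 0)" by (simp add: LIM_zero_iff)
  then have "((\<lambda>r. (r, \<xi> r)) \<longlongrightarrow> (0, T 0)) (at 0)" by (intro tendsto_Pair tendsto_ident_at)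
  moreover have "isCont (\<lambda>(r, p). B r p) (0, T 0)" using B by (simp add: continuous_on_eq_continuous_at)
  ultimately have "((\<lambda>r. B r (\<xi> r)) \<longlongrightarrow> B 0 (T 0)) (at 0)"
    using isCont_tendsto_compose[of "(0, T 0)" "\<lambda>(r, p). B r p" "\<lambda>r. (r, \<xi> r)"] by simp
  with \<xi>(2) show thesis by (rule that)
qed

lemma has_real_derivative_at_0_iff:
  fixes h :: "real \<Rightarrow> real"
  shows "(h has_real_derivative D) (at 0) \<longleftrightarrow> ((\<lambda>r. (h r - h 0) / r) \<longlongrightarrow> D) (at 0)"
  by (simp add: has_field_derivative_iff)

text \<open>A chain rule that asks for the derivative in \<open>r\<close> only with \<open>p\<close>
  frozen at \<open>T 0\<close>; the variation of \<open>p\<close> is absorbed by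
  \<open>mean_value_factor\<close>.\<close>

lemma derivative_two_variables:
  fixes H B :: "real \<Rightarrow> real \<Rightarrow> real"
  assumes D: "\<And>r p. (H r has_real_derivative B r p) (at p)"
    and B: "continuous_on UNIV (\<lambda>(r, p). B r p)"
    and A: "((\<lambda>r. H r (T 0)) has_real_derivative A) (at 0)" and T: "(T has_real_derivative T') (at 0)"
  shows "((\<lambda>r. H r (T r)) has_real_derivative A + T' * B 0 (T 0)) (at 0)"
proof -
  obtain b where b: "\<And>r. H r (T r) - H r (T 0) = (T r - T 0) * b r" "(b \<longlongrightarrow> B 0 (T 0)) (at 0)"
    using mean_value_factor[OF D B DERIV_isCont[OF T]] by blast
  have eq: "(H r (T r) - H 0 (T 0)) / r = (H r (T 0) - H 0 (T 0)) / r + (T r - T 0) / r * b r" for r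
    using b(1)[of r] by (simp add: diff_divide_distrib[symmetric] add_divide_distrib[symmetric] algebra_simps)
  show ?thesis
    unfolding has_real_derivative_at_0_iff eq
    by (intro tendsto_add tendsto_mult b) (use A T in \<open>simp_all add: has_real_derivative_at_0_iff\<close>)
qed

text \<open>Existence and continuity of the implicit function \<open>T\<close> are given, so only
  its slope has to be found, by solving the factored increment for \<open>T r - T 0\<close>.\<close>

lemma derivative_implicit:
  fixes H B :: "real \<Rightarrow> real \<Rightarrow> real"
  assumes D: "\<And>r p. (H r has_real_derivative B r p) (at p)"
    and B: "continuous_on UNIV (\<lambda>(r, p). B r p)" and nz: "B 0 (T 0) \<noteq> 0"
    and A: "((\<lambda>r. H r (T 0)) has_real_derivative A) (at 0)" and T: "isCont T 0"
    and const: "\<And>r. H r (T r) = s"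
  shows "(T has_real_derivative - A / B 0 (T 0)) (at 0)"
proof -
  obtain b where b: "\<And>r. H r (T r) - H r (T 0) = (T r - T 0) * b r" "(b \<longlongrightarrow> B 0 (T 0)) (at 0)"
    using mean_value_factor[OF D B T] by blast
  have "\<forall>\<^sub>F r in at 0. b r \<noteq> 0" using b(2) nz by (rule tendsto_imp_eventually_ne)
  then have ev: "\<forall>\<^sub>F r in at 0. - ((H r (T 0) - H 0 (T 0)) / r) / b r = (T r - T 0) / r"
  proof eventually_elim
    case (elim r)
    have "H 0 (T 0) - H r (T 0) = (T r - T 0) * b r" using b(1)[of r] const by metis
    then have "(T r - T 0) = (H 0 (T 0) - H r (T 0)) / b r" using elim by simp
    then show ?case by (simp add: divide_simps)
  qed
  have "((\<lambda>r. - ((H r (T 0) - H 0 (T 0)) / r) / b r) \<longlongrightarrow> - A / B 0 (T 0)) (at 0)"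
    by (intro tendsto_divide tendsto_minus b nz) (use A in \<open>simp add: has_real_derivative_at_0_iff\<close>)
  then show ?thesis unfolding has_real_derivative_at_0_iff by (rule Lim_transform_eventually[OF _ ev])
qed

context compact_flow
begin

lemma C1_along_at:
  assumes "C1_along \<phi> g g'"
  shows "((\<lambda>t. g (\<phi> t x)) has_real_derivative g' (\<phi> t x)) (at t)"
proof -
  have "((\<lambda>h. g (\<phi> h (\<phi> t x))) has_real_derivative g' (\<phi> t x)) (at 0)" using assms by (rule C1_along_0)
  then have "((\<lambda>h. g (\<phi> (h + t) x)) has_real_derivative g' (\<phi> t x)) (at 0)" by (simp add: flow_add)
  then show ?thesis using DERIV_shift[of "\<lambda>h. g (\<phi> h x)" "g' (\<phi> t x)" 0 t] by simp
qed

lemma C1_along_mult: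
  assumes "C1_along \<phi> g g'" "C1_along \<phi> h h'"
  shows "C1_along \<phi> (\<lambda>x. g x * h x) (\<lambda>x. g' x * h x + g x * h' x)"
  unfolding C1_along_def
proof (intro conjI allI)
  show "((\<lambda>t. g (\<phi> t x) * h (\<phi> t x)) has_real_derivative g' x * h x + g x * h' x) (at 0)" for x
    using DERIV_mult[OF C1_along_0[OF assms(1)] C1_along_0[OF assms(2)], of x x] by (simp add: ac_simps)
qed (auto intro!: continuous_intros C1_along_continuous[OF assms(1)] C1_along_continuous[OF assms(2)])

lemma C1_along_divide:
  assumes "C1_along \<phi> g g'" "C1_along \<phi> h h'" "\<And>x. h x \<noteq> 0"
  shows "C1_along \<phi> (\<lambda>x. g x / h x) (\<lambda>x. (g' x * h x - g x * h' x) / (h x * h x))"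
  unfolding C1_along_def
proof (intro conjI allI)
  show "((\<lambda>t. g (\<phi> t x) / h (\<phi> t x)) has_real_derivative (g' x * h x - g x * h' x) / (h x * h x)) (at 0)" for x
    using DERIV_divide[OF C1_along_0[OF assms(1)] C1_along_0[OF assms(2)], of x x] assms(3) by simp
qed (use assms(3) in \<open>auto intro!: continuous_intros C1_along_continuous[OF assms(1)] C1_along_continuous[OF assms(2)]\<close>)

lemma C1_along_scale:
  assumes "C1_along \<phi> g g'"
  shows "C1_along \<phi> (\<lambda>x. c * g x) (\<lambda>x. c * g' x)"
  unfolding C1_along_def
  by (auto intro!: continuous_intros C1_along_continuous[OF assms] DERIV_cmult C1_along_0[OF assms])

text \<open>By invariance every difference quotient has integral zero, and by the mean value theorem
  the quotients are bounded by the supremum of \<open>\<bar>g'\<bar>\<close>, so dominated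
  convergence applies.\<close>

lemma integral_C1_along_zero:
  assumes inv: "prob_space \<nu>" "sets \<nu> = sets borel"
    "\<And>s (u :: 'a \<Rightarrow> real). continuous_on UNIV u \<Longrightarrow> (LINT x|\<nu>. u (\<phi> s x)) = (LINT x|\<nu>. u x)"
    and g: "C1_along \<phi> g g'"
  shows "(LINT x|\<nu>. g' x) = 0"
proof -
  interpret prob_space \<nu> by (rule inv)
  note c = C1_along_continuous[OF g]
  obtain B where B: "\<And>x. \<bar>g' x\<bar> \<le> B" using continuous_bounded_compact[OF compact_space c(2)] by metis
  define t where "t n = 1 / real (Suc n)" for n
  have t: "t n > 0" for n by (simp add: t_def)
  have ci: "integrable \<nu> u" if "continuous_on UNIV u" for u :: "'a \<Rightarrow> real"
    using continuous_integrable_compact[OF compact_space that finite_measure_axioms inv(2)] .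
  have cm: "u \<in> borel_measurable \<nu>" if "continuous_on UNIV u" for u :: "'a \<Rightarrow> real"
    using ci[OF that] by simp
  have gt: "continuous_on UNIV (\<lambda>x. g (\<phi> (t n) x))" for n by (intro continuous_on_compose_flow[OF c(1)] continuous_intros)
  have lim: "(\<lambda>n. LINT x|\<nu>. (g (\<phi> (t n) x) - g x) / t n) \<longlonglongrightarrow> (LINT x|\<nu>. g' x)"
  proof (rule integral_dominated_convergence[where w = "\<lambda>_. B"])
    show "g' \<in> borel_measurable \<nu>" by (intro cm c)
    show "(\<lambda>x. (g (\<phi> (t n) x) - g x) / t n) \<in> borel_measurable \<nu>" for n
      using cm[OF gt] cm[OF c(1)] by measurable
    have "t \<longlonglongrightarrow> 0" unfolding t_def by (rule LIMSEQ_Suc[OF lim_1_over_n])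
    then have "filterlim t (at 0) sequentially"
      unfolding filterlim_at using t less_imp_neq[OF t, symmetric] by auto
    moreover have "((\<lambda>r. (g (\<phi> r x) - g x) / r) \<longlongrightarrow> g' x) (at 0)" for x
      using C1_along_0[OF g, of x] by (simp add: has_real_derivative_at_0_iff)
    ultimately show "AE x in \<nu>. (\<lambda>n. (g (\<phi> (t n) x) - g x) / t n) \<longlonglongrightarrow> g' x"
      by (intro AE_I2) (rule filterlim_compose)
    show "AE x in \<nu>. norm ((g (\<phi> (t n) x) - g x) / t n) \<le> B" for n
    proof (rule AE_I2)
      fix x
      obtain z where "g (\<phi> (t n) x) - g (\<phi> 0 x) = (t n - 0) * g' (\<phi> z x)"
        using MVT2[OF t[of n], of "\<lambda>r. g (\<phi> r x)" "\<lambda>r. g' (\<phi> r x)"] C1_along_at[OF g] by blast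
      then have "(g (\<phi> (t n) x) - g x) / t n = g' (\<phi> z x)" using t[of n] by simp
      then show "norm ((g (\<phi> (t n) x) - g x) / t n) \<le> B" using B by simp
    qed
  qed simp
  have zero: "(LINT x|\<nu>. (g (\<phi> (t n) x) - g x) / t n) = 0" for n
    using inv(3)[OF c(1), of "t n"] ci[OF gt] ci[OF c(1)] by simp
  show ?thesis using lim unfolding zero by (simp add: LIMSEQ_const_iff)
qed

text \<open>With a primitive \<open>F\<close> of \<open>u\<close> along the orbit of
  \<open>x\<close>, the integral based at \<open>\<phi> t x\<close> is
  \<open>F (r + t) - F t\<close>. Thus averaging a merely continuous \<open>u\<close> produces
  differentiability along the flow.\<close>

lemma C1_along_orbit_integral:
  assumes u: "continuous_on UNIV u" and r: "r \<ge> 0"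
  shows "C1_along \<phi> (\<lambda>x. integral {0..r} (\<lambda>p. u (\<phi> p x))) (\<lambda>x. u (\<phi> r x) - u x)"
  unfolding C1_along_def
proof (intro conjI allI)
  have "continuous_on UNIV (\<lambda>x. integral (cbox 0 r) (\<lambda>p. u (\<phi> p x)))"
    by (rule integral_continuous_on_param) (auto simp: split_beta intro!: continuous_on_compose_flow[OF u] continuous_intros u)
  then show "continuous_on UNIV (\<lambda>x. integral {0..r} (\<lambda>p. u (\<phi> p x)))" by simp
  show "continuous_on UNIV (\<lambda>x. u (\<phi> r x) - u x)" by (intro continuous_on_compose_flow[OF u] continuous_intros u)
  fix x
  have v: "continuous_on UNIV (\<lambda>p. u (\<phi> p x))" by (intro continuous_on_compose_flow[OF u] continuous_intros)
  obtain F where F: "\<And>z. (F has_real_derivative u (\<phi> z x)) (at z)" using primitive_exists[OF v] by blast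
  have "integral {0..r} (\<lambda>p. u (\<phi> p (\<phi> t x))) = F (r + t) - F t" for t
  proof -
    have "((\<lambda>z. F (z + t)) has_real_derivative u (\<phi> z (\<phi> t x))) (at z)" for z
      using DERIV_shift[of F "u (\<phi> (z + t) x)" z t] F[of "z + t"] by (simp add: flow_add)
    from integral_primitive(2)[OF r this] show ?thesis by simp
  qed
  moreover have "((\<lambda>t. F (r + t) - F t) has_real_derivative u (\<phi> r x) - u (\<phi> 0 x)) (at 0)"
    using DERIV_shift[of F "u (\<phi> r x)" 0 r] F[of r] by (intro DERIV_diff F) (simp add: add.commute)
  ultimately show "((\<lambda>t. integral {0..r} (\<lambda>p. u (\<phi> p (\<phi> t x)))) has_real_derivative u (\<phi> r x) - u x) (at 0)" by simp
qed

lemma orbit_average_close: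
  fixes u :: "'a \<Rightarrow> real"
  assumes u: "continuous_on UNIV u" and e: "\<epsilon> > 0"
  obtains r where "r > 0" "\<And>x. \<bar>(1 / r) * integral {0..r} (\<lambda>p. u (\<phi> p x)) - u x\<bar> \<le> \<epsilon>"
proof -
  have "compact ({0..1::real} \<times> (UNIV :: 'a set))" by (intro compact_Times compact_space) simp
  moreover have "continuous_on ({0..1::real} \<times> UNIV) (\<lambda>z. u (\<phi> (fst z) (snd z)))" by (intro continuous_on_compose_flow[OF u] continuous_intros)
  ultimately have "uniformly_continuous_on ({0..1::real} \<times> (UNIV :: 'a set)) (\<lambda>z. u (\<phi> (fst z) (snd z)))"
    by (rule compact_uniformly_continuous[rotated])
  then obtain d where d: "d > 0"
    "\<And>z z'. z \<in> {0..1::real} \<times> (UNIV :: 'a set) \<Longrightarrow> z' \<in> {0..1} \<times> UNIV \<Longrightarrow> dist z' z < d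
       \<Longrightarrow> dist (u (\<phi> (fst z') (snd z'))) (u (\<phi> (fst z) (snd z))) < \<epsilon>"
    using e unfolding uniformly_continuous_on_def by metis
  define r where "r = min 1 (d / 2)"
  have r: "r > 0" "r \<le> 1" "r < d" using d(1) by (auto simp: r_def)
  have close: "\<bar>u (\<phi> p x) - u x\<bar> \<le> \<epsilon>" if "p \<in> {0..r}" for p x
    using d(2)[of "(0, x)" "(p, x)"] that r by (simp add: dist_Pair_Pair dist_real_def)
  have "\<bar>(1 / r) * integral {0..r} (\<lambda>p. u (\<phi> p x)) - u x\<bar> \<le> \<epsilon>" for x
  proof -
    have c: "continuous_on {0..r} (\<lambda>p. u (\<phi> p x))" by (intro continuous_on_compose_flow[OF u] continuous_intros)
    have "integral {0..r} (\<lambda>p. u (\<phi> p x) - u x) = integral {0..r} (\<lambda>p. u (\<phi> p x)) - r * u x"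
      using r by (subst Henstock_Kurzweil_Integration.integral_diff) (auto intro!: integrable_continuous_real c)
    moreover have "\<bar>integral {0..r} (\<lambda>p. u (\<phi> p x) - u x)\<bar> \<le> \<epsilon> * (r - 0)"
      using r close by (intro abs_integral_le) (auto intro!: continuous_on_compose_flow[OF u] continuous_intros u)
    ultimately have "\<bar>integral {0..r} (\<lambda>p. u (\<phi> p x)) - r * u x\<bar> / r \<le> \<epsilon>" using r by (simp add: divide_le_eq mult.commute)
    moreover have "(1 / r) * integral {0..r} (\<lambda>p. u (\<phi> p x)) - u x = (integral {0..r} (\<lambda>p. u (\<phi> p x)) - r * u x) / r"
      using r by (simp add: field_simps)
    ultimately show ?thesis using r by (simp add: abs_divide)
  qed
  with r(1) show thesis by (rule that)
qed

end

section \<open>Reweighting invariant measures under a time change\<close>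

definition weighted :: "('a \<Rightarrow> real) \<Rightarrow> 'a measure \<Rightarrow> 'a measure" where
  "weighted w N = density N (\<lambda>x. ennreal (w x / (LINT x|N. w x)))"

lemma weighted:
  fixes w :: "'a::metric_space \<Rightarrow> real"
  assumes compact: "compact (UNIV :: 'a set)" and N: "prob_space N" "sets N = sets borel"
    and w: "continuous_on UNIV w" "\<And>x. w x > 0"
  shows "(LINT x|N. w x) > 0" "prob_space (weighted w N)" "sets (weighted w N) = sets borel"
    and "continuous_on UNIV u \<Longrightarrow> (LINT x|weighted w N. u x) = (LINT x|N. w x * u x) / (LINT x|N. w x)"
proof -
  interpret prob_space N by (rule N)
  have wi: "integrable N w" using continuous_integrable_compact[OF compact w(1) finite_measure_axioms N(2)] .
  show pos: "(LINT x|N. w x) > 0"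
  proof -
    have "(LINT x|N. w x) \<noteq> 0"
    proof
      assume "(LINT x|N. w x) = 0"
      then have "AE x in N. w x = 0"
        using wi w(2) by (subst (asm) integral_nonneg_eq_0_iff_AE) (auto intro: less_imp_le)
      then have "AE x in N. False" by eventually_elim (use w(2) in \<open>metis less_irrefl\<close>)
      then show False using AE_False by simp
    qed
    moreover have "(LINT x|N. w x) \<ge> 0" using w(2) by (intro integral_nonneg_AE AE_I2) (auto intro: less_imp_le)
    ultimately show ?thesis by simp
  qed
  let ?c = "LINT x|N. w x"
  have nn: "0 \<le> w x / ?c" for x using w(2)[of x] pos by simp
  have wm [measurable]: "w \<in> borel_measurable N" using wi by simp
  show "prob_space (weighted w N)"
  proof (rule prob_spaceI)
    have "emeasure (weighted w N) (space (weighted w N)) = (\<integral>\<^sup>+x. ennreal (w x / ?c) \<partial>N)"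
      unfolding weighted_def by (simp add: emeasure_density cong: nn_integral_cong)
    also have "\<dots> = ennreal (LINT x|N. w x / ?c)" using wi nn by (intro nn_integral_eq_integral) auto
    also have "\<dots> = 1" using pos by simp
    finally show "emeasure (weighted w N) (space (weighted w N)) = 1" .
  qed
  show "sets (weighted w N) = sets borel" using N by (simp add: weighted_def)
  show "(LINT x|weighted w N. u x) = (LINT x|N. w x * u x) / ?c" if u: "continuous_on UNIV u"
  proof -
    have um: "u \<in> borel_measurable N"
      using continuous_integrable_compact[OF compact u finite_measure_axioms N(2)] by simp
    have "(LINT x|weighted w N. u x) = (LINT x|N. (w x / ?c) *\<^sub>R u x)"
      unfolding weighted_def using um nn by (intro integral_density) auto
    then show ?thesis by simp
  qed
qed

text \<open>For the primitive \<open>\<integral>\<^sub>0\<^sup>r u \<circ> \<phi>'\<^sub>p dp\<close> of \<open>u \<circ> \<phi>'\<^sub>r - u\<close> along \<open>\<phi>'\<close>, the function \<open>w (u \<circ> \<phi>'\<^sub>r - u)\<close> is a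
  derivative along \<open>\<phi>\<close> and therefore has integral zero.\<close>

lemma invariant_weighted:
  assumes flows: "compact_flow \<phi>" "compact_flow \<phi>'"
    and w: "continuous_on UNIV w" "\<And>x. w x > 0"
    and change: "\<And>g g'. C1_along \<phi>' g g' \<Longrightarrow> C1_along \<phi> g (\<lambda>x. w x * g' x)"
    and inv: "invariant_probability \<phi> \<nu>"
  shows "invariant_probability \<phi>' (weighted w \<nu>)"
proof -
  interpret A: compact_flow \<phi> by fact
  interpret B: compact_flow \<phi>' by fact
  have \<nu>: "prob_space \<nu>" "sets \<nu> = sets borel" using inv by (auto simp: invariant_probability_def)
  interpret prob_space \<nu> by (rule \<nu>)
  note W = weighted[OF A.compact_space \<nu> w]
  show ?thesis
  proof (rule B.invariant_probabilityI[OF W(2,3)])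
    fix s :: real and u :: "'a \<Rightarrow> real" assume s: "s \<ge> 0" and u: "continuous_on UNIV u"
    have us: "continuous_on UNIV (\<lambda>x. u (\<phi>' s x))" by (intro B.continuous_on_compose_flow[OF u] continuous_intros)
    have "(LINT x|\<nu>. w x * (u (\<phi>' s x) - u x)) = 0"
      by (rule A.integral_C1_along_zero[OF \<nu> A.invariant_integral[OF inv] change[OF B.C1_along_orbit_integral[OF u s]]])
    moreover have "(LINT x|\<nu>. w x * (u (\<phi>' s x) - u x)) = (LINT x|\<nu>. w x * u (\<phi>' s x)) - (LINT x|\<nu>. w x * u x)"
      using continuous_integrable_compact[OF A.compact_space continuous_on_mult[OF w(1) us] finite_measure_axioms \<nu>(2)]
        continuous_integrable_compact[OF A.compact_space continuous_on_mult[OF w(1) u] finite_measure_axioms \<nu>(2)]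
      by (simp add: right_diff_distrib)
    ultimately show "(LINT x|weighted w \<nu>. u (\<phi>' s x)) = (LINT x|weighted w \<nu>. u x)"
      using W(4)[OF us] W(4)[OF u] by simp
  qed
qed

section \<open>Time changes of uniformly expanding flows\<close>

text \<open>The chart-free form of the situation: compact flows, derivatives along them, and the
  cocycle \<open>\<tau>\<close> with rate \<open>1 / \<rho>\<close> at the current point. The
  expansion constant is written \<open>exp a\<close>.\<close>

locale expanding_time_change =
  F: compact_flow f + P: compact_flow \<phi> + Q: compact_flow \<phi>'
  for f \<phi> \<phi>' :: "real \<Rightarrow> 'a::metric_space \<Rightarrow> 'a" +
  fixes a :: real and \<tau> :: "'a \<Rightarrow> real \<Rightarrow> real" and \<rho> X\<rho> XG VG :: "'a \<Rightarrow> real" and \<mu> :: "'a measure"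
  assumes a_pos: "a > 0"
    and expand: "\<And>t s x. f t (\<phi>' s x) = \<phi>' (exp (a * t) * s) (f t x)"
    and reparam: "\<And>s x. \<phi> s x = \<phi>' (\<tau> x s) x" and \<tau>_0: "\<And>x. \<tau> x 0 = 0"
    and \<tau>_mono: "\<And>x. strict_mono (\<tau> x)"
    and \<tau>_deriv: "\<And>x s. (\<tau> x has_real_derivative 1 / \<rho> (\<phi> s x)) (at s)"
    and \<tau>_cont: "\<And>s. continuous_on UNIV (\<lambda>x. \<tau> x s)"
    and \<rho>_pos: "\<And>x. \<rho> x > 0" and \<rho>_along: "C1_along f \<rho> X\<rho>"
    and G_along: "C1_along f (\<lambda>x. a + X\<rho> x / \<rho> x) XG" "C1_along \<phi> (\<lambda>x. a + X\<rho> x / \<rho> x) VG"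
    and ergodic: "unique_invariant_probability \<phi> \<mu>"
begin

text \<open>The element of \<open>\<phi>\<close>-time is \<open>\<rho> dp\<close> in terms of the
  time \<open>p\<close> of \<open>\<phi>'\<close>, and \<open>f r\<close> turns it into
  \<open>exp (a r) (\<rho> \<circ> f r) dp\<close>. Thus \<open>G\<close> is the logarithmic rate at
  which \<open>f\<close> stretches \<open>\<phi>\<close>-time.\<close>

definition G :: "'a \<Rightarrow> real" where "G x = a + X\<rho> x / \<rho> x"

lemma G_f: "C1_along f G XG" and G_\<phi>: "C1_along \<phi> G VG"
  using G_along by (simp_all add: G_def[abs_def])

lemma \<rho>_cont: "continuous_on UNIV \<rho>" and X\<rho>_cont: "continuous_on UNIV X\<rho>" and G_cont: "continuous_on UNIV G"
  using C1_along_continuous[OF \<rho>_along] C1_along_continuous[OF G_f] by auto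

lemma \<rho>_nz: "\<rho> x \<noteq> 0" using \<rho>_pos[of x] by simp

lemma \<rho>_G: "\<rho> x * G x = a * \<rho> x + X\<rho> x"
  using \<rho>_nz[of x] by (simp add: G_def field_simps)

lemma C1_along_\<phi>:
  assumes "C1_along \<phi>' g g'"
  shows "C1_along \<phi> g (\<lambda>x. (1 / \<rho> x) * g' x)"
  unfolding C1_along_def
proof (intro conjI allI)
  fix x
  have "((\<lambda>s. g (\<phi>' (\<tau> x s) x)) has_real_derivative g' x * (1 / \<rho> x)) (at 0)"
    using DERIV_chain2[of "\<lambda>p. g (\<phi>' p x)" "g' x" "\<tau> x" 0 "1 / \<rho> (\<phi> 0 x)"] C1_along_0[OF assms, of x] \<tau>_deriv[of x 0]
    by (simp add: \<tau>_0)
  then show "((\<lambda>s. g (\<phi> s x)) has_real_derivative (1 / \<rho> x) * g' x) (at 0)"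
    by (simp add: reparam[symmetric] mult.commute)
qed (auto intro!: continuous_intros C1_along_continuous[OF assms] \<rho>_cont simp: \<rho>_nz)

text \<open>The chain rule for the inverse of \<open>\<tau> x\<close>. An inverse near 0 suffices;
  it exists between \<open>\<tau> x (- 1)\<close> and \<open>\<tau> x 1\<close> by the intermediate
  value theorem.\<close>

lemma C1_along_\<phi>':
  assumes "C1_along \<phi> g g'"
  shows "C1_along \<phi>' g (\<lambda>x. \<rho> x * g' x)"
  unfolding C1_along_def
proof (intro conjI allI)
  fix x
  have inj: "inj (\<tau> x)" using \<tau>_mono by (rule strict_mono_imp_inj_on)
  define \<kappa> where "\<kappa> = inv (\<tau> x)"
  have \<kappa>\<tau>: "\<kappa> (\<tau> x s) = s" for s by (simp add: \<kappa>_def inj)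
  have \<tau>c: "isCont (\<tau> x) s" for s using \<tau>_deriv by (rule DERIV_isCont)
  have \<kappa>0: "\<kappa> 0 = 0" using \<kappa>\<tau>[of 0] by (simp add: \<tau>_0)
  have neg: "\<tau> x (-1) < 0" "0 < \<tau> x 1" using strict_monoD[OF \<tau>_mono, of "-1" 0 x] strict_monoD[OF \<tau>_mono, of 0 1 x] by (simp_all add: \<tau>_0)
  have \<tau>\<kappa>: "\<tau> x (\<kappa> p) = p" if "\<tau> x (-1) < p" "p < \<tau> x 1" for p
  proof -
    have "\<exists>s\<ge>-1. s \<le> 1 \<and> \<tau> x s = p" using that \<tau>c by (intro IVT) auto
    then obtain s where "\<tau> x s = p" by blast
    then show ?thesis using \<kappa>\<tau>[of s] by simp
  qed
  have "isCont \<kappa> (\<tau> x 0)" by (rule isCont_inverse_function[where d = 1]) (auto simp: \<kappa>\<tau> \<tau>c)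
  then have "isCont \<kappa> 0" by (simp add: \<tau>_0)
  then have D\<kappa>: "(\<kappa> has_real_derivative inverse (1 / \<rho> x)) (at 0)"
    by (intro DERIV_inverse_function[where a = "\<tau> x (-1)" and b = "\<tau> x 1" and f = "\<tau> x"])
      (use \<tau>_deriv[of x 0] \<rho>_nz neg \<tau>\<kappa> \<kappa>0 in auto)
  have "((\<lambda>p. g (\<phi> (\<kappa> p) x)) has_real_derivative g' x * \<rho> x) (at 0)"
    using DERIV_chain2[of "\<lambda>s. g (\<phi> s x)" "g' x" \<kappa> 0 "\<rho> x"] C1_along_0[OF assms, of x] D\<kappa> by (simp add: \<kappa>0)
  moreover have "\<forall>\<^sub>F p in nhds 0. g (\<phi> (\<kappa> p) x) = g (\<phi>' p x)"
  proof -
    have "\<forall>\<^sub>F p in nhds 0. p \<in> {\<tau> x (-1)<..<\<tau> x 1}" using neg by (intro eventually_nhds_in_open) auto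
    then show ?thesis by eventually_elim (simp add: reparam \<tau>\<kappa>)
  qed
  ultimately show "((\<lambda>p. g (\<phi>' p x)) has_real_derivative \<rho> x * g' x) (at 0)"
    by (subst DERIV_cong_ev[OF refl _ refl, symmetric]) (auto simp: mult.commute)
qed (auto intro!: continuous_intros C1_along_continuous[OF assms] \<rho>_cont)

section \<open>The probability invariant under both \<open>\<phi>'\<close> and
  \<open>f\<close>\<close>

definition \<mu>' :: "'a measure" where "\<mu>' = weighted (\<lambda>x. 1 / \<rho> x) \<mu>"

lemma \<mu>_inv: "invariant_probability \<phi> \<mu>"
  using ergodic by (simp add: unique_invariant_probability_def)

lemma \<mu>_prob: "prob_space \<mu>" "sets \<mu> = sets borel"
  using \<mu>_inv by (auto simp: invariant_probability_def)

lemma inv_\<rho>: "continuous_on UNIV (\<lambda>x. 1 / \<rho> x)" "1 / \<rho> x > 0"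
  using \<rho>_pos by (auto intro!: continuous_intros \<rho>_cont simp: \<rho>_nz)

lemma \<mu>'_inv: "invariant_probability \<phi>' \<mu>'"
  unfolding \<mu>'_def
  by (rule invariant_weighted[OF P.compact_flow_axioms Q.compact_flow_axioms inv_\<rho> C1_along_\<phi> \<mu>_inv])

lemma \<mu>'_prob: "prob_space \<mu>'" "sets \<mu>' = sets borel"
  using \<mu>'_inv by (auto simp: invariant_probability_def)

text \<open>Reweighting by \<open>\<rho>\<close> transfers invariance from \<open>\<phi>'\<close> to
  \<open>\<phi>\<close>, and with it unique ergodicity from \<open>\<phi>\<close> to
  \<open>\<phi>'\<close>.\<close>

lemma weighted_\<rho>_unique:
  assumes "invariant_probability \<phi>' \<nu>"
  shows "weighted \<rho> \<nu> = \<mu>"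
  using invariant_weighted[OF Q.compact_flow_axioms P.compact_flow_axioms \<rho>_cont \<rho>_pos C1_along_\<phi>' assms] ergodic
  by (simp add: unique_invariant_probability_def)

lemma integral_invariant_via_\<mu>:
  assumes \<nu>: "invariant_probability \<phi>' \<nu>" and u: "continuous_on UNIV u"
  shows "(LINT x|\<nu>. u x) = (LINT x|\<nu>. \<rho> x) * (LINT x|\<mu>. u x / \<rho> x)" "(LINT x|\<nu>. \<rho> x) > 0"
proof -
  have p: "prob_space \<nu>" "sets \<nu> = sets borel" using \<nu> by (auto simp: invariant_probability_def)
  note W = weighted[OF P.compact_space p \<rho>_cont \<rho>_pos]
  show pos: "(LINT x|\<nu>. \<rho> x) > 0" by (rule W)
  have c: "continuous_on UNIV (\<lambda>x. u x / \<rho> x)" by (intro continuous_intros u \<rho>_cont) (simp add: \<rho>_nz)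
  show "(LINT x|\<nu>. u x) = (LINT x|\<nu>. \<rho> x) * (LINT x|\<mu>. u x / \<rho> x)"
    using W(4)[OF c] pos by (simp add: weighted_\<rho>_unique[OF \<nu>] \<rho>_nz)
qed

text \<open>\<open>f t\<close> conjugates \<open>\<phi>'\<close> to itself with rescaled time, so it
  carries \<open>\<mu>'\<close> to another probability invariant under \<open>\<phi>'\<close>.
  Unique ergodicity makes the two proportional.\<close>

lemma \<mu>'_f:
  fixes u :: "'a \<Rightarrow> real"
  assumes u: "continuous_on UNIV u"
  shows "(LINT x|\<mu>'. u (f t x)) = (LINT x|\<mu>'. u x)"
proof -
  interpret prob_space \<mu>' by (rule \<mu>'_prob)
  have m: "f t \<in> measurable \<mu>' borel" using F.measurable_flow \<mu>'_prob(2) by (simp cong: measurable_cong_sets)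
  let ?\<nu> = "distr \<mu>' borel (f t)"
  have int: "(LINT x|?\<nu>. v x) = (LINT x|\<mu>'. v (f t x))" if "continuous_on UNIV v" for v :: "'a \<Rightarrow> real"
    using m borel_measurable_continuous_onI[OF that] by (rule integral_distr)
  have inv: "invariant_probability \<phi>' ?\<nu>"
  proof (rule Q.invariant_probabilityI)
    show "prob_space ?\<nu>" using m by (rule prob_space_distr)
    fix s :: real and v :: "'a \<Rightarrow> real" assume v: "continuous_on UNIV v"
    have vs: "continuous_on UNIV (\<lambda>x. v (\<phi>' s x))" by (intro Q.continuous_on_compose_flow[OF v] continuous_intros)
    have vt: "continuous_on UNIV (\<lambda>x. v (f t x))" by (intro F.continuous_on_compose_flow[OF v] continuous_intros)
    have "\<phi>' s (f t x) = f t (\<phi>' (exp (- (a * t)) * s) x)" for x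
      by (simp add: expand mult.assoc[symmetric] flip: exp_add)
    then have "(LINT x|?\<nu>. v (\<phi>' s x)) = (LINT x|\<mu>'. v (f t (\<phi>' (exp (- (a * t)) * s) x)))"
      by (simp add: int[OF vs])
    also have "\<dots> = (LINT x|\<mu>'. v (f t x))"
      using Q.invariant_integral[OF \<mu>'_inv vt] by simp
    finally show "(LINT x|?\<nu>. v (\<phi>' s x)) = (LINT x|?\<nu>. v x)" by (simp add: int[OF v])
  qed simp
  interpret N: prob_space ?\<nu> using m by (rule prob_space_distr)
  have "(LINT x|?\<nu>. v x) = ((LINT x|?\<nu>. \<rho> x) / (LINT x|\<mu>'. \<rho> x)) * (LINT x|\<mu>'. v x)"
    if v: "continuous_on UNIV v" for v :: "'a \<Rightarrow> real"
    using integral_invariant_via_\<mu>[OF inv v] integral_invariant_via_\<mu>[OF \<mu>'_inv v] by simp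
  note * = this
  \<comment> \<open>The factor of proportionality is evaluated at the constant function 1.\<close>
  have "(LINT x|?\<nu>. \<rho> x) / (LINT x|\<mu>'. \<rho> x) = 1" using *[of "\<lambda>_. 1"] N.prob_space prob_space by simp
  then show ?thesis using *[OF u] int[OF u] by simp
qed

lemma integral_X_zero: "C1_along f g Xg \<Longrightarrow> (LINT x|\<mu>'. Xg x) = 0"
  using F.integral_C1_along_zero[OF \<mu>'_prob \<mu>'_f] .

lemma integrable_\<mu>': "continuous_on UNIV (u :: 'a \<Rightarrow> real) \<Longrightarrow> integrable \<mu>' u"
  using continuous_integrable_compact[OF P.compact_space _ prob_space.axioms(1)[OF \<mu>'_prob(1)] \<mu>'_prob(2)] .

lemma integral_\<mu>:
  assumes "continuous_on UNIV (u :: 'a \<Rightarrow> real)"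
  shows "(LINT x|\<mu>. u x) = (LINT x|\<mu>'. \<rho> x * u x) / (LINT x|\<mu>'. \<rho> x)"
  using integral_invariant_via_\<mu>[OF \<mu>'_inv, of "\<lambda>x. \<rho> x * u x"] continuous_on_mult[OF \<rho>_cont assms]
  by (simp add: \<rho>_nz)

lemma integral_G: "(LINT x|\<mu>. G x) = a"
proof -
  have "(LINT x|\<mu>'. \<rho> x * G x) = a * (LINT x|\<mu>'. \<rho> x) + (LINT x|\<mu>'. X\<rho> x)"
    unfolding \<rho>_G using integrable_\<mu>'[OF \<rho>_cont] integrable_\<mu>'[OF X\<rho>_cont] by simp
  then show ?thesis
    using integral_\<mu>[OF G_cont] integral_X_zero[OF \<rho>_along] integral_invariant_via_\<mu>(2)[OF \<mu>'_inv \<rho>_cont] by simp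
qed

text \<open>To first order in \<open>r\<close>, \<open>f r\<close> stretches the orbit segment of
  \<open>\<phi>\<close>-length \<open>s\<close> starting at \<open>x\<close> to
  \<open>\<phi>\<close>-length \<open>s + r J s x\<close>.\<close>

definition J :: "real \<Rightarrow> 'a \<Rightarrow> real" where "J s x = integral {0..s} (\<lambda>q. G (\<phi> q x))"

lemma J_growth:
  obtains c s\<^sub>0 where "c > 0" "s\<^sub>0 > 0" "\<And>s y. s \<ge> s\<^sub>0 \<Longrightarrow> J s y \<ge> c * s"
  using P.uniquely_ergodic_linear_growth[OF ergodic G_cont] a_pos unfolding J_def integral_G by blast

section \<open>How \<open>f\<close> distorts the time of \<open>\<phi>\<close>\<close>

lemma exp_cancel: "exp (a * r) * exp (- (a * r)) = 1" "exp (- (a * r)) * exp (a * r) = 1"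
  by (simp_all flip: exp_add)

text \<open>The substitution \<open>p = exp (- a r) \<tau>(f\<^sub>r x, q)\<close>.\<close>

lemma integral_substitution:
  assumes u: "continuous_on UNIV u" and s: "s \<ge> 0"
  shows "exp (a * r) * integral {0..exp (- (a * r)) * \<tau> (f r x) s} (\<lambda>p. \<rho> (f r (\<phi>' p x)) * u (f r (\<phi>' p x)))
    = integral {0..s} (\<lambda>q. u (\<phi> q (f r x)))"
proof -
  let ?v = "\<lambda>p. \<rho> (f r (\<phi>' p x)) * u (f r (\<phi>' p x))"
  define T where "T q = exp (- (a * r)) * \<tau> (f r x) q" for q
  have v: "continuous_on UNIV ?v"
    by (intro continuous_on_mult F.continuous_on_compose_flow[OF u] F.continuous_on_compose_flow[OF \<rho>_cont]
        Q.continuous_on_flow continuous_intros)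
  obtain F where F: "\<And>z. (F has_real_derivative ?v z) (at z)" using primitive_exists[OF v] by blast
  have fT: "f r (\<phi>' (T q) x) = \<phi> q (f r x)" for q
    by (simp add: expand reparam T_def mult.assoc[symmetric] exp_cancel)
  have "((\<lambda>q. exp (a * r) * F (T q)) has_real_derivative u (\<phi> q (f r x))) (at q)" for q
  proof -
    have "(T has_real_derivative exp (- (a * r)) * (1 / \<rho> (\<phi> q (f r x)))) (at q)"
      unfolding T_def by (intro DERIV_cmult \<tau>_deriv)
    from DERIV_cmult[OF DERIV_chain2[OF F this], of "exp (a * r)"]
    show ?thesis by (rule DERIV_cong) (simp add: fT \<rho>_nz exp_minus field_simps)
  qed
  from integral_primitive(2)[OF s this]
  have "integral {0..s} (\<lambda>q. u (\<phi> q (f r x))) = exp (a * r) * (F (T s) - F 0)"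
    by (simp add: T_def \<tau>_0 right_diff_distrib)
  moreover have "0 \<le> \<tau> (f r x) s"
    using strict_mono_less_eq[OF \<tau>_mono, of "f r x" 0 s] s by (simp add: \<tau>_0)
  then have "0 \<le> T s" by (simp add: T_def)
  ultimately show ?thesis using integral_primitive(2)[OF _ F] by (simp add: T_def)
qed

lemma sheared_orbit_integral_derivative:
  assumes g: "C1_along f g Xg" and T: "T \<ge> 0"
  shows "((\<lambda>r. integral {0..T} (\<lambda>p. g (f r (\<phi>' p x)))) has_real_derivative integral {0..T} (\<lambda>p. Xg (\<phi>' p x))) (at 0)"
proof -
  note c = C1_along_continuous[OF g]
  have "((\<lambda>r. integral (cbox 0 T) (\<lambda>p. g (f r (\<phi>' p x)))) has_field_derivative
      integral (cbox 0 T) (\<lambda>p. Xg (f 0 (\<phi>' p x)))) (at 0 within UNIV)"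
  proof (rule leibniz_rule_field_derivative)
    show "((\<lambda>r. g (f r (\<phi>' p x))) has_field_derivative Xg (f r (\<phi>' p x))) (at r within UNIV)" for r p
      using F.C1_along_at[OF g] by simp
    show "(\<lambda>p. g (f r (\<phi>' p x))) integrable_on cbox 0 T" for r
      by (intro integrable_continuous F.continuous_on_compose_flow[OF c(1)] Q.continuous_on_flow continuous_intros)
    show "continuous_on (UNIV \<times> cbox 0 T) (\<lambda>(r, p). Xg (f r (\<phi>' p x)))"
      unfolding split_beta
      by (intro F.continuous_on_compose_flow[OF c(2)] Q.continuous_on_flow continuous_intros)
  qed auto
  then show ?thesis by simp
qed

text \<open>The chain rules above need a function of all real \<open>p\<close>, whereas
  \<open>integral {0..p}\<close> is a primitive for \<open>p \<ge> 0\<close> only.\<close>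

lemma sheared_primitive:
  assumes "continuous_on UNIV (g :: 'a \<Rightarrow> real)"
  obtains H where "\<And>r p. (H r has_real_derivative g (f r (\<phi>' p x))) (at p)"
    "\<And>r p. p \<ge> 0 \<Longrightarrow> H r p = integral {0..p} (\<lambda>p. g (f r (\<phi>' p x)))"
proof -
  have "\<exists>F. \<forall>p. (F has_real_derivative g (f r (\<phi>' p x))) (at p)" for r
  proof -
    have "continuous_on UNIV (\<lambda>p. g (f r (\<phi>' p x)))"
      by (intro F.continuous_on_compose_flow[OF assms] Q.continuous_on_flow continuous_intros)
    then show ?thesis using primitive_exists by blast
  qed
  then obtain K where K: "\<And>r p. (K r has_real_derivative g (f r (\<phi>' p x))) (at p)" by metis
  have "((\<lambda>p. K r p - K r 0) has_real_derivative g (f r (\<phi>' p x))) (at p)" for r p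
    using DERIV_diff[OF K[of r p] DERIV_const[of "K r 0"]] by simp
  then show thesis
    by (rule that[of "\<lambda>r p. K r p - K r 0"]) (simp add: integral_primitive(2)[OF _ K])
qed

lemma sheared_continuous:
  assumes "continuous_on UNIV (g :: 'a \<Rightarrow> real)"
  shows "continuous_on UNIV (\<lambda>(r, p). g (f r (\<phi>' p x)))"
  unfolding split_beta by (intro F.continuous_on_compose_flow[OF assms] Q.continuous_on_flow continuous_intros)

text \<open>\<open>\<phi>\<^sub>s f\<^sub>r x = f\<^sub>r \<phi>'\<^sub>T x\<close> with \<open>T = exp (- a r) \<tau>(f\<^sub>r x, s)\<close>, and \<open>T\<close> is implicitly determined by
  \<open>exp (a r) \<integral>\<^sub>0\<^sup>T \<rho>(f\<^sub>r \<phi>'\<^sub>p x) dp = s\<close>.\<close>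

lemma shear_derivative:
  assumes s: "s \<ge> 0"
  shows "((\<lambda>r. exp (- (a * r)) * \<tau> (f r x) s) has_real_derivative - J s x / \<rho> (\<phi> s x)) (at 0)"
proof -
  define T where "T r = exp (- (a * r)) * \<tau> (f r x) s" for r
  have T_nonneg: "T r \<ge> 0" for r
    using strict_mono_less_eq[OF \<tau>_mono, of "f r x" 0 s] s by (simp add: \<tau>_0 T_def)
  have T0: "T 0 = \<tau> x s" by (simp add: T_def)
  obtain H where H: "\<And>r p. (H r has_real_derivative \<rho> (f r (\<phi>' p x))) (at p)"
    "\<And>r p. p \<ge> 0 \<Longrightarrow> H r p = integral {0..p} (\<lambda>p. \<rho> (f r (\<phi>' p x)))"
    using sheared_primitive[OF \<rho>_cont] by blast
  let ?K = "\<lambda>r p. exp (a * r) * H r p" and ?B = "\<lambda>r p. exp (a * r) * \<rho> (f r (\<phi>' p x))"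
  let ?A = "J s x"
  have "(T has_real_derivative - ?A / ?B 0 (T 0)) (at 0)"
  proof (rule derivative_implicit[where H = ?K and s = s])
    show "(?K r has_real_derivative ?B r p) (at p)" for r p by (intro DERIV_cmult H)
    show "continuous_on UNIV (\<lambda>(r, p). ?B r p)"
      using sheared_continuous[OF \<rho>_cont, of x] by (auto simp: split_beta intro!: continuous_intros)
    show "?B 0 (T 0) \<noteq> 0" by (simp add: \<rho>_nz)
    have "continuous_on UNIV T" unfolding T_def
      by (intro continuous_intros continuous_on_compose2[OF \<tau>_cont[of s]] F.continuous_on_flow) auto
    then show "isCont T 0" by (simp add: continuous_on_eq_continuous_at)
    show "?K r (T r) = s" for r
      using integral_substitution[of "\<lambda>_. 1" s r x] s T_nonneg[of r] by (simp add: H(2) T_def[symmetric])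
    have "((\<lambda>r. integral {0..T 0} (\<lambda>p. \<rho> (f r (\<phi>' p x)))) has_real_derivative integral {0..T 0} (\<lambda>p. X\<rho> (\<phi>' p x))) (at 0)"
      by (rule sheared_orbit_integral_derivative[OF \<rho>_along T_nonneg])
    then have D: "((\<lambda>r. H r (T 0)) has_real_derivative integral {0..T 0} (\<lambda>p. X\<rho> (\<phi>' p x))) (at 0)"
      by (simp add: H(2) T_nonneg)
    have E: "((\<lambda>r. exp (a * r)) has_real_derivative a) (at 0)"
      by (auto intro!: derivative_eq_intros)
    have "((\<lambda>r. ?K r (T 0)) has_real_derivative a * H 0 (T 0) + integral {0..T 0} (\<lambda>p. X\<rho> (\<phi>' p x))) (at 0)"
      using DERIV_mult[OF E D] by simp
    moreover have "a * H 0 (T 0) + integral {0..T 0} (\<lambda>p. X\<rho> (\<phi>' p x)) = J s x"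
    proof -
      have i: "(\<lambda>p. \<rho> (\<phi>' p x)) integrable_on {0..T 0}" "(\<lambda>p. X\<rho> (\<phi>' p x)) integrable_on {0..T 0}"
        by (intro integrable_continuous_real Q.continuous_on_compose_flow[OF \<rho>_cont] Q.continuous_on_compose_flow[OF X\<rho>_cont] continuous_intros)+
      have "J s x = integral {0..T 0} (\<lambda>p. \<rho> (\<phi>' p x) * G (\<phi>' p x))"
        using integral_substitution[OF G_cont s, of 0 x] by (simp add: J_def T0)
      also have "\<dots> = integral {0..T 0} (\<lambda>p. a * \<rho> (\<phi>' p x) + X\<rho> (\<phi>' p x))" by (simp add: \<rho>_G)
      also have "\<dots> = a * integral {0..T 0} (\<lambda>p. \<rho> (\<phi>' p x)) + integral {0..T 0} (\<lambda>p. X\<rho> (\<phi>' p x))"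
        using i by (subst Henstock_Kurzweil_Integration.integral_add) (auto intro: integrable_on_mult_right)
      finally show ?thesis by (simp add: H(2) T_nonneg)
    qed
    ultimately show "((\<lambda>r. ?K r (T 0)) has_real_derivative ?A) (at 0)" by simp
  qed
  then show ?thesis by (simp add: T0 reparam[symmetric] T_def[abs_def])
qed

lemma sheared_flow_eq: "f r (\<phi>' (exp (- (a * r)) * \<tau> (f r x) s) x) = \<phi> s (f r x)"
  by (simp add: expand reparam mult.assoc[symmetric] exp_cancel)

text \<open>Rescaling time to the fixed interval \<open>[0, 1]\<close> moves the upper limit into
  the integrand, where joint continuity applies. Times are kept nonnegative because
  \<open>integral {0..s}\<close> vanishes for negative \<open>s\<close>.\<close>

lemma continuous_J:
  assumes y: "continuous_on S y" and q: "continuous_on S q" and nonneg: "\<And>z. z \<in> S \<Longrightarrow> q z \<ge> 0"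
  shows "continuous_on S (\<lambda>z. J (q z) (y z))"
proof -
  have J: "J s x = s * integral {0..1} (\<lambda>p. G (\<phi> (s * p) x))" if "s \<ge> 0" for s x
  proof -
    have v: "continuous_on UNIV (\<lambda>p. G (\<phi> p x))" by (intro P.continuous_on_compose_flow[OF G_cont] continuous_intros)
    obtain F where F: "\<And>z. (F has_real_derivative G (\<phi> z x)) (at z)" using primitive_exists[OF v] by blast
    have v': "continuous_on {0..1} (\<lambda>p. G (\<phi> (s * p) x))" by (intro P.continuous_on_compose_flow[OF G_cont] continuous_intros)
    have "((\<lambda>p. F (s * p)) has_real_derivative s * G (\<phi> (s * p) x)) (at p)" for p
      using DERIV_chain2[OF F DERIV_cmult_Id, of s p UNIV] by (simp add: mult.commute)
    from integral_primitive(2)[OF zero_le_one this]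
    have "integral {0..1} (\<lambda>p. s * G (\<phi> (s * p) x)) = F s - F 0" by simp
    then show ?thesis using integral_primitive(2)[OF that F] by (simp add: J_def)
  qed
  have "continuous_on (UNIV :: ('a \<times> real) set) (\<lambda>w. integral (cbox 0 1) (\<lambda>p. G (\<phi> (snd w * p) (fst w))))"
  proof (rule integral_continuous_on_param)
    show "continuous_on (UNIV \<times> cbox 0 1) (\<lambda>(w, p). G (\<phi> (snd (w :: 'a \<times> real) * p) (fst w)))"
      unfolding split_beta by (intro P.continuous_on_compose_flow[OF G_cont] continuous_intros)
  qed
  from continuous_on_compose2[OF this continuous_on_Pair[OF y q]]
  have "continuous_on S (\<lambda>z. q z * integral {0..1} (\<lambda>p. G (\<phi> (q z * p) (y z))))"
    by (intro continuous_on_mult q) simp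
  then show ?thesis by (rule continuous_on_eq) (simp add: J nonneg)
qed

text \<open>Write \<open>\<phi> s (f r x)\<close> as \<open>f r (\<phi>' (T r) x)\<close>. With
  \<open>T\<close> frozen, moving \<open>r\<close> gives \<open>Xg\<close>. Moving \<open>T\<close>
  gives its slope \<open>- J s x / \<rho>\<close> times the \<open>\<phi>'\<close>-derivative
  \<open>\<rho> Vg\<close>, and the factor \<open>\<rho>\<close> cancels.\<close>

lemma C1_along_f_flow:
  assumes g: "C1_along f g Xg" "C1_along \<phi> g Vg" and s: "s \<ge> 0"
  shows "C1_along f (\<lambda>x. g (\<phi> s x)) (\<lambda>x. Xg (\<phi> s x) - J s x * Vg (\<phi> s x))"
  unfolding C1_along_def
proof (intro conjI allI)
  note c = C1_along_continuous[OF g(1)] C1_along_continuous[OF g(2)]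
  show "continuous_on UNIV (\<lambda>x. g (\<phi> s x))" by (intro P.continuous_on_compose_flow[OF c(1)] continuous_intros)
  show "continuous_on UNIV (\<lambda>x. Xg (\<phi> s x) - J s x * Vg (\<phi> s x))"
    by (intro continuous_on_diff continuous_on_mult continuous_J P.continuous_on_compose_flow[OF c(2)]
        P.continuous_on_compose_flow[OF c(4)] continuous_intros s)
  fix x
  define T where "T r = exp (- (a * r)) * \<tau> (f r x) s" for r
  have T0: "T 0 = \<tau> x s" by (simp add: T_def)
  let ?H = "\<lambda>r p. g (f r (\<phi>' p x))"
  let ?B = "\<lambda>r p. exp (a * r) * (\<rho> (f r (\<phi>' p x)) * Vg (f r (\<phi>' p x)))"
  have "((\<lambda>r. ?H r (T r)) has_real_derivative Xg (\<phi> s x) + (- J s x / \<rho> (\<phi> s x)) * ?B 0 (T 0)) (at 0)"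
  proof (rule derivative_two_variables[where H = ?H and B = ?B and T = T])
    show "(?H r has_real_derivative ?B r p) (at p)" for r p
    proof -
      have "((\<lambda>q. g (\<phi>' q (f r x))) has_real_derivative \<rho> (\<phi>' (exp (a * r) * p) (f r x)) * Vg (\<phi>' (exp (a * r) * p) (f r x))) (at (exp (a * r) * p))"
        by (rule Q.C1_along_at[OF C1_along_\<phi>'[OF g(2)]])
      from DERIV_chain2[OF this DERIV_cmult_Id]
      show ?thesis by (simp add: expand mult.commute)
    qed
    show "continuous_on UNIV (\<lambda>(r, p). ?B r p)"
      unfolding split_beta
      by (intro continuous_on_mult F.continuous_on_compose_flow[OF \<rho>_cont] F.continuous_on_compose_flow[OF c(4)] Q.continuous_on_flow continuous_intros)
    show "((\<lambda>r. ?H r (T 0)) has_real_derivative Xg (\<phi> s x)) (at 0)"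
      unfolding T0 reparam[symmetric] by (rule C1_along_0[OF g(1)])
    show "(T has_real_derivative - J s x / \<rho> (\<phi> s x)) (at 0)"
      unfolding T_def[abs_def] by (rule shear_derivative[OF s])
  qed
  then show "((\<lambda>r. g (\<phi> s (f r x))) has_real_derivative Xg (\<phi> s x) - J s x * Vg (\<phi> s x)) (at 0)"
    by (simp add: T_def sheared_flow_eq T0[unfolded T_def] \<rho>_nz reparam[symmetric])
qed

end

section \<open>Linear bounds on \<open>J\<close> and decay of correlations\<close>

context expanding_time_change
begin

lemma J_bound:
  obtains C where "C > 0" "\<And>s x. s \<ge> 0 \<Longrightarrow> \<bar>J s x\<bar> \<le> C * s"
proof -
  obtain B where B: "B > 0" "\<And>x. \<bar>G x\<bar> \<le> B" using continuous_bounded_compact[OF P.compact_space G_cont] by metis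
  have "\<bar>J s x\<bar> \<le> B * s" if "s \<ge> 0" for s x
  proof -
    have "\<bar>integral {0..s} (\<lambda>q. G (\<phi> q x))\<bar> \<le> B * (s - 0)"
      by (rule abs_integral_le) (use that B in \<open>auto intro!: P.continuous_on_compose_flow[OF G_cont] continuous_intros\<close>)
    then show ?thesis by (simp add: J_def)
  qed
  with B(1) show thesis by (rule that)
qed

lemma J_derivative_\<phi>:
  assumes "q > 0"
  shows "((\<lambda>q. J q x) has_real_derivative G (\<phi> q x)) (at q)"
proof -
  have v: "continuous_on UNIV (\<lambda>p. G (\<phi> p x))" by (intro P.continuous_on_compose_flow[OF G_cont] continuous_intros)
  obtain F where F: "\<And>z. (F has_real_derivative G (\<phi> z x)) (at z)" using primitive_exists[OF v] by blast
  have D: "((\<lambda>q. F q - F 0) has_real_derivative G (\<phi> q x)) (at q)"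
    using DERIV_diff[OF F[of q] DERIV_const[of "F 0"]] by simp
  have "\<forall>\<^sub>F z in nhds q. z > 0" using assms by (intro eventually_nhds_in_open[of "{0<..}", simplified]) auto
  then have "\<forall>\<^sub>F z in nhds q. F z - F 0 = J z x"
    by eventually_elim (simp add: J_def integral_primitive(2)[OF _ F])
  from DERIV_cong_ev[OF refl this refl] D show ?thesis by blast
qed

text \<open>The derivative of \<open>J s\<close> along \<open>f\<close>, found by differentiating
  \<open>G \<circ> \<phi> q\<close> under the integral with \<open>C1_along_f_flow\<close>.\<close>

definition DJ :: "real \<Rightarrow> 'a \<Rightarrow> real" where
  "DJ s x = integral {0..s} (\<lambda>q. XG (\<phi> q x) - J q x * VG (\<phi> q x))"

lemma DJ_integrand_continuous:
  "continuous_on ((UNIV :: 'a set) \<times> cbox 0 s) (\<lambda>(x, q). XG (\<phi> q x) - J q x * VG (\<phi> q x))"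
  unfolding split_beta
  by (intro continuous_on_diff continuous_on_mult continuous_J continuous_intros
      P.continuous_on_compose_flow[OF C1_along_continuous(2)[OF G_f]]
      P.continuous_on_compose_flow[OF C1_along_continuous(2)[OF G_\<phi>]]) auto

lemma J_C1_along:
  assumes s: "s \<ge> 0"
  shows "C1_along f (J s) (DJ s)"
  unfolding C1_along_def
proof (intro conjI allI)
  show "continuous_on UNIV (J s)" by (intro continuous_J continuous_intros s)
  have "continuous_on (UNIV :: 'a set) (\<lambda>x. integral (cbox 0 s) (\<lambda>q. XG (\<phi> q x) - J q x * VG (\<phi> q x)))"
    by (rule integral_continuous_on_param) (rule DJ_integrand_continuous)
  then show "continuous_on UNIV (DJ s)" by (simp add: DJ_def[abs_def])
  fix x
  have "((\<lambda>r. integral (cbox 0 s) (\<lambda>q. G (\<phi> q (f r x)))) has_field_derivative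
      integral (cbox 0 s) (\<lambda>q. XG (\<phi> q (f 0 x)) - J q (f 0 x) * VG (\<phi> q (f 0 x)))) (at 0 within UNIV)"
  proof (rule leibniz_rule_field_derivative)
    show "((\<lambda>r. G (\<phi> q (f r x))) has_field_derivative XG (\<phi> q (f r x)) - J q (f r x) * VG (\<phi> q (f r x))) (at r within UNIV)"
      if "q \<in> cbox 0 s" for r q
      using F.C1_along_at[OF C1_along_f_flow[OF G_f G_\<phi>, of q]] that by simp
    show "(\<lambda>q. G (\<phi> q (f r x))) integrable_on cbox 0 s" for r
      by (intro integrable_continuous P.continuous_on_compose_flow[OF G_cont] continuous_intros)
    have "continuous_on (UNIV \<times> cbox 0 s) (\<lambda>(r, q). (f r x, q))"
      unfolding split_beta by (intro continuous_intros F.continuous_on_flow)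
    from continuous_on_compose2[OF DJ_integrand_continuous[of s] this]
    show "continuous_on (UNIV \<times> cbox 0 s) (\<lambda>(r, q). XG (\<phi> q (f r x)) - J q (f r x) * VG (\<phi> q (f r x)))"
      by (simp add: split_beta image_subset_iff mem_Times_iff)
  qed auto
  then show "((\<lambda>t. J s (f t x)) has_real_derivative DJ s x) (at 0)" by (simp add: J_def DJ_def)
qed

text \<open>\<open>\<integral>\<^sub>0\<^sup>s J\<^sub>q (X\<^sub>\<phi> G) \<circ> \<phi>\<^sub>q dq\<close> looks quadratic in \<open>s\<close>; integration by parts shows that it is only linear.\<close>

lemma DJ_bound:
  obtains C where "C > 0" "\<And>s x. s \<ge> 0 \<Longrightarrow> \<bar>DJ s x\<bar> \<le> C * s"
proof -
  obtain B where B: "B > 0" "\<And>x. \<bar>G x\<bar> \<le> B" using continuous_bounded_compact[OF P.compact_space G_cont] by metis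
  note XG_cont = C1_along_continuous(2)[OF G_f] and VG_cont = C1_along_continuous(2)[OF G_\<phi>]
  obtain B' where B': "B' > 0" "\<And>x. \<bar>XG x\<bar> \<le> B'" using continuous_bounded_compact[OF P.compact_space XG_cont] by metis
  obtain C where C: "C > 0" "\<And>s x. s \<ge> 0 \<Longrightarrow> \<bar>J s x\<bar> \<le> C * s" using J_bound by blast
  have "\<bar>DJ s x\<bar> \<le> (B' + C * B + B * B) * s" if s: "s \<ge> 0" for s x
  proof -
    have Jc: "continuous_on {0..s} (\<lambda>q. J q x)" by (intro continuous_J continuous_intros) auto
    have Gc: "continuous_on {0..s} (\<lambda>q. G (\<phi> q x))" by (intro P.continuous_on_compose_flow[OF G_cont] continuous_intros)
    have Vc: "continuous_on {0..s} (\<lambda>q. VG (\<phi> q x))" by (intro P.continuous_on_compose_flow[OF VG_cont] continuous_intros)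
    have Xc: "continuous_on {0..s} (\<lambda>q. XG (\<phi> q x))" by (intro P.continuous_on_compose_flow[OF XG_cont] continuous_intros)
    have "((\<lambda>q. G (\<phi> q x) * G (\<phi> q x) + J q x * VG (\<phi> q x)) has_integral J s x * G (\<phi> s x) - J 0 x * G (\<phi> 0 x)) {0..s}"
    \<comment> \<open>\<open>J\<close> is 0 at negative times, so at \<open>q = 0\<close> only a
      one-sided derivative can be expected; the version for the open interval avoids this
      endpoint.\<close>
    proof (rule fundamental_theorem_of_calculus_interior[OF s])
      show "continuous_on {0..s} (\<lambda>q. J q x * G (\<phi> q x))" by (intro continuous_on_mult Jc Gc)
      fix q assume "q \<in> {0<..<s}"
      then have "((\<lambda>q. J q x * G (\<phi> q x)) has_real_derivative G (\<phi> q x) * G (\<phi> q x) + VG (\<phi> q x) * J q x) (at q)"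
        by (intro DERIV_mult J_derivative_\<phi> P.C1_along_at[OF G_\<phi>]) simp
      then show "((\<lambda>q. J q x * G (\<phi> q x)) has_vector_derivative G (\<phi> q x) * G (\<phi> q x) + J q x * VG (\<phi> q x)) (at q)"
        by (simp add: has_real_derivative_iff_has_vector_derivative mult.commute)
    qed
    from integral_unique[OF this]
    have "integral {0..s} (\<lambda>q. G (\<phi> q x) * G (\<phi> q x) + J q x * VG (\<phi> q x)) = J s x * G (\<phi> s x)"
      by (simp add: J_def)
    moreover have i: "(\<lambda>q. G (\<phi> q x) * G (\<phi> q x)) integrable_on {0..s}" "(\<lambda>q. J q x * VG (\<phi> q x)) integrable_on {0..s}"
      "(\<lambda>q. XG (\<phi> q x)) integrable_on {0..s}"
      by (intro integrable_continuous_real continuous_on_mult Gc Jc Vc Xc)+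
    ultimately have parts: "integral {0..s} (\<lambda>q. J q x * VG (\<phi> q x)) = J s x * G (\<phi> s x) - integral {0..s} (\<lambda>q. G (\<phi> q x) * G (\<phi> q x))"
      by (simp add: Henstock_Kurzweil_Integration.integral_add)
    have DJ_eq: "DJ s x = integral {0..s} (\<lambda>q. XG (\<phi> q x)) - J s x * G (\<phi> s x) + integral {0..s} (\<lambda>q. G (\<phi> q x) * G (\<phi> q x))"
      unfolding DJ_def using i parts by (simp add: Henstock_Kurzweil_Integration.integral_diff)
    have b1: "\<bar>integral {0..s} (\<lambda>q. XG (\<phi> q x))\<bar> \<le> B' * (s - 0)"
      by (rule abs_integral_le[OF s Xc]) (use B' in auto)
    have b2: "\<bar>integral {0..s} (\<lambda>q. G (\<phi> q x) * G (\<phi> q x))\<bar> \<le> (B * B) * (s - 0)"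
    proof (rule abs_integral_le[OF s continuous_on_mult[OF Gc Gc]])
      show "\<bar>G (\<phi> q x) * G (\<phi> q x)\<bar> \<le> B * B" for q
        unfolding abs_mult by (rule mult_mono) (use B in auto)
    qed
    have b3: "\<bar>J s x * G (\<phi> s x)\<bar> \<le> (C * s) * B"
      unfolding abs_mult by (rule mult_mono) (use C B s in auto)
    have tri: "\<bar>p - q + r\<bar> \<le> P + Q + R" if "\<bar>p\<bar> \<le> P" "\<bar>r\<bar> \<le> R" "\<bar>q\<bar> \<le> Q" for p q r P Q R :: real
      using that by linarith
    have "\<bar>DJ s x\<bar> \<le> B' * (s - 0) + (C * s) * B + (B * B) * (s - 0)"
      unfolding DJ_eq by (rule tri[OF b1 b2 b3])
    then show ?thesis by (simp add: algebra_simps)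
  qed
  moreover have "B' + C * B + B * B > 0" using B B' C by (intro add_pos_pos mult_pos_pos)
  ultimately show thesis by (rule that[rotated])
qed

text \<open>Passing from \<open>\<mu>\<close> to the \<open>f\<close>-invariant
  \<open>\<mu>'\<close> multiplies the integrand by \<open>\<rho>\<close>, which is why
  \<open>\<rho> k\<close> must be differentiable along \<open>f\<close>. The function
  \<open>w = \<rho> k / J s\<close> and its derivative along \<open>f\<close> are both of order
  \<open>1 / s\<close>; this is where the linear upper bound on \<open>DJ\<close> is needed.\<close>

lemma correlation_decay:
  assumes g: "C1_along f g Xg" "C1_along \<phi> g k" and m: "C1_along f (\<lambda>x. \<rho> x * k x) Xm"
  obtains K s\<^sub>0 where "s\<^sub>0 > 0" "\<And>s. s \<ge> s\<^sub>0 \<Longrightarrow> \<bar>LINT x|\<mu>. k x * k (\<phi> s x)\<bar> \<le> K / s"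
proof -
  let ?m = "\<lambda>x. \<rho> x * k x"
  note c = C1_along_continuous[OF g(1)] C1_along_continuous[OF g(2)] C1_along_continuous[OF m]
  obtain Bg where Bg: "Bg > 0" "\<And>x. \<bar>g x\<bar> \<le> Bg" using continuous_bounded_compact[OF P.compact_space c(1)] by metis
  obtain BX where BX: "BX > 0" "\<And>x. \<bar>Xg x\<bar> \<le> BX" using continuous_bounded_compact[OF P.compact_space c(2)] by metis
  obtain Bm where Bm: "Bm > 0" "\<And>x. \<bar>?m x\<bar> \<le> Bm" using continuous_bounded_compact[OF P.compact_space c(5)] by metis
  obtain BY where BY: "BY > 0" "\<And>x. \<bar>Xm x\<bar> \<le> BY" using continuous_bounded_compact[OF P.compact_space c(6)] by metis
  obtain d s\<^sub>0 where d: "d > 0" "s\<^sub>0 > 0" "\<And>s y. s \<ge> s\<^sub>0 \<Longrightarrow> J s y \<ge> d * s" using J_growth by blast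
  obtain C where C: "C > 0" "\<And>s x. s \<ge> 0 \<Longrightarrow> \<bar>DJ s x\<bar> \<le> C * s" using DJ_bound by blast
  define z where "z = (LINT x|\<mu>'. \<rho> x)"
  have z: "z > 0" unfolding z_def by (rule integral_invariant_via_\<mu>(2)[OF \<mu>'_inv \<rho>_cont])
  define K where "K = (BY / d + Bm * C / (d * d)) * Bg + (Bm / d) * BX"
  interpret prob_space \<mu>' by (rule \<mu>'_prob)
  have "\<bar>LINT x|\<mu>. k x * k (\<phi> s x)\<bar> \<le> (K / z) / s" if s: "s \<ge> s\<^sub>0" for s
  proof -
    have s0: "s > 0" using s d by simp
    have Jpos: "J s x \<ge> d * s" "J s x > 0" for x using d(3)[OF s, of x] mult_pos_pos[OF d(1) s0] by linarith+
    have Jnz: "J s x \<noteq> 0" for x using Jpos(2)[of x] by simp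
    define w where "w x = ?m x / J s x" for x
    define Xw where "Xw x = (Xm x * J s x - ?m x * DJ s x) / (J s x * J s x)" for x
    have w: "C1_along f w Xw"
      unfolding w_def[abs_def] Xw_def[abs_def] by (rule F.C1_along_divide[OF m J_C1_along Jnz]) (use s0 in simp)
    have gs: "C1_along f (\<lambda>x. g (\<phi> s x)) (\<lambda>x. Xg (\<phi> s x) - J s x * k (\<phi> s x))"
      by (rule C1_along_f_flow[OF g]) (use s0 in simp)
    note wc = C1_along_continuous[OF w]
    have kc: "continuous_on UNIV (\<lambda>x. k (\<phi> s x))" by (intro P.continuous_on_compose_flow[OF c(4)] continuous_intros)
    have e1: "continuous_on UNIV (\<lambda>x. Xw x * g (\<phi> s x) + w x * Xg (\<phi> s x))"
      by (intro continuous_on_add continuous_on_mult wc P.continuous_on_compose_flow[OF c(1)] P.continuous_on_compose_flow[OF c(2)] continuous_intros)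
    have e2: "continuous_on UNIV (\<lambda>x. ?m x * k (\<phi> s x))" by (intro continuous_on_mult[OF c(5)] kc)
    have "(LINT x|\<mu>'. Xw x * g (\<phi> s x) + w x * (Xg (\<phi> s x) - J s x * k (\<phi> s x))) = 0"
      by (rule integral_X_zero[OF F.C1_along_mult[OF w gs]])
    moreover have "Xw x * g (\<phi> s x) + w x * (Xg (\<phi> s x) - J s x * k (\<phi> s x))
        = (Xw x * g (\<phi> s x) + w x * Xg (\<phi> s x)) - ?m x * k (\<phi> s x)" for x
      using Jnz[of x] by (simp add: w_def right_diff_distrib)
    ultimately have eq: "(LINT x|\<mu>'. ?m x * k (\<phi> s x)) = (LINT x|\<mu>'. Xw x * g (\<phi> s x) + w x * Xg (\<phi> s x))"
      using integrable_\<mu>'[OF e1] integrable_\<mu>'[OF e2] by simp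
    have wb: "\<bar>w x\<bar> \<le> Bm / (d * s)" for x
      unfolding w_def abs_divide using Bm Jpos[of x] mult_pos_pos[OF d(1) s0] by (intro frac_le) auto
    have Xwb: "\<bar>Xw x\<bar> \<le> (BY / d + Bm * C / (d * d)) / s" for x
    proof -
      \<comment> \<open>Arranged so that \<open>DJ / J\<close> appears as a bounded factor, both
        being of linear size.\<close>
      have "Xw x = Xm x / J s x - (?m x / J s x) * (DJ s x / J s x)" using Jnz[of x] by (simp add: Xw_def field_simps)
      then have "\<bar>Xw x\<bar> \<le> \<bar>Xm x / J s x\<bar> + \<bar>?m x / J s x\<bar> * \<bar>DJ s x / J s x\<bar>"
        by (simp only: abs_mult[symmetric] abs_triangle_ineq4)
      also have "\<dots> \<le> BY / (d * s) + Bm / (d * s) * (C * s / (d * s))"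
        unfolding abs_divide using BY Bm C(2)[of s x] C(1) Jpos[of x] mult_pos_pos[OF d(1) s0] s0
        by (intro add_mono mult_mono frac_le) auto
      also have "\<dots> = (BY / d + Bm * C / (d * d)) / s" using s0 d by (simp add: field_simps)
      finally show ?thesis .
    qed
    have "\<bar>LINT x|\<mu>'. Xw x * g (\<phi> s x) + w x * Xg (\<phi> s x)\<bar> \<le> (LINT x|\<mu>'. \<bar>Xw x * g (\<phi> s x) + w x * Xg (\<phi> s x)\<bar>)"
      using integral_norm_bound[of \<mu>' "\<lambda>x. Xw x * g (\<phi> s x) + w x * Xg (\<phi> s x)"] by simp
    also have "\<dots> \<le> (LINT x|\<mu>'. K / s)"
    proof (rule integral_mono)
      show "integrable \<mu>' (\<lambda>x. \<bar>Xw x * g (\<phi> s x) + w x * Xg (\<phi> s x)\<bar>)" using integrable_\<mu>'[OF e1] by (rule integrable_abs)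
      fix x
      have "\<bar>Xw x * g (\<phi> s x) + w x * Xg (\<phi> s x)\<bar> \<le> \<bar>Xw x\<bar> * \<bar>g (\<phi> s x)\<bar> + \<bar>w x\<bar> * \<bar>Xg (\<phi> s x)\<bar>"
        by (simp only: abs_mult[symmetric] abs_triangle_ineq)
      also have "\<dots> \<le> ((BY / d + Bm * C / (d * d)) / s) * Bg + (Bm / (d * s)) * BX"
        using Xwb[of x] wb[of x] Bg BX by (intro add_mono mult_mono) (auto intro: order_trans[OF abs_ge_zero])
      also have "\<dots> = K / s" unfolding K_def using s0 d by (simp add: field_simps)
      finally show "\<bar>Xw x * g (\<phi> s x) + w x * Xg (\<phi> s x)\<bar> \<le> K / s" .
    qed simp
    also have "\<dots> = K / s" by (simp add: prob_space)
    finally have "\<bar>LINT x|\<mu>'. ?m x * k (\<phi> s x)\<bar> \<le> K / s" unfolding eq .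
    moreover have "(LINT x|\<mu>. k x * k (\<phi> s x)) = (LINT x|\<mu>'. ?m x * k (\<phi> s x)) / z"
      using integral_\<mu>[OF continuous_on_mult[OF c(4) kc]] by (simp add: z_def mult.assoc)
    ultimately show ?thesis using z s0 by (simp add: abs_divide divide_right_mono mult.commute flip: divide_divide_eq_left) (simp add: field_simps)
  qed
  with d(2) show thesis by (rule that)
qed

section \<open>Smoothing continuous functions\<close>

lemma C1_along_f_flow':
  assumes g: "C1_along f g Xg" "C1_along \<phi>' g Yg"
  shows "C1_along f (\<lambda>x. g (\<phi>' r x)) (\<lambda>x. Xg (\<phi>' r x) - a * r * Yg (\<phi>' r x))"
  unfolding C1_along_def
proof (intro conjI allI)
  note c = C1_along_continuous[OF g(1)] C1_along_continuous[OF g(2)]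
  show "continuous_on UNIV (\<lambda>x. g (\<phi>' r x))" by (intro Q.continuous_on_compose_flow[OF c(1)] continuous_intros)
  show "continuous_on UNIV (\<lambda>x. Xg (\<phi>' r x) - a * r * Yg (\<phi>' r x))"
    by (intro continuous_on_diff continuous_on_mult Q.continuous_on_compose_flow[OF c(2)]
        Q.continuous_on_compose_flow[OF c(4)] continuous_intros)
  fix x
  let ?H = "\<lambda>t p. g (f t (\<phi>' p x))" and ?B = "\<lambda>t p. exp (a * t) * Yg (f t (\<phi>' p x))"
  define T where "T t = exp (- (a * t)) * r" for t
  have "((\<lambda>t. ?H t (T t)) has_real_derivative Xg (\<phi>' r x) + (- a * r) * ?B 0 (T 0)) (at 0)"
  proof (rule derivative_two_variables[where H = ?H and B = ?B and T = T])
    show "(?H t has_real_derivative ?B t p) (at p)" for t p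
      using DERIV_chain2[OF Q.C1_along_at[OF g(2), of "f t x" "exp (a * t) * p"] DERIV_cmult_Id]
      by (simp add: expand mult.commute)
    show "continuous_on UNIV (\<lambda>(t, p). ?B t p)"
      unfolding split_beta
      by (intro continuous_on_mult F.continuous_on_compose_flow[OF c(4)] Q.continuous_on_flow continuous_intros)
    show "((\<lambda>t. ?H t (T 0)) has_real_derivative Xg (\<phi>' r x)) (at 0)"
      using C1_along_0[OF g(1), of "\<phi>' r x"] by (simp add: T_def)
    show "(T has_real_derivative - a * r) (at 0)"
      unfolding T_def[abs_def] by (auto intro!: derivative_eq_intros)
  qed
  then show "((\<lambda>t. g (\<phi>' r (f t x))) has_real_derivative Xg (\<phi>' r x) - a * r * Yg (\<phi>' r x)) (at 0)"
    by (simp add: T_def expand mult.assoc[symmetric] exp_cancel)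
qed

text \<open>Substituting \<open>exp (- a t) p\<close> for \<open>p\<close> turns the average at
  \<open>f t x\<close> into \<open>exp (a t)\<close> times the integral of
  \<open>g (f t (\<phi>' p x))\<close> over \<open>[0, exp (- a t) r]\<close>. Prefactor, integrand
  and endpoint contribute the three terms of \<open>h\<close>: the variation along
  \<open>\<phi>'\<close> enters as a boundary value of \<open>g\<close> instead of a
  derivative.\<close>

lemma C1_along_f_orbit_integral':
  assumes g: "C1_along f g Xg" and r: "r \<ge> 0"
  obtains h where "C1_along f (\<lambda>x. integral {0..r} (\<lambda>p. g (\<phi>' p x))) h"
proof -
  note c = C1_along_continuous[OF g]
  define h where "h x = a * integral {0..r} (\<lambda>p. g (\<phi>' p x)) + integral {0..r} (\<lambda>p. Xg (\<phi>' p x)) - a * r * g (\<phi>' r x)" for x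
  have "C1_along f (\<lambda>x. integral {0..r} (\<lambda>p. g (\<phi>' p x))) h"
    unfolding C1_along_def
  proof (intro conjI allI)
    note ic = C1_along_continuous(1)[OF Q.C1_along_orbit_integral[OF _ r]]
    show "continuous_on UNIV (\<lambda>x. integral {0..r} (\<lambda>p. g (\<phi>' p x)))" by (rule ic[OF c(1)])
    show "continuous_on UNIV h"
      unfolding h_def[abs_def]
      by (intro continuous_on_diff continuous_on_add continuous_on_mult ic[OF c(1)] ic[OF c(2)]
          Q.continuous_on_compose_flow[OF c(1)] continuous_intros)
    fix x
    obtain F where F: "\<And>t p. (F t has_real_derivative g (f t (\<phi>' p x))) (at p)"
      "\<And>t p. p \<ge> 0 \<Longrightarrow> F t p = integral {0..p} (\<lambda>p. g (f t (\<phi>' p x)))"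
      using sheared_primitive[OF c(1)] by blast
    let ?H = "\<lambda>t p. exp (a * t) * F t p" and ?B = "\<lambda>t p. exp (a * t) * g (f t (\<phi>' p x))"
    define T where "T t = exp (- (a * t)) * r" for t
    have T: "T t \<ge> 0" "T 0 = r" for t using r by (simp_all add: T_def)
    have "((\<lambda>t. ?H t (T t)) has_real_derivative
        (a * integral {0..r} (\<lambda>p. g (\<phi>' p x)) + integral {0..r} (\<lambda>p. Xg (\<phi>' p x))) + (- a * r) * ?B 0 (T 0)) (at 0)"
    proof (rule derivative_two_variables[where H = ?H and B = ?B and T = T])
      show "(?H t has_real_derivative ?B t p) (at p)" for t p by (intro DERIV_cmult F)
      show "continuous_on UNIV (\<lambda>(t, p). ?B t p)"
        unfolding split_beta
        by (intro continuous_on_mult F.continuous_on_compose_flow[OF c(1)] Q.continuous_on_flow continuous_intros)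
      have "((\<lambda>t. F t r) has_real_derivative integral {0..r} (\<lambda>p. Xg (\<phi>' p x))) (at 0)"
        using sheared_orbit_integral_derivative[OF g r] by (simp add: F(2) r)
      moreover have "((\<lambda>t. exp (a * t)) has_real_derivative a) (at 0)"
        by (auto intro!: derivative_eq_intros)
      ultimately show "((\<lambda>t. ?H t (T 0)) has_real_derivative
          a * integral {0..r} (\<lambda>p. g (\<phi>' p x)) + integral {0..r} (\<lambda>p. Xg (\<phi>' p x))) (at 0)"
        using DERIV_mult[of "\<lambda>t. exp (a * t)" a 0 UNIV "\<lambda>t. F t r"] by (simp add: T F(2) r)
      show "(T has_real_derivative - a * r) (at 0)"
        unfolding T_def[abs_def] by (auto intro!: derivative_eq_intros)
    qed
    moreover have "?H t (T t) = integral {0..r} (\<lambda>p. g (\<phi>' p (f t x)))" for t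
    proof -
      have "((\<lambda>p. exp (a * t) * F t (exp (- (a * t)) * p)) has_real_derivative g (\<phi>' p (f t x))) (at p)" for p
      proof (rule DERIV_cong[OF DERIV_cmult[OF DERIV_chain2[OF F(1) DERIV_cmult_Id]]])
        show "exp (a * t) * (g (f t (\<phi>' (exp (- (a * t)) * p) x)) * exp (- (a * t))) = g (\<phi>' p (f t x))"
          using exp_cancel(1)[of t] by (simp add: expand mult.assoc[symmetric] exp_cancel)
      qed
      from integral_primitive(2)[OF r this] show ?thesis by (simp add: T_def F(2) algebra_simps)
    qed
    ultimately show "((\<lambda>t. integral {0..r} (\<lambda>p. g (\<phi>' p (f t x)))) has_real_derivative h x) (at 0)"
      by (simp add: h_def T(2) algebra_simps)
  qed
  then show thesis by (rule that)
qed

text \<open>Average once along \<open>f\<close> and twice along \<open>\<phi>'\<close>: the second average along \<open>\<phi>'\<close> makes the derivative along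
  \<open>\<phi>'\<close> differentiable along \<open>f\<close>.\<close>

lemma smooth_approximation:
  fixes u :: "'a \<Rightarrow> real"
  assumes u: "continuous_on UNIV u" and e: "\<epsilon> > 0"
  obtains g Xg k Xm where "C1_along f g Xg" "C1_along \<phi> g k" "C1_along f (\<lambda>x. \<rho> x * k x) Xm" "\<And>x. \<bar>g x - u x\<bar> \<le> \<epsilon>"
proof -
  have e3: "\<epsilon> / 3 > 0" using e by simp
  obtain r\<^sub>1 where r1: "r\<^sub>1 > 0" "\<And>x. \<bar>(1 / r\<^sub>1) * integral {0..r\<^sub>1} (\<lambda>p. u (f p x)) - u x\<bar> \<le> \<epsilon> / 3"
    using F.orbit_average_close[OF u e3] by blast
  define g\<^sub>1 where "g\<^sub>1 x = (1 / r\<^sub>1) * integral {0..r\<^sub>1} (\<lambda>p. u (f p x))" for x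
  have "C1_along f g\<^sub>1 (\<lambda>x. (1 / r\<^sub>1) * (u (f r\<^sub>1 x) - u x))"
    unfolding g\<^sub>1_def[abs_def] using r1(1) by (intro F.C1_along_scale F.C1_along_orbit_integral u) simp
  then obtain X\<^sub>1 where g1: "C1_along f g\<^sub>1 X\<^sub>1" by blast
  obtain r\<^sub>2 where r2: "r\<^sub>2 > 0" "\<And>x. \<bar>(1 / r\<^sub>2) * integral {0..r\<^sub>2} (\<lambda>p. g\<^sub>1 (\<phi>' p x)) - g\<^sub>1 x\<bar> \<le> \<epsilon> / 3"
    using Q.orbit_average_close[OF C1_along_continuous(1)[OF g1] e3] by blast
  define g\<^sub>2 where "g\<^sub>2 x = (1 / r\<^sub>2) * integral {0..r\<^sub>2} (\<lambda>p. g\<^sub>1 (\<phi>' p x))" for x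
  obtain h\<^sub>2 where "C1_along f (\<lambda>x. integral {0..r\<^sub>2} (\<lambda>p. g\<^sub>1 (\<phi>' p x))) h\<^sub>2"
    using C1_along_f_orbit_integral'[OF g1 less_imp_le[OF r2(1)]] by blast
  then have "C1_along f g\<^sub>2 (\<lambda>x. (1 / r\<^sub>2) * h\<^sub>2 x)" unfolding g\<^sub>2_def[abs_def] by (rule F.C1_along_scale)
  then obtain X\<^sub>2 where g2: "C1_along f g\<^sub>2 X\<^sub>2" by blast
  have "C1_along \<phi>' g\<^sub>2 (\<lambda>x. (1 / r\<^sub>2) * (g\<^sub>1 (\<phi>' r\<^sub>2 x) - g\<^sub>1 x))"
    unfolding g\<^sub>2_def[abs_def] using r2(1) by (intro Q.C1_along_scale Q.C1_along_orbit_integral C1_along_continuous(1)[OF g1]) simp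
  then obtain Y\<^sub>2 where g2': "C1_along \<phi>' g\<^sub>2 Y\<^sub>2" by blast
  obtain r\<^sub>3 where r3: "r\<^sub>3 > 0" "\<And>x. \<bar>(1 / r\<^sub>3) * integral {0..r\<^sub>3} (\<lambda>p. g\<^sub>2 (\<phi>' p x)) - g\<^sub>2 x\<bar> \<le> \<epsilon> / 3"
    using Q.orbit_average_close[OF C1_along_continuous(1)[OF g2] e3] by blast
  define g\<^sub>3 where "g\<^sub>3 x = (1 / r\<^sub>3) * integral {0..r\<^sub>3} (\<lambda>p. g\<^sub>2 (\<phi>' p x))" for x
  obtain h\<^sub>3 where "C1_along f (\<lambda>x. integral {0..r\<^sub>3} (\<lambda>p. g\<^sub>2 (\<phi>' p x))) h\<^sub>3"
    using C1_along_f_orbit_integral'[OF g2 less_imp_le[OF r3(1)]] by blast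
  then have g3: "C1_along f g\<^sub>3 (\<lambda>x. (1 / r\<^sub>3) * h\<^sub>3 x)" unfolding g\<^sub>3_def[abs_def] by (rule F.C1_along_scale)
  have g3': "C1_along \<phi>' g\<^sub>3 (\<lambda>x. (1 / r\<^sub>3) * (g\<^sub>2 (\<phi>' r\<^sub>3 x) - g\<^sub>2 x))"
    unfolding g\<^sub>3_def[abs_def] using r3(1) by (intro Q.C1_along_scale Q.C1_along_orbit_integral C1_along_continuous(1)[OF g2]) simp
  define k where "k x = (1 / \<rho> x) * ((1 / r\<^sub>3) * (g\<^sub>2 (\<phi>' r\<^sub>3 x) - g\<^sub>2 x))" for x
  have k: "C1_along \<phi> g\<^sub>3 k" unfolding k_def[abs_def] by (rule C1_along_\<phi>[OF g3'])
  \<comment> \<open>The factor \<open>\<rho>\<close> cancels against \<open>1 / \<rho>\<close> in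
    \<open>k\<close>. What remains is a difference of values of \<open>g\<^sub>2\<close>, which is
    differentiable along both \<open>f\<close> and \<open>\<phi>'\<close>.\<close>
  have \<rho>k: "(\<lambda>x. \<rho> x * k x) = (\<lambda>x. (1 / r\<^sub>3) * (g\<^sub>2 (\<phi>' r\<^sub>3 x) + (- 1) * g\<^sub>2 x))" by (simp add: k_def \<rho>_nz fun_eq_iff)
  have add: "C1_along f (\<lambda>x. p x + q x) (\<lambda>x. p' x + q' x)" if "C1_along f p p'" "C1_along f q q'" for p p' q q'
    using that unfolding C1_along_def by (auto intro!: continuous_intros DERIV_add)
  obtain Xm where "C1_along f (\<lambda>x. \<rho> x * k x) Xm"
    unfolding \<rho>k using F.C1_along_scale[OF add[OF C1_along_f_flow'[OF g2 g2'] F.C1_along_scale[OF g2]]] by blast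
  moreover have "\<bar>g\<^sub>3 x - u x\<bar> \<le> \<epsilon>" for x
    using r1(2)[of x] r2(2)[of x] r3(2)[of x] unfolding g\<^sub>1_def[symmetric] g\<^sub>2_def[symmetric] g\<^sub>3_def[symmetric] by linarith
  ultimately show thesis using g3 k by (intro that)
qed

end

section \<open>Absolute continuity from the decay of correlations\<close>

lemma l2_inner_tendsto_both:
  assumes L: "\<And>n. p n \<in> L2 M" "\<And>n. r n \<in> L2 M" "P \<in> L2 M" "R \<in> L2 M"
    and lim: "((\<lambda>n. l2_norm M (\<lambda>x. p n x - P x)) \<longlongrightarrow> 0) F" "((\<lambda>n. l2_norm M (\<lambda>x. r n x - R x)) \<longlongrightarrow> 0) F"
  shows "((\<lambda>n. l2_inner M (p n) (r n)) \<longlongrightarrow> l2_inner M P R) F"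
proof (rule LIM_zero_cancel, rule Lim_null_comparison)
  let ?d = "\<lambda>n. l2_norm M (\<lambda>x. p n x - P x)" and ?e = "\<lambda>n. l2_norm M (\<lambda>x. r n x - R x)"
  show "\<forall>\<^sub>F n in F. norm (l2_inner M (p n) (r n) - l2_inner M P R) \<le> (?d n + l2_norm M P) * ?e n + ?d n * l2_norm M R"
  proof (intro always_eventually allI)
    fix n
    have dL: "(\<lambda>x. p n x - P x) \<in> L2 M" "(\<lambda>x. r n x - R x) \<in> L2 M" using L by (auto intro: L2_diff)
    have "l2_inner M (p n) (\<lambda>x. r n x - R x) = l2_inner M (p n) (r n) - l2_inner M (p n) R"
      using L by (simp add: l2_inner_diff_right)
    moreover have "l2_inner M (\<lambda>x. p n x - P x) R = l2_inner M (p n) R - l2_inner M P R"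
      using l2_inner_lincomb_left[of R M "p n" P 1 "-1"] L by simp
    ultimately have "l2_inner M (p n) (r n) - l2_inner M P R = l2_inner M (p n) (\<lambda>x. r n x - R x) + l2_inner M (\<lambda>x. p n x - P x) R"
      by simp
    then have "norm (l2_inner M (p n) (r n) - l2_inner M P R) \<le> cmod (l2_inner M (p n) (\<lambda>x. r n x - R x)) + cmod (l2_inner M (\<lambda>x. p n x - P x) R)"
      by (simp add: norm_triangle_ineq)
    also have "\<dots> \<le> l2_norm M (p n) * ?e n + ?d n * l2_norm M R"
      by (intro add_mono l2_cauchy_schwarz L dL)
    also have "l2_norm M (p n) \<le> ?d n + l2_norm M P"
      using l2_norm_triangle[OF dL(1) L(3)] by simp
    finally show "norm (l2_inner M (p n) (r n) - l2_inner M P R) \<le> (?d n + l2_norm M P) * ?e n + ?d n * l2_norm M R"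
      by (simp add: mult_right_mono l2_norm_nonneg)
  qed
  have "((\<lambda>n. (?d n + l2_norm M P) * ?e n + ?d n * l2_norm M R) \<longlongrightarrow> (0 + l2_norm M P) * 0 + 0 * l2_norm M R) F"
    by (intro tendsto_intros lim)
  then show "((\<lambda>n. (?d n + l2_norm M P) * ?e n + ?d n * l2_norm M R) \<longlongrightarrow> 0) F" by simp
qed

lemma integrable_square_if_decay:
  fixes C :: "real \<Rightarrow> complex"
  assumes meas: "C \<in> borel_measurable borel" and bdd: "\<And>s. cmod (C s) \<le> B"
    and s0: "s\<^sub>0 > 0" and decay: "\<And>s. \<bar>s\<bar> \<ge> s\<^sub>0 \<Longrightarrow> cmod (C s) \<le> K / \<bar>s\<bar>"
  shows "integrable lborel (\<lambda>s. (cmod (C s))\<^sup>2)"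
proof (rule Bochner_Integration.integrable_bound)
  \<comment> \<open>The first summand of \<open>D\<close> dominates for
    \<open>\<bar>s\<bar> < s\<^sub>0\<close>, where only the bound \<open>B\<close> is known, the
    second for larger \<open>\<bar>s\<bar>\<close>, where \<open>1 / s^2\<close> is compared with
    \<open>1 / (1 + s^2)\<close>.\<close>
  define D where "D = B\<^sup>2 * (1 + s\<^sub>0\<^sup>2) + K\<^sup>2 * (1 + 1 / s\<^sub>0\<^sup>2)"
  have "integrable lborel (\<lambda>s::real. inverse (1 + s\<^sup>2))"
    using integrable_inverse_1_plus_square by (simp add: set_integrable_def)
  then show "integrable lborel (\<lambda>s. D * inverse (1 + s\<^sup>2))" by simp
  show "(\<lambda>s. (cmod (C s))\<^sup>2) \<in> borel_measurable lborel"
  proof -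
    have [measurable]: "C \<in> borel_measurable borel" by (rule meas)
    have "(\<lambda>s. (cmod (C s))\<^sup>2) \<in> borel_measurable borel" by measurable
    then show ?thesis by simp
  qed
  have "(cmod (C s))\<^sup>2 \<le> D * inverse (1 + s\<^sup>2)" for s
  proof (cases "\<bar>s\<bar> \<ge> s\<^sub>0")
    case True
    have s2: "s\<^sup>2 > 0" using True s0 by auto
    have "s\<^sub>0\<^sup>2 \<le> s\<^sup>2" using True s0 by (simp add: abs_le_square_iff[symmetric])
    then have "1 + s\<^sup>2 \<le> (1 + 1 / s\<^sub>0\<^sup>2) * s\<^sup>2" using s0 by (simp add: field_simps)
    then have "1 / s\<^sup>2 \<le> (1 + 1 / s\<^sub>0\<^sup>2) * inverse (1 + s\<^sup>2)"
      using s2 by (simp add: field_simps add_pos_pos)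
    then have "K\<^sup>2 * (1 / s\<^sup>2) \<le> K\<^sup>2 * ((1 + 1 / s\<^sub>0\<^sup>2) * inverse (1 + s\<^sup>2))" by (intro mult_left_mono) auto
    moreover have "(cmod (C s))\<^sup>2 \<le> (K / \<bar>s\<bar>)\<^sup>2" using decay[OF True] by (intro power_mono) auto
    moreover have "(K / \<bar>s\<bar>)\<^sup>2 = K\<^sup>2 * (1 / s\<^sup>2)" by (simp add: power_divide)
    moreover have "0 \<le> B\<^sup>2 * (1 + s\<^sub>0\<^sup>2) * inverse (1 + s\<^sup>2)" by (auto intro!: mult_nonneg_nonneg add_nonneg_nonneg)
    ultimately show ?thesis unfolding D_def distrib_right mult.assoc by linarith
  next
    case False
    then have "s\<^sup>2 \<le> s\<^sub>0\<^sup>2" using s0 by (simp add: abs_le_square_iff[symmetric])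
    then have "1 \<le> (1 + s\<^sub>0\<^sup>2) * inverse (1 + s\<^sup>2)" by (simp add: field_simps add_pos_nonneg)
    then have "B\<^sup>2 * 1 \<le> B\<^sup>2 * ((1 + s\<^sub>0\<^sup>2) * inverse (1 + s\<^sup>2))" by (intro mult_left_mono) auto
    moreover have "(cmod (C s))\<^sup>2 \<le> B\<^sup>2" using bdd[of s] by (intro power_mono) auto
    moreover have "0 \<le> K\<^sup>2 * (1 + 1 / s\<^sub>0\<^sup>2) * inverse (1 + s\<^sup>2)" by (auto intro!: mult_nonneg_nonneg add_nonneg_nonneg)
    ultimately show ?thesis unfolding D_def distrib_right mult.assoc by linarith
  qed
  then show "AE s in lborel. norm ((cmod (C s))\<^sup>2) \<le> norm (D * inverse (1 + s\<^sup>2))"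
    by (intro AE_I2) (auto intro: order_trans[OF _ abs_ge_self])
qed

context koopman_resolution
begin

lemma borel_measurable_spec: "f \<in> measurable borel N \<Longrightarrow> f \<in> measurable (spec h) N"
  by (simp cong: measurable_cong_sets)

text \<open>Replace \<open>k\<close> by the difference quotients of \<open>g\<close>. Their
  correlation is a second difference of the characteristic function of \<open>spec g\<close>, with
  multiplier \<open>(2 - 2 cos (h t)) / h^2\<close>, which is at most \<open>t^2\<close> and
  converges to it.\<close>

lemma inner_flow_gen:
  assumes gk: "(g, k) \<in> gen"
  shows "l2_inner M k (\<lambda>x. k (\<phi> s x)) = (CLINT t|spec g. iexp (- (s * t)) * complex_of_real (t\<^sup>2))"
proof -
  note L = gen_L2[OF gk]
  interpret S: finite_measure "spec g" using L(1) by (rule finite_measure_spec)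
  define h where "h n = 1 / real (Suc n)" for n
  have h: "h n > 0" for n by (simp add: h_def)
  have "h \<longlonglongrightarrow> 0" unfolding h_def by (rule LIMSEQ_Suc[OF lim_1_over_n])
  then have h0: "filterlim h (at 0) sequentially"
    unfolding filterlim_at using h less_imp_neq[OF h, symmetric] by auto
  define q where "q n x = \<i> / complex_of_real (h n) * (g (\<phi> (h n) x) - g x)" for n x
  have qL: "q n \<in> L2 M" for n unfolding q_def[abs_def] by (rule L2_difference_quotient[OF L(1)])
  have "((\<lambda>s. l2_norm M (\<lambda>x. \<i> / complex_of_real s * (g (\<phi> s x) - g x) - k x)) \<longlongrightarrow> 0) (at 0)"
    using gk by (simp add: koopman_generator_def)
  from filterlim_compose[OF this h0] have qlim: "(\<lambda>n. l2_norm M (\<lambda>x. q n x - k x)) \<longlonglongrightarrow> 0"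
    by (simp add: q_def)
  have "l2_norm M (\<lambda>x. q n (\<phi> s x) - k (\<phi> s x)) = l2_norm M (\<lambda>x. q n x - k x)" for n
    using l2_norm_flow[OF L2_diff[OF qL[of n] L(2)]] .
  then have qlim': "(\<lambda>n. l2_norm M (\<lambda>x. q n (\<phi> s x) - k (\<phi> s x))) \<longlonglongrightarrow> 0" using qlim by simp
  have lim1: "(\<lambda>n. l2_inner M (q n) (\<lambda>x. q n (\<phi> s x))) \<longlonglongrightarrow> l2_inner M k (\<lambda>x. k (\<phi> s x))"
    by (rule l2_inner_tendsto_both[OF qL L2_flow[OF qL] L(2) L2_flow[OF L(2)] qlim qlim'])
  define C where "C s = l2_inner M g (\<lambda>x. g (\<phi> s x))" for s
  have Cc: "l2_inner M (\<lambda>x. g (\<phi> r x)) (\<lambda>x. g (\<phi> s x)) = C (s - r)" for r s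
    unfolding C_def
    using l2_inner_flow[where v = "\<lambda>x. g (\<phi> r x)" and h = "\<lambda>x. g (\<phi> (s - r) x)" and s = r, OF L2_flow[OF L(1)] L2_flow[OF L(1)]]
    by (simp add: flow_add[symmetric] flow_0)
  have inner_q: "l2_inner M (q n) (\<lambda>x. q n (\<phi> s x)) = (2 * C s - C (s + h n) - C (s - h n)) / complex_of_real ((h n)\<^sup>2)" for n
  proof -
    let ?c = "\<i> / complex_of_real (h n)" and ?g = "\<lambda>r x. g (\<phi> r x)"
    have gL: "?g r \<in> L2 M" for r by (rule L2_flow[OF L(1)])
    have q1: "q n = (\<lambda>x. ?c * ?g (h n) x + (- ?c) * ?g 0 x)" by (auto simp: q_def fun_eq_iff algebra_simps flow_0)
    have q2: "(\<lambda>x. q n (\<phi> s x)) = (\<lambda>x. ?c * ?g (s + h n) x + (- ?c) * ?g s x)"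
      by (auto simp: q_def fun_eq_iff algebra_simps flow_add[symmetric])
    have "l2_inner M (q n) (\<lambda>x. q n (\<phi> s x)) = ?c * l2_inner M (q n) (?g (s + h n)) + (- ?c) * l2_inner M (q n) (?g s)"
      unfolding q2 by (rule l2_inner_lincomb_right[OF qL gL gL])
    also have "l2_inner M (q n) (?g (s + h n)) = cnj ?c * C s + cnj (- ?c) * C (s + h n)"
      unfolding q1 using l2_inner_lincomb_left[OF gL gL gL, of ?c "h n" "- ?c" 0 "s + h n"] by (simp only: Cc) simp
    also have "l2_inner M (q n) (?g s) = cnj ?c * C (s - h n) + cnj (- ?c) * C s"
      unfolding q1 using l2_inner_lincomb_left[OF gL gL gL, of ?c "h n" "- ?c" 0 s] by (simp only: Cc) simp
    finally have "l2_inner M (q n) (\<lambda>x. q n (\<phi> s x)) = (?c * cnj ?c) * (2 * C s - C (s + h n) - C (s - h n))"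
      by (simp add: algebra_simps)
    moreover have "?c * cnj ?c = 1 / complex_of_real ((h n)\<^sup>2)" by (simp add: power2_eq_square)
    ultimately show ?thesis by (simp only:) simp
  qed
  have Cchar: "C s = (CLINT t|spec g. iexp (- (s * t)))" for s
    unfolding C_def inner_flow_eq_char[OF L(1)] char_def by simp
  define W where "W n t = iexp (- (s * t)) * complex_of_real ((2 - 2 * cos (h n * t)) / (h n)\<^sup>2)" for n t
  have "l2_inner M (q n) (\<lambda>x. q n (\<phi> s x)) = (CLINT t|spec g. W n t)" for n
  proof -
    have i: "integrable (spec g) (\<lambda>t. iexp (- (r * t)))" for r
      using integrable_iexp_spec[OF L(1), of "- r"] by simp
    have "W n t = (2 * iexp (- (s * t)) - iexp (- ((s + h n) * t)) - iexp (- ((s - h n) * t))) / complex_of_real ((h n)\<^sup>2)" for t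
    proof -
      have e: "iexp (- ((s + h n) * t)) = iexp (- (s * t)) * iexp (- (h n * t))" "iexp (- ((s - h n) * t)) = iexp (- (s * t)) * iexp (h n * t)"
        by (simp_all add: algebra_simps flip: exp_add)
      have cos: "iexp (- (h n * t)) + iexp (h n * t) = complex_of_real (2 * cos (h n * t))"
        by (simp add: complex_eq_iff Re_exp Im_exp)
      have alg: "2 * e - e * p - e * q = e * (2 - (p + q))" for e p q :: complex by (simp add: algebra_simps)
      have "2 * iexp (- (s * t)) - iexp (- ((s + h n) * t)) - iexp (- ((s - h n) * t))
          = iexp (- (s * t)) * (2 - (iexp (- (h n * t)) + iexp (h n * t)))"
        unfolding e by (rule alg)
      also have "\<dots> = iexp (- (s * t)) * complex_of_real (2 - 2 * cos (h n * t))"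
        unfolding cos by (simp only: of_real_diff of_real_numeral)
      finally show ?thesis by (simp only: W_def of_real_divide times_divide_eq_right)
    qed
    then have "(CLINT t|spec g. W n t) = (2 * C s - C (s + h n) - C (s - h n)) / complex_of_real ((h n)\<^sup>2)"
      using i by (simp only: Cchar Bochner_Integration.integral_divide_zero Bochner_Integration.integral_diff
          Bochner_Integration.integrable_diff integrable_mult_right integral_mult_right_zero)
    then show ?thesis by (simp only: inner_q)
  qed
  moreover have "(\<lambda>n. CLINT t|spec g. W n t) \<longlonglongrightarrow> (CLINT t|spec g. iexp (- (s * t)) * complex_of_real (t\<^sup>2))"
  proof (rule integral_dominated_convergence[where w = "\<lambda>t. t\<^sup>2"])
    have "g \<in> Domain gen" using gk by auto
    then show "integrable (spec g) (\<lambda>t. t\<^sup>2)" using Domain_gen_iff[OF L(1)] by simp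
    have half: "2 - 2 * cos y = 4 * (sin (y / 2))\<^sup>2" for y :: real
      using cos_double_sin[of "y / 2"] by simp
    show "AE t in spec g. norm (W n t) \<le> t\<^sup>2" for n
    proof (rule AE_I2)
      fix t
      have "(sin (h n * t / 2))\<^sup>2 \<le> (h n * t / 2)\<^sup>2"
        using abs_sin_x_le_abs_x[of "h n * t / 2"] by (simp only: abs_le_square_iff)
      then have "2 - 2 * cos (h n * t) \<le> (h n)\<^sup>2 * t\<^sup>2" by (simp add: half power_divide power_mult_distrib)
      then have "(2 - 2 * cos (h n * t)) / (h n)\<^sup>2 \<le> t\<^sup>2" using h[of n] by (simp add: divide_le_eq mult.commute)
      moreover have "0 \<le> (2 - 2 * cos (h n * t)) / (h n)\<^sup>2" by (simp add: half)
      ultimately show "norm (W n t) \<le> t\<^sup>2" by (simp add: W_def norm_mult del: of_real_divide of_real_diff of_real_mult)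
    qed
    show "AE t in spec g. (\<lambda>n. W n t) \<longlonglongrightarrow> iexp (- (s * t)) * complex_of_real (t\<^sup>2)"
    proof (rule AE_I2)
      fix t
      have "((\<lambda>r::real. sin (r * t / 2) / r) \<longlongrightarrow> t / 2) (at 0)"
      proof -
        have "((\<lambda>r::real. sin (r * t / 2)) has_real_derivative t / 2) (at 0)" by (auto intro!: derivative_eq_intros)
        then show ?thesis by (simp add: has_field_derivative_iff)
      qed
      from filterlim_compose[OF this h0] have "(\<lambda>n. sin (h n * t / 2) / h n) \<longlonglongrightarrow> t / 2" .
      then have "(\<lambda>n. 4 * (sin (h n * t / 2) / h n)\<^sup>2) \<longlonglongrightarrow> 4 * (t / 2)\<^sup>2"
        by (rule tendsto_mult[OF tendsto_const tendsto_power])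
      then have "(\<lambda>n. (2 - 2 * cos (h n * t)) / (h n)\<^sup>2) \<longlonglongrightarrow> t\<^sup>2" by (simp add: half power_divide)
      then show "(\<lambda>n. W n t) \<longlonglongrightarrow> iexp (- (s * t)) * complex_of_real (t\<^sup>2)"
        unfolding W_def by (intro tendsto_mult tendsto_const tendsto_of_real)
    qed
    show "(\<lambda>t. iexp (- (s * t)) * complex_of_real (t\<^sup>2)) \<in> borel_measurable (spec g)"
      by (rule borel_measurable_spec) measurable
    show "W n \<in> borel_measurable (spec g)" for n
      unfolding W_def[abs_def] by (rule borel_measurable_spec) measurable
  qed
  ultimately show ?thesis using LIMSEQ_unique[OF lim1] by simp
qed

text \<open>The correlation of \<open>k\<close> is the characteristic function of
  \<open>\<beta> = t^2 d(spec g)\<close> up to the sign of \<open>s\<close>. Its decay makes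
  \<open>\<beta>\<close> absolutely continuous, and since \<open>t^2\<close> is positive on
  \<open>N\<close>, a set avoiding 0, \<open>\<beta> N = 0\<close> forces
  \<open>spec g N = 0\<close>.\<close>

lemma E_null_set_zero:
  assumes gk: "(g, k) \<in> gen" and s0: "s\<^sub>0 > 0"
    and decay: "\<And>s. s \<ge> s\<^sub>0 \<Longrightarrow> cmod (l2_inner M k (\<lambda>x. k (\<phi> s x))) \<le> K / s"
    and N: "N \<in> null_sets lborel" "0 \<notin> N"
  shows "AE x in M. E N g x = 0"
proof -
  note L = gen_L2[OF gk]
  have Nb [measurable]: "N \<in> sets borel" using N by auto
  have "g \<in> Domain gen" using gk by auto
  then have i2: "integrable (spec g) (\<lambda>t. t\<^sup>2)" using Domain_gen_iff[OF L(1)] by simp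
  have sq: "(\<lambda>t. ennreal (t\<^sup>2)) \<in> borel_measurable (spec g)" "power2 \<in> borel_measurable (spec g)"
    "(\<lambda>t. iexp (- s * t)) \<in> borel_measurable (spec g)" for s
    by (rule borel_measurable_spec; auto intro!: borel_measurable_continuous_onI continuous_intros)+
  define \<beta> where "\<beta> = density (spec g) (\<lambda>t. ennreal (t\<^sup>2))"
  have sets: "sets \<beta> = sets borel" by (simp add: \<beta>_def)
  have fin: "finite_measure \<beta>"
  proof (rule finite_measureI)
    have "emeasure \<beta> (space \<beta>) = (\<integral>\<^sup>+t. ennreal (t\<^sup>2) \<partial>spec g)"
      unfolding \<beta>_def by (subst emeasure_density[OF sq(1)]) auto
    also have "\<dots> = ennreal (LINT t|spec g. t\<^sup>2)" by (rule nn_integral_eq_integral[OF i2]) simp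
    finally show "emeasure \<beta> (space \<beta>) \<noteq> \<infinity>" by simp
  qed
  have char: "char \<beta> (- s) = l2_inner M k (\<lambda>x. k (\<phi> s x))" for s
  proof -
    have "char \<beta> (- s) = (CLINT t|spec g. (t\<^sup>2) *\<^sub>R iexp (- s * t))"
      unfolding char_def \<beta>_def using sq by (intro integral_density) auto
    then show ?thesis unfolding inner_flow_gen[OF gk] by (simp add: scaleR_conv_of_real mult.commute)
  qed
  \<comment> \<open>Decay is given for positive times; reversing time conjugates the
    correlation.\<close>
  have sym: "cmod (char \<beta> s) = cmod (char \<beta> (- s))" for s
  proof -
    have "l2_inner M k (\<lambda>x. k (\<phi> (- s) x)) = cnj (l2_inner M k (\<lambda>x. k (\<phi> s x)))"
      using l2_inner_flow[OF L(2,2), of s] l2_inner_cnj[of M k "\<lambda>x. k (\<phi> (- s) x)"] by simp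
    then show ?thesis using char[of "- s"] char[of s] by simp
  qed
  have "integrable lborel (\<lambda>s. (cmod (char \<beta> s))\<^sup>2)"
  proof (rule integrable_square_if_decay[OF _ _ s0])
    show "char \<beta> \<in> borel_measurable borel" by (rule measurable_char_\<beta>[OF fin sets])
    show "cmod (char \<beta> s) \<le> measure \<beta> UNIV" for s by (rule cmod_char_le[OF fin sets])
    show "cmod (char \<beta> s) \<le> K / \<bar>s\<bar>" if "\<bar>s\<bar> \<ge> s\<^sub>0" for s
    proof (cases "s \<ge> 0")
      case True then show ?thesis using sym[of s] char[of s] decay[of s] that by simp
    next
      case False then show ?thesis using char[of "- s"] decay[of "- s"] that by simp
    qed
  qed
  then have "absolutely_continuous lborel \<beta>" by (rule absolutely_continuous_of_char_square_integrable[OF fin sets])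
  then have "N \<in> null_sets \<beta>" using N(1) unfolding absolutely_continuous_def by blast
  then have "emeasure \<beta> N = 0" by auto
  then have "(\<integral>\<^sup>+t. ennreal (t\<^sup>2) * indicator N t \<partial>spec g) = 0"
    unfolding \<beta>_def by (simp add: emeasure_density[OF sq(1)])
  then have "AE t in spec g. ennreal (t\<^sup>2) * indicator N t = 0" by (subst (asm) nn_integral_0_iff_AE) (auto intro: borel_measurable_spec)
  then have "AE t in spec g. t \<notin> N"
    by eventually_elim (use N(2) in \<open>auto simp: indicator_def split: if_splits\<close>)
  then have "emeasure (spec g) N = 0" using emeasure_eq_0_AE[of "\<lambda>t. t \<in> N" "spec g"] by simp
  then show ?thesis by (rule E_AE_0[OF L(1) Nb])
qed

end

lemma (in compact_flow) flow_uniformly_close: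
  fixes u :: "'a \<Rightarrow> real"
  assumes u: "continuous_on UNIV u" and e: "\<epsilon> > 0"
  obtains d where "d > 0" "\<And>t x. \<bar>t\<bar> < d \<Longrightarrow> \<bar>u (\<phi> t x) - u x\<bar> < \<epsilon>"
proof -
  have "compact ({-1..1::real} \<times> (UNIV :: 'a set))" by (intro compact_Times compact_space) simp
  moreover have "continuous_on ({-1..1::real} \<times> UNIV) (\<lambda>z. u (\<phi> (fst z) (snd z)))"
    by (intro continuous_on_compose_flow[OF u] continuous_intros)
  ultimately have "uniformly_continuous_on ({-1..1::real} \<times> (UNIV :: 'a set)) (\<lambda>z. u (\<phi> (fst z) (snd z)))"
    by (rule compact_uniformly_continuous[rotated])
  then obtain d where d: "d > 0"
    "\<And>z z'. z \<in> {-1..1::real} \<times> (UNIV :: 'a set) \<Longrightarrow> z' \<in> {-1..1} \<times> UNIV \<Longrightarrow> dist z' z < d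
       \<Longrightarrow> dist (u (\<phi> (fst z') (snd z'))) (u (\<phi> (fst z) (snd z))) < \<epsilon>"
    using e unfolding uniformly_continuous_on_def by metis
  have "\<bar>u (\<phi> t x) - u x\<bar> < \<epsilon>" if "\<bar>t\<bar> < min 1 d" for t x
    using d(2)[of "(0, x)" "(t, x)"] that by (auto simp: dist_Pair_Pair dist_real_def abs_less_iff)
  with d(1) show thesis by (intro that[of "min 1 d"]) auto
qed

section \<open>Spectral type and kernel of the generator\<close>

context expanding_time_change
begin

sublocale mp_flow \<mu> \<phi>
proof (intro mp_flow.intro mp_flow_axioms.intro)
  show "prob_space \<mu>" by (rule \<mu>_prob)
  show "is_flow \<phi>" using P.continuous_flow by (simp add: continuous_flow_def)
  fix s
  show "\<phi> s \<in> measurable \<mu> \<mu>" using P.measurable_flow \<mu>_prob(2) by (simp cong: measurable_cong_sets)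
  have "distr \<mu> \<mu> (\<phi> s) = distr \<mu> borel (\<phi> s)" using \<mu>_prob(2) by (intro distr_cong) auto
  then show "distr \<mu> \<mu> (\<phi> s) = \<mu>" using \<mu>_inv by (simp add: invariant_probability_def)
qed

lemma measurable_\<mu>: "continuous_on UNIV (u :: 'a \<Rightarrow> real) \<Longrightarrow> u \<in> borel_measurable \<mu>"
  using borel_measurable_continuous_onI \<mu>_prob(2) by (simp cong: measurable_cong_sets)

lemma L2_continuous:
  assumes "continuous_on UNIV (u :: 'a \<Rightarrow> real)"
  shows "(\<lambda>x. complex_of_real (u x)) \<in> L2 \<mu>"
proof -
  obtain B where B: "\<And>x. \<bar>u x\<bar> \<le> B" using continuous_bounded_compact[OF P.compact_space assms] by metis
  show ?thesis
    using measurable_\<mu>[OF assms] B by (intro L2_bounded[where C = B] finite_measure_axioms) auto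
qed

text \<open>By the mean value theorem the difference quotient at \<open>x\<close> is
  \<open>\<i>\<close> times \<open>k\<close> at a point of the same orbit at time less than
  \<open>\<bar>s\<bar>\<close>. Uniform continuity along the flow makes the convergence uniform,
  hence one in \<open>L2\<close>.\<close>

lemma gen_C1_along:
  assumes g: "C1_along \<phi> g k"
  shows "((\<lambda>x. complex_of_real (g x)), (\<lambda>x. \<i> * complex_of_real (k x))) \<in> gen"
proof -
  note c = C1_along_continuous[OF g]
  let ?d = "\<lambda>s x. \<i> / complex_of_real s * (complex_of_real (g (\<phi> s x)) - complex_of_real (g x)) - \<i> * complex_of_real (k x)"
  have "((\<lambda>s. l2_norm \<mu> (?d s)) \<longlongrightarrow> 0) (at 0)"
  proof (rule tendstoI)
    fix e :: real assume e: "e > 0"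
    obtain d where d: "d > 0" "\<And>t x. \<bar>t\<bar> < d \<Longrightarrow> \<bar>k (\<phi> t x) - k x\<bar> < e / 2"
      using P.flow_uniformly_close[OF c(2), of "e / 2"] e by auto
    have "l2_norm \<mu> (?d s) \<le> e / 2" if s: "s \<noteq> 0" "\<bar>s\<bar> < d" for s
    proof (rule l2_norm_le_bound)
      have "continuous_on UNIV (\<lambda>x. g (\<phi> s x))" by (intro P.continuous_on_compose_flow[OF c(1)] continuous_intros)
      then show "?d s \<in> borel_measurable \<mu>" using measurable_\<mu>[OF c(1)] measurable_\<mu>[OF c(2)] measurable_\<mu> by measurable
      show "cmod (?d s x) \<le> e / 2" for x
      proof -
        have "\<exists>z. \<bar>z\<bar> < d \<and> g (\<phi> s x) - g x = s * k (\<phi> z x)"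
        proof (cases "s > 0")
          case True
          obtain z where "0 < z" "z < s" "g (\<phi> s x) - g (\<phi> 0 x) = (s - 0) * k (\<phi> z x)"
            using MVT2[OF True, of "\<lambda>t. g (\<phi> t x)" "\<lambda>t. k (\<phi> t x)"] P.C1_along_at[OF g] by blast
          then show ?thesis using s by (intro exI[of _ z]) auto
        next
          case False
          then have "s < 0" using s by simp
          obtain z where "s < z" "z < 0" "g (\<phi> 0 x) - g (\<phi> s x) = (0 - s) * k (\<phi> z x)"
            using MVT2[OF \<open>s < 0\<close>, of "\<lambda>t. g (\<phi> t x)" "\<lambda>t. k (\<phi> t x)"] P.C1_along_at[OF g] by blast
          then show ?thesis using s by (intro exI[of _ z]) auto
        qed
        then obtain z where z: "\<bar>z\<bar> < d" "g (\<phi> s x) - g x = s * k (\<phi> z x)" by blast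
        have "?d s x = \<i> / complex_of_real s * complex_of_real (g (\<phi> s x) - g x) - \<i> * complex_of_real (k x)" by simp
        also have "\<dots> = \<i> * complex_of_real (k (\<phi> z x) - k x)" unfolding z(2) using s by (simp add: field_simps)
        finally have "cmod (?d s x) = \<bar>k (\<phi> z x) - k x\<bar>" by (simp only: norm_mult norm_ii norm_of_real mult_1)
        then show ?thesis using d(2)[OF z(1), of x] by simp
      qed
    qed (use e prob_space_axioms in auto)
    then have "\<forall>s. s \<noteq> 0 \<and> \<bar>s\<bar> < d \<longrightarrow> l2_norm \<mu> (?d s) \<le> e / 2" by blast
    then show "\<forall>\<^sub>F s in at 0. dist (l2_norm \<mu> (?d s)) 0 < e"
      unfolding eventually_at using d(1) e by (intro exI[of _ d]) (auto simp: l2_norm_nonneg dist_real_def)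
  qed
  then show ?thesis
    using L2_continuous[OF c(1)] L2_scale[OF L2_continuous[OF c(2)]] by (simp add: koopman_generator_def)
qed

text \<open>\<open>w = E N h\<close> is orthogonal to each function \<open>g\<close> of
  \<open>smooth_approximation\<close>, since \<open>E N\<close> moves over to \<open>g\<close> and
  kills it. Such \<open>g\<close> are uniformly dense in the continuous functions and
  \<open>w\<close> is integrable, so \<open>w\<close> is orthogonal to every continuous
  function.\<close>

lemma E_null_set_zero_everywhere:
  assumes res: "spectral_resolution \<mu> gen E" and N: "N \<in> null_sets lborel" "0 \<notin> N" and h: "h \<in> L2 \<mu>"
  shows "AE x in \<mu>. E N h x = 0"
proof -
  interpret koopman_resolution \<mu> \<phi> E
    using res by unfold_locales (auto simp: spectral_resolution_def)
  have Nb: "N \<in> sets borel" using N by auto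
  define w where "w = E N h"
  have wL: "w \<in> L2 \<mu>" unfolding w_def by (rule L2_E[OF Nb h])
  have w_abs: "integrable \<mu> (\<lambda>x. cmod (w x))"
    using L2_integrable_norm_mult[OF wL L2_continuous[of "\<lambda>_. 1"]] by simp
  have w_int: "integrable \<mu> w" using w_abs L2_measurable[OF wL] by (simp add: integrable_norm_iff)
  have zero: "l2_inner \<mu> w (\<lambda>x. complex_of_real (u x)) = 0" if u: "continuous_on UNIV u" for u
  proof -
    let ?D = "LINT x|\<mu>. cmod (w x)"
    have D: "?D \<ge> 0" by (rule integral_nonneg_AE) simp
    have small: "cmod (l2_inner \<mu> w (\<lambda>x. complex_of_real (u x))) \<le> e * ?D" if e: "e > 0" for e
    proof -
      obtain g Xg k Xm where g: "C1_along f g Xg" "C1_along \<phi> g k" "C1_along f (\<lambda>x. \<rho> x * k x) Xm"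
        and close: "\<And>x. \<bar>g x - u x\<bar> \<le> e"
        using smooth_approximation[OF u e] by blast
      obtain K s\<^sub>0 where K: "s\<^sub>0 > 0" "\<And>s. s \<ge> s\<^sub>0 \<Longrightarrow> \<bar>LINT x|\<mu>. k x * k (\<phi> s x)\<bar> \<le> K / s"
        using correlation_decay[OF g] by blast
      let ?g = "\<lambda>x. complex_of_real (g x)" and ?k = "\<lambda>x. \<i> * complex_of_real (k x)"
      have "AE x in \<mu>. E N ?g x = 0"
      proof (rule E_null_set_zero[OF gen_C1_along[OF g(2)] K(1) _ N])
        fix s assume s: "s \<ge> s\<^sub>0"
        have "l2_inner \<mu> ?k (\<lambda>x. ?k (\<phi> s x)) = (CLINT x|\<mu>. complex_of_real (k x * k (\<phi> s x)))"
          unfolding l2_inner_def by (intro Bochner_Integration.integral_cong) (auto simp: complex_eq_iff)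
        also have "\<dots> = complex_of_real (LINT x|\<mu>. k x * k (\<phi> s x))" by (rule integral_complex_of_real)
        finally show "cmod (l2_inner \<mu> ?k (\<lambda>x. ?k (\<phi> s x))) \<le> K / s" using K(2)[OF s] by simp
      qed
      then have "l2_inner \<mu> h (E N ?g) = l2_inner \<mu> h (\<lambda>x. 0)"
        by (intro l2_inner_cong_AE) (auto intro: h L2_E[OF Nb] L2_continuous[OF C1_along_continuous(1)[OF g(2)]] L2_zero)
      then have wg: "l2_inner \<mu> w ?g = 0"
        unfolding w_def using inner_E[OF Nb h L2_continuous[OF C1_along_continuous(1)[OF g(2)]]] by (simp add: l2_inner_def)
      have uc: "continuous_on UNIV (\<lambda>x. u x - g x)" by (intro continuous_intros u C1_along_continuous(1)[OF g(2)])
      have "l2_inner \<mu> w (\<lambda>x. complex_of_real (u x - g x)) = l2_inner \<mu> w (\<lambda>x. complex_of_real (u x)) - l2_inner \<mu> w ?g"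
        using l2_inner_diff_right[OF wL L2_continuous[OF u] L2_continuous[OF C1_along_continuous(1)[OF g(2)]]] by simp
      then have "cmod (l2_inner \<mu> w (\<lambda>x. complex_of_real (u x))) = cmod (l2_inner \<mu> w (\<lambda>x. complex_of_real (u x - g x)))"
        using wg by simp
      also have "\<dots> \<le> (LINT x|\<mu>. cmod (cnj (w x) * complex_of_real (u x - g x)))"
        unfolding l2_inner_def by (rule integral_norm_bound)
      also have "\<dots> \<le> (LINT x|\<mu>. e * cmod (w x))"
      proof (rule integral_mono)
        show "integrable \<mu> (\<lambda>x. cmod (cnj (w x) * complex_of_real (u x - g x)))"
          by (rule integrable_norm[OF L2_integrable_mult[OF wL L2_continuous[OF uc]]])
        show "integrable \<mu> (\<lambda>x. e * cmod (w x))" using w_abs by simp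
        show "cmod (cnj (w x) * complex_of_real (u x - g x)) \<le> e * cmod (w x)" for x
          using mult_right_mono[OF close[of x], of "cmod (w x)"]
          by (simp add: norm_mult mult.commute abs_minus_commute del: of_real_diff)
      qed
      finally show ?thesis by simp
    qed
    have "cmod (l2_inner \<mu> w (\<lambda>x. complex_of_real (u x))) \<le> 0"
    proof (rule field_le_epsilon)
      fix e :: real assume e: "e > 0"
      \<comment> \<open>The summand 1 covers the case \<open>?D = 0\<close>.\<close>
      have p: "e / (?D + 1) > 0" by (intro divide_pos_pos e add_nonneg_pos D zero_less_one)
      have "e / (?D + 1) * ?D \<le> e / (?D + 1) * (?D + 1)" using p by (intro mult_left_mono) auto
      also have "\<dots> = e" using add_nonneg_pos[OF D zero_less_one] by simp
      finally show "cmod (l2_inner \<mu> w (\<lambda>x. complex_of_real (u x))) \<le> 0 + e"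
        using small[OF p] by linarith
    qed
    then show ?thesis by simp
  qed
  have parts: "(LINT x|\<mu>. Re (w x) * u x) = 0" "(LINT x|\<mu>. Im (w x) * u x) = 0" if u: "continuous_on UNIV u" for u
  proof -
    have i: "integrable \<mu> (\<lambda>x. cnj (w x) * complex_of_real (u x))" by (rule L2_integrable_mult[OF wL L2_continuous[OF u]])
    have z: "(CLINT x|\<mu>. cnj (w x) * complex_of_real (u x)) = 0" using zero[OF u] by (simp add: l2_inner_def)
    show "(LINT x|\<mu>. Re (w x) * u x) = 0" using integral_Re[OF i] z by simp
    show "(LINT x|\<mu>. Im (w x) * u x) = 0" using integral_Im[OF i] z by simp
  qed
  have "AE x in \<mu>. Re (w x) = 0" "AE x in \<mu>. Im (w x) = 0"
    using AE_zero_if_continuous_integrals_zero[OF P.compact_space finite_measure_axioms \<mu>_prob(2) integrable_Re[OF w_int] parts(1)]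
      AE_zero_if_continuous_integrals_zero[OF P.compact_space finite_measure_axioms \<mu>_prob(2) integrable_Im[OF w_int] parts(2)]
    by auto
  then show ?thesis unfolding w_def[symmetric] by eventually_elim (simp add: complex_eq_iff)
qed

theorem purely_ac: "purely_ac_spectrum_on \<mu> gen (- {0})"
  unfolding purely_ac_spectrum_on_def
proof (intro allI impI ballI)
  fix E h assume res: "spectral_resolution \<mu> gen E" and h: "h \<in> L2 \<mu>"
  interpret koopman_resolution \<mu> \<phi> E
    using res by unfold_locales (auto simp: spectral_resolution_def)
  show "absolutely_continuous lborel (density (spec h) (indicator (- {0})))"
    unfolding absolutely_continuous_def
  proof
    fix N :: "real set" assume N: "N \<in> null_sets lborel"
    then have Nb [measurable]: "N \<in> sets borel" by auto
    have N': "N - {0} \<in> null_sets lborel" using N by (intro null_sets_subset[OF N]) auto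
    have "AE x in \<mu>. E (N - {0}) h x = 0" using E_null_set_zero_everywhere[OF res N' _ h] by simp
    then have "l2_norm \<mu> (E (N - {0}) h) = l2_norm \<mu> (\<lambda>x. 0)"
      using L2_E[of "N - {0}" h] h by (intro l2_norm_cong_AE) (auto simp: L2_zero)
    then have z: "emeasure (spec h) (N - {0}) = 0" using h by (simp add: emeasure_spec l2_norm_def)
    have "emeasure (density (spec h) (indicator (- {0}))) N = (\<integral>\<^sup>+t. indicator (- {0}) t * indicator N t \<partial>spec h)"
      by (rule emeasure_density[OF borel_measurable_spec]) auto
    also have "\<dots> = (\<integral>\<^sup>+t. indicator (N - {0}) t \<partial>spec h)"
      by (intro nn_integral_cong) (auto simp: indicator_def)
    also have "\<dots> = 0" using z by simp
    finally show "N \<in> null_sets (density (spec h) (indicator (- {0})))" by (simp add: null_sets_def)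
  qed
qed

text \<open>A measurable invariant \<open>v\<close> may be unbounded and of any sign. The injective
  transform \<open>2 + arctan v\<close> is bounded and, as \<open>\<pi> / 2 < 2\<close>, bounded
  below by a positive constant, so it can be normalised to the density of an invariant
  probability.\<close>

lemma invariant_AE_constant:
  fixes v :: "'a \<Rightarrow> real"
  assumes vm: "v \<in> borel_measurable \<mu>" and inv: "\<And>s. AE x in \<mu>. v (\<phi> s x) = v x"
  shows "\<exists>c. AE x in \<mu>. v x = c"
proof -
  define w where "w x = 2 + arctan (v x)" for x
  have w: "0 < w x" "w x < 4" for x
    using arctan_bounded[of "v x"] pi_less_4 pi_gt_zero unfolding w_def by linarith+
  have wm [measurable]: "w \<in> borel_measurable \<mu>"
    unfolding w_def[abs_def] using vm by (intro borel_measurable_add borel_measurable_const borel_measurable_continuous_on[OF _ vm]) (auto intro!: continuous_intros)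
  have wi: "integrable \<mu> w" by (rule integrable_const_bound[where B = 4]) (use w in \<open>auto intro: less_imp_le simp: abs_of_pos\<close>)
  define c where "c = (LINT x|\<mu>. w x)"
  have "c \<ge> (LINT x|\<mu>. 2 - pi / 2)"
    unfolding c_def using wi arctan_lbound by (intro integral_mono) (auto simp: w_def intro: less_imp_le)
  then have c: "c > 0" using pi_less_4 by (simp add: prob_space)
  define D where "D x = ennreal (w x / c)" for x
  have Dm [measurable]: "D \<in> borel_measurable \<mu>" unfolding D_def[abs_def] by measurable
  define \<nu> where "\<nu> = density \<mu> D"
  have "invariant_probability \<phi> \<nu>"
    unfolding invariant_probability_def
  proof (intro conjI allI)
    show "prob_space \<nu>"
    proof (rule prob_spaceI)
      have "emeasure \<nu> (space \<nu>) = (\<integral>\<^sup>+x. D x \<partial>\<mu>)"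
        unfolding \<nu>_def by (simp add: emeasure_density cong: nn_integral_cong)
      also have "\<dots> = ennreal (LINT x|\<mu>. w x / c)"
        unfolding D_def using wi w(1) c by (intro nn_integral_eq_integral) (auto intro!: AE_I2 divide_nonneg_pos intro: less_imp_le)
      also have "\<dots> = 1" using c by (simp add: c_def[symmetric])
      finally show "emeasure \<nu> (space \<nu>) = 1" .
    qed
    show "sets \<nu> = sets borel" by (simp add: \<nu>_def \<mu>_prob)
    fix s
    show "distr \<nu> borel (\<phi> s) = \<nu>"
    proof (rule measure_eqI)
      fix B assume "B \<in> sets (distr \<nu> borel (\<phi> s))"
      then have B [measurable]: "B \<in> sets \<mu>" by (simp add: \<mu>_prob)
      have m: "\<phi> s \<in> measurable \<nu> borel" using measurable_flow[of s] by (simp add: \<nu>_def \<mu>_prob cong: measurable_cong_sets)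
      have sp: "space \<mu> = UNIV" using sets_eq_imp_space_eq[OF \<mu>_prob(2)] by simp
      have pre: "\<phi> s -` B \<in> sets \<mu>" using measurable_sets[OF measurable_flow B, of s] by (simp add: sp)
      have "emeasure (distr \<nu> borel (\<phi> s)) B = emeasure \<nu> (\<phi> s -` B)"
        using B m by (subst emeasure_distr) (auto simp: \<mu>_prob \<nu>_def sp)
      also have "\<dots> = (\<integral>\<^sup>+x. D x * indicator (\<phi> s -` B) x \<partial>\<mu>)"
        unfolding \<nu>_def using pre by (rule emeasure_density[OF Dm])
      \<comment> \<open>Invariance of \<open>v\<close> holds off a null set that may depend on
        \<open>s\<close>; with \<open>s\<close> fixed, this suffices under the integral.\<close>
      also have "\<dots> = (\<integral>\<^sup>+x. D (\<phi> s x) * indicator B (\<phi> s x) \<partial>\<mu>)"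
        using inv[of s] by (intro nn_integral_cong_AE) (auto simp: D_def w_def indicator_def)
      also have "\<dots> = (\<integral>\<^sup>+x. D x * indicator B x \<partial>distr \<mu> \<mu> (\<phi> s))"
        by (rule nn_integral_distr[symmetric]) measurable
      also have "\<dots> = emeasure \<nu> B" unfolding \<nu>_def distr_flow using B by (intro emeasure_density[symmetric] Dm)
      finally show "emeasure (distr \<nu> borel (\<phi> s)) B = emeasure \<nu> B" .
    qed (simp add: \<nu>_def \<mu>_prob)
  qed
  then have "\<nu> = \<mu>" using ergodic by (simp add: unique_invariant_probability_def)
  then have "density \<mu> D = density \<mu> (\<lambda>_. 1)" by (simp add: \<nu>_def density_1)
  then have "AE x in \<mu>. D x = 1" by (subst (asm) density_unique_iff) auto
  then have "AE x in \<mu>. v x = tan (c - 2)"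
  proof eventually_elim
    case (elim x)
    then have "w x / c = 1" unfolding D_def by (simp add: ennreal_eq_1)
    then have "arctan (v x) = c - 2" using c by (simp add: w_def)
    then show ?case by (metis tan_arctan)
  qed
  then show ?thesis by blast
qed

text \<open>For \<open>\<psi>\<close> in the kernel every function
  \<open>s \<mapsto> <v, U_s \<psi>>\<close> has derivative zero, so \<open>\<psi>\<close> is
  invariant almost everywhere at each time and its real and imaginary parts are constant.\<close>

theorem eigenspace_0: "eigenspace \<mu> gen 0 = {\<psi> \<in> L2 \<mu>. \<exists>a. AE x in \<mu>. \<psi> x = a}"
proof (intro set_eqI iffI)
  fix \<psi> assume "\<psi> \<in> eigenspace \<mu> gen 0"
  then have L: "\<psi> \<in> L2 \<mu>" and ker: "(\<psi>, \<lambda>x. 0 * \<psi> x) \<in> gen" by (auto simp: eigenspace_def)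
  have inv: "AE x in \<mu>. \<psi> (\<phi> s x) = \<psi> x" for s
  proof -
    have "AE x in \<mu>. \<psi> (\<phi> s x) - \<psi> x = 0"
    proof (rule AE_zero_if_l2_inner_zero)
      show "(\<lambda>x. \<psi> (\<phi> s x) - \<psi> x) \<in> L2 \<mu>" by (intro L2_diff L2_flow L)
      fix v assume v: "v \<in> L2 \<mu>"
      let ?W = "\<lambda>s. l2_inner \<mu> v (\<lambda>x. \<psi> (\<phi> s x))"
      have "(?W has_vector_derivative 0) (at t)" for t
        using inner_flow_derivative[OF ker v, of t] by (simp add: l2_inner_def)
      then have "(?W has_derivative (\<lambda>h. 0)) (at t within UNIV)" for t by (simp add: has_vector_derivative_def)
      then obtain C where C: "\<And>t. ?W t = C" using has_derivative_zero_constant[of UNIV ?W] by auto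
      have "?W s = ?W 0" by (simp only: C)
      then show "l2_inner \<mu> v (\<lambda>x. \<psi> (\<phi> s x) - \<psi> x) = 0"
        using v L by (simp add: l2_inner_diff_right L2_flow flow_0)
    qed
    then show ?thesis by eventually_elim simp
  qed
  have m: "\<psi> \<in> borel_measurable \<mu>" using L by (rule L2_measurable)
  have "AE x in \<mu>. Re (\<psi> (\<phi> s x)) = Re (\<psi> x)" "AE x in \<mu>. Im (\<psi> (\<phi> s x)) = Im (\<psi> x)" for s
    using inv[of s] by (eventually_elim, simp)+
  then have "\<exists>c. AE x in \<mu>. Re (\<psi> x) = c" "\<exists>c. AE x in \<mu>. Im (\<psi> x) = c"
    using m by (intro invariant_AE_constant; simp)+
  then obtain p q where "AE x in \<mu>. Re (\<psi> x) = p" "AE x in \<mu>. Im (\<psi> x) = q" by blast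
  then have "AE x in \<mu>. \<psi> x = Complex p q" by eventually_elim (simp add: complex_eq_iff)
  then show "\<psi> \<in> {\<psi> \<in> L2 \<mu>. \<exists>a. AE x in \<mu>. \<psi> x = a}" using L by blast
next
  fix \<psi> assume "\<psi> \<in> {\<psi> \<in> L2 \<mu>. \<exists>a. AE x in \<mu>. \<psi> x = a}"
  then obtain c where L: "\<psi> \<in> L2 \<mu>" and c: "AE x in \<mu>. \<psi> x = c" by blast
  \<comment> \<open>Invariance of \<open>\<mu>\<close> carries the null set where
    \<open>\<psi>\<close> differs from \<open>c\<close> back along the flow.\<close>
  have "AE x in distr \<mu> \<mu> (\<phi> s). \<psi> x = c" for s using c by (simp only: distr_flow)
  then have c': "AE x in \<mu>. \<psi> (\<phi> s x) = c" for s
    by (rule AE_distrD[OF measurable_flow])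
  have "l2_norm \<mu> (\<lambda>x. \<i> / complex_of_real s * (\<psi> (\<phi> s x) - \<psi> x) - 0 * \<psi> x) = l2_norm \<mu> (\<lambda>x. 0)" for s
  proof (rule l2_norm_cong_AE)
    show "AE x in \<mu>. \<i> / complex_of_real s * (\<psi> (\<phi> s x) - \<psi> x) - 0 * \<psi> x = 0"
      using c c'[of s] by eventually_elim simp
    show "(\<lambda>x. \<i> / complex_of_real s * (\<psi> (\<phi> s x) - \<psi> x) - 0 * \<psi> x) \<in> L2 \<mu>"
      by (intro L2_diff L2_scale L2_flow L)
  qed (rule L2_zero)
  then have "((\<lambda>s. l2_norm \<mu> (\<lambda>x. \<i> / complex_of_real s * (\<psi> (\<phi> s x) - \<psi> x) - 0 * \<psi> x)) \<longlongrightarrow> 0) (at 0)"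
    by (simp only: l2_norm_def) simp
  then show "\<psi> \<in> eigenspace \<mu> gen 0"
    using L L2_scale[OF L, of 0] by (simp add: eigenspace_def koopman_generator_def)
qed

end

section \<open>Differentiation along flows in charts\<close>

lemma atlas_chart:
  assumes "smooth_atlas A" "c \<in> A"
  shows "open (fst c)" "open (snd c ` fst c)" "continuous_on (fst c) (snd c)" "inj_on (snd c) (fst c)"
proof -
  have c: "topological_chart c" using assms by (auto simp: smooth_atlas_def)
  then show "open (fst c)" "open (snd c ` fst c)" by (auto simp: topological_chart_def)
  obtain k where "homeomorphism (fst c) (snd c ` fst c) (snd c) k" using c by (auto simp: topological_chart_def)
  then show "continuous_on (fst c) (snd c)" "inj_on (snd c) (fst c)"
    by (auto simp: homeomorphism_def intro: inj_on_inverseI)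
qed

lemma chart_covering: "smooth_atlas A \<Longrightarrow> \<exists>c\<in>A. x \<in> fst c"
  unfolding smooth_atlas_def by blast

lemma chart_inv_chart:
  assumes "smooth_atlas A" "c \<in> A" "x \<in> fst c"
  shows "chart_inv c (snd c x) = x"
  using atlas_chart(4)[OF assms(1,2)] assms(3) by (rule inv_into_f_f)

lemma continuous_on_UNIV_if_charts:
  assumes A: "smooth_atlas A" and g: "\<And>c. c \<in> A \<Longrightarrow> continuous_on (fst c) g"
  shows "continuous_on UNIV g"
proof -
  have "continuous_on (\<Union>c\<in>A. fst c) g"
    by (rule continuous_on_open_Union) (use atlas_chart(1)[OF A] g in auto)
  then show ?thesis using A by (simp add: smooth_atlas_def)
qed

text \<open>\<open>Ck_on\<close> provides continuity of \<open>D y v\<close> for a fixed direction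
  \<open>v\<close>. Expanding \<open>w y\<close> in the standard basis allows the direction to vary
  with \<open>y\<close>.\<close>

lemma continuous_on_derivative_apply:
  fixes D :: "'b::topological_space \<Rightarrow> 'e::euclidean_space \<Rightarrow> real"
  assumes lin: "\<And>y. y \<in> S \<Longrightarrow> linear (D y)" and D: "\<And>v. continuous_on S (\<lambda>y. D y v)" and w: "continuous_on S w"
  shows "continuous_on S (\<lambda>y. D y (w y))"
proof -
  have "continuous_on S (\<lambda>y. \<Sum>b\<in>Basis. (w y \<bullet> b) * D y b)" by (intro continuous_intros D w)
  moreover have "D y (w y) = (\<Sum>b\<in>Basis. (w y \<bullet> b) * D y b)" if "y \<in> S" for y
  proof -
    interpret linear "D y" using lin[OF that] .
    have "D y (w y) = D y (\<Sum>b\<in>Basis. (w y \<bullet> b) *\<^sub>R b)" by (simp add: euclidean_representation)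
    also have "\<dots> = (\<Sum>b\<in>Basis. (w y \<bullet> b) *\<^sub>R D y b)" by (simp add: sum scale)
    finally show ?thesis by simp
  qed
  ultimately show ?thesis by (simp cong: continuous_on_cong)
qed

text \<open>In a chart the derivative along the flow is the differential of \<open>g\<close> applied
  to the vector field, and both depend continuously on the point.\<close>

lemma C1_map_along_flow:
  fixes A :: "('a::topological_space, 'e::euclidean_space) chart set" and g :: "'a \<Rightarrow> real"
  assumes A: "smooth_atlas A" and f: "continuous_flow f" and g: "C1_map A std_atlas g"
    and X: "vector_field_of A f X" "C1_vector_field A X"
  obtains g' where "C1_along f g g'"
proof -
  have g_cont: "continuous_on UNIV g" using g by (simp add: regular_map_def)
  have f0: "f 0 x = x" for x using f by (simp add: continuous_flow_def is_flow_def)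
  have "\<exists>D. (\<forall>y\<in>snd c ` fst c. ((g \<circ> chart_inv c) has_derivative D y) (at y)) \<and> (\<forall>v. continuous_on (snd c ` fst c) (\<lambda>y. D y v))"
    if "c \<in> A" for c
    using g that by (simp add: regular_map_def std_atlas_def)
  then obtain D where D: "\<And>c y. c \<in> A \<Longrightarrow> y \<in> snd c ` fst c \<Longrightarrow> ((g \<circ> chart_inv c) has_derivative D c y) (at y)"
    "\<And>c v. c \<in> A \<Longrightarrow> continuous_on (snd c ` fst c) (\<lambda>y. D c y v)"
    by metis
  have deriv: "((\<lambda>t. g (f t x)) has_real_derivative D c (snd c x) (X c x)) (at 0)" if c: "c \<in> A" "x \<in> fst c" for c x
  proof -
    have "((\<lambda>t. snd c (f t x)) has_derivative (\<lambda>h. h *\<^sub>R X c x)) (at 0)"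
      using X(1) c by (simp add: vector_field_of_def has_vector_derivative_def)
    moreover have "((g \<circ> chart_inv c) has_derivative D c (snd c x)) (at (snd c (f 0 x)))"
      using D(1)[OF c(1), of "snd c x"] c(2) by (simp add: f0)
    ultimately have "((\<lambda>t. (g \<circ> chart_inv c) (snd c (f t x))) has_derivative (\<lambda>h. D c (snd c x) (h *\<^sub>R X c x))) (at 0)"
      by (rule has_derivative_compose)
    moreover have "linear (D c (snd c x))" using D(1)[OF c(1), of "snd c x"] c(2) by (auto dest: has_derivative_linear)
    ultimately have d: "((\<lambda>t. (g \<circ> chart_inv c) (snd c (f t x))) has_derivative (\<lambda>h. h * D c (snd c x) (X c x))) (at 0)"
      by (simp add: linear_cmul)
    have "continuous_on UNIV (\<lambda>t. f t x)"
    proof -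
      have "continuous_on UNIV (\<lambda>(t, x). f t x)" using f by (simp add: continuous_flow_def)
      from continuous_on_compose2[OF this continuous_on_Pair[OF continuous_on_id continuous_on_const[of _ x]]]
      show ?thesis by simp
    qed
    then have "open ((\<lambda>t. f t x) -` fst c)" using atlas_chart(1)[OF A c(1)] by (rule open_vimage[rotated])
    \<comment> \<open>The orbit stays in the chart domain for small times, so the coordinate
      representative computes \<open>g\<close> along it.\<close>
    then have "\<forall>\<^sub>F t in nhds 0. t \<in> (\<lambda>t. f t x) -` fst c" using c(2) by (intro eventually_nhds_in_open) (auto simp: f0)
    then have "\<forall>\<^sub>F t in nhds 0. (g \<circ> chart_inv c) (snd c (f t x)) = g (f t x)"
      by eventually_elim (simp add: chart_inv_chart[OF A c(1)])
    moreover have "((\<lambda>t. (g \<circ> chart_inv c) (snd c (f t x))) has_real_derivative D c (snd c x) (X c x)) (at 0)"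
      using d unfolding has_field_derivative_def mult_commute_abs .
    ultimately show ?thesis by (subst (asm) DERIV_cong_ev[OF refl _ refl]) auto
  qed
  \<comment> \<open>Defined through \<open>deriv\<close>, without reference to a chart, so that the
    coordinate formulas agree on overlaps.\<close>
  define g' where "g' x = deriv (\<lambda>t. g (f t x)) 0" for x
  have g': "g' x = D c (snd c x) (X c x)" if "c \<in> A" "x \<in> fst c" for c x
    unfolding g'_def using deriv[OF that] by (rule DERIV_imp_deriv)
  have "continuous_on UNIV g'"
  proof (rule continuous_on_UNIV_if_charts[OF A])
    fix c assume c: "c \<in> A"
    let ?U = "snd c ` fst c"
    have "continuous_on ?U (\<lambda>y. X c (chart_inv c y))"
    proof -
      have "Ck_on 1 ?U (\<lambda>y. X c (chart_inv c y))" using X(2) c unfolding C1_vector_field_def by blast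
      from this[unfolded One_nat_def Ck_on.simps]
      obtain D' where D': "\<forall>y\<in>?U. ((\<lambda>y. X c (chart_inv c y)) has_derivative D' y) (at y)" by (elim exE conjE)
      show ?thesis
        by (intro continuous_at_imp_continuous_on ballI has_derivative_continuous[OF bspec[OF D']])
    qed
    from continuous_on_derivative_apply[where D = "D c", OF has_derivative_linear[OF D(1)[OF c]] D(2)[OF c] this]
    have "continuous_on ?U (\<lambda>y. D c y (X c (chart_inv c y)))" .
    from continuous_on_compose2[OF this atlas_chart(3)[OF A c] subset_refl]
    have "continuous_on (fst c) (\<lambda>x. D c (snd c x) (X c (chart_inv c (snd c x))))" .
    then show "continuous_on (fst c) g'"
      by (rule continuous_on_eq) (simp add: chart_inv_chart[OF A c] g'[OF c])
  qed
  moreover have "((\<lambda>t. g (f t x)) has_real_derivative g' x) (at 0)" for x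
    using chart_covering[OF A, of x] deriv g' by metis
  ultimately have "C1_along f g g'" using g_cont by (simp add: C1_along_def)
  then show thesis by (rule that)
qed

text \<open>In a product chart the derivative in \<open>s\<close> is the differential applied to the
  direction \<open>(0, 1)\<close>.\<close>

lemma C1_reparametrisation_derivative:
  fixes A :: "('a::topological_space, 'e::euclidean_space) chart set"
  assumes A: "smooth_atlas A" and \<tau>: "C1_map (prod_atlas A std_atlas) std_atlas (\<lambda>(x, s). \<tau> x s :: real)"
  shows "(\<tau> x has_real_derivative deriv (\<tau> x) s) (at s)" "continuous_on UNIV (\<lambda>x. deriv (\<tau> x) 0)"
    "continuous_on UNIV (\<lambda>x. \<tau> x s)"
proof -
  have c: "continuous_on UNIV (\<lambda>(x, s). \<tau> x s)" using \<tau> by (simp add: regular_map_def)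
  show "continuous_on UNIV (\<lambda>x. \<tau> x s)"
    using continuous_on_compose2[OF c continuous_on_Pair[OF continuous_on_id continuous_on_const[of _ s]]] by simp
  let ?ch = "\<lambda>c. (fst c \<times> (UNIV :: real set), map_prod (snd c) (id :: real \<Rightarrow> real))"
  let ?h = "\<lambda>c. (\<lambda>(x, s). \<tau> x s) \<circ> chart_inv (?ch c)"
  have "\<exists>D. (\<forall>y\<in>map_prod (snd c) id ` (fst c \<times> UNIV). (?h c has_derivative D y) (at y)) \<and>
      (\<forall>v. continuous_on (map_prod (snd c) id ` (fst c \<times> UNIV)) (\<lambda>y. D y v))" if "c \<in> A" for c
  proof -
    have "?ch c \<in> prod_atlas A std_atlas" using that by (force simp: prod_atlas_def std_atlas_def)
    then have "Ck_on 1 (snd (?ch c) ` (fst (?ch c) \<inter> (\<lambda>(x, s). \<tau> x s) -` UNIV)) (id \<circ> (\<lambda>(x, s). \<tau> x s) \<circ> chart_inv (?ch c))"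
      using \<tau> unfolding regular_map_def std_atlas_def by (metis fst_conv insertI1 snd_conv)
    then show ?thesis by simp
  qed
  then obtain D where D: "\<And>c y. c \<in> A \<Longrightarrow> y \<in> map_prod (snd c) id ` (fst c \<times> UNIV) \<Longrightarrow> (?h c has_derivative D c y) (at y)"
    "\<And>c v. c \<in> A \<Longrightarrow> continuous_on (map_prod (snd c) id ` (fst c \<times> UNIV)) (\<lambda>y. D c y v)"
    by metis
  have h: "?h c (snd c x, s) = \<tau> x s" if "c \<in> A" "x \<in> fst c" for c x s
  proof -
    have "inj_on (map_prod (snd c) (id :: real \<Rightarrow> real)) (fst c \<times> UNIV)"
      using atlas_chart(4)[OF A that(1)] by (auto simp: inj_on_def)
    from inv_into_f_f[OF this, of "(x, s)"] that(2) show ?thesis by simp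
  qed
  have deriv: "(\<tau> x has_real_derivative D c (snd c x, s) (0, 1)) (at s)" if "c \<in> A" "x \<in> fst c" for c x s
  proof -
    have "((\<lambda>s::real. (snd c x, s)) has_derivative (\<lambda>h. (0, h))) (at s)"
      by (auto intro!: derivative_eq_intros)
    moreover have hd: "(?h c has_derivative D c (snd c x, s)) (at (snd c x, s))"
      using that by (intro D(1)) force+
    ultimately have "((\<lambda>s. ?h c (snd c x, s)) has_derivative (\<lambda>r. D c (snd c x, s) (0, r))) (at s)"
      by (rule has_derivative_compose)
    moreover have "(\<lambda>s. ?h c (snd c x, s)) = \<tau> x" by (rule ext) (rule h[OF that])
    moreover have "(\<lambda>r. D c (snd c x, s) (0, r)) = (*) (D c (snd c x, s) (0, 1))"
    proof
      show "D c (snd c x, s) (0, r) = D c (snd c x, s) (0, 1) * r" for r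
        using linear_cmul[OF has_derivative_linear[OF hd], of r "(0, 1)"] by simp
    qed
    ultimately show ?thesis by (simp only: has_field_derivative_def)
  qed
  have d: "deriv (\<tau> x) s = D c (snd c x, s) (0, 1)" if "c \<in> A" "x \<in> fst c" for c x s
    using deriv[OF that] by (rule DERIV_imp_deriv)
  show "(\<tau> x has_real_derivative deriv (\<tau> x) s) (at s)" using chart_covering[OF A, of x] deriv d by metis
  show "continuous_on UNIV (\<lambda>x. deriv (\<tau> x) 0)"
  proof (rule continuous_on_UNIV_if_charts[OF A])
    fix c assume cA: "c \<in> A"
    have "continuous_on (fst c) (\<lambda>x. (snd c x, 0::real))" by (intro continuous_intros atlas_chart(3)[OF A cA])
    moreover have "(\<lambda>x. (snd c x, 0::real)) ` fst c \<subseteq> map_prod (snd c) id ` (fst c \<times> UNIV)"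
    proof (rule image_subsetI)
      fix x assume "x \<in> fst c"
      then show "(snd c x, 0::real) \<in> map_prod (snd c) id ` (fst c \<times> UNIV)" by (intro image_eqI[of _ _ "(x, 0)"]) auto
    qed
    ultimately have "continuous_on (fst c) (\<lambda>x. D c (snd c x, 0) (0, 1))"
      by (rule continuous_on_compose2[OF D(2)[OF cA]])
    then show "continuous_on (fst c) (\<lambda>x. deriv (\<tau> x) 0)"
      by (rule continuous_on_eq) (simp add: d[OF cA])
  qed
qed

theorem theorem3p8:
  fixes A :: "('a::metric_space, 'e::euclidean_space) chart set"
    and g :: "('a, 'e) metric_tensor"
    and \<epsilon> :: real
    and f \<phi> \<phi>' :: "real \<Rightarrow> 'a \<Rightarrow> 'a"
    and \<mu> :: "'a measure"
    and sstar D2_sstar u :: "real \<Rightarrow> real \<Rightarrow> 'a \<Rightarrow> real"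
    and \<tau> :: "'a \<Rightarrow> real \<Rightarrow> real"
    and \<rho> Xf_\<rho> :: "'a \<Rightarrow> real"
    and X_f X_\<phi> :: "('a, 'e) chart \<Rightarrow> 'a \<Rightarrow> 'e"
  assumes manifold: "compact_connected_riemannian_manifold A g"
    and eps: "0 < \<epsilon>" "\<epsilon> \<le> 1"
    and anosov: "codimension_one_anosov_flow A \<epsilon> f"
    and Wu_flow: "minimal_Wu_flow f \<phi>"
    and uniquely_ergodic: "unique_invariant_probability \<phi> \<mu>"
    and expanding: "uniformly_expanding_parametrisation f \<phi> \<phi>'"
    and sstar: "\<And>t s x. f t (\<phi> s x) = \<phi> (sstar t s x) (f t x)"
    and hyp1_flow: "C1_flow A \<phi>"
    and hyp1_reparam: "C1_reparametrisation A \<phi> \<phi>' \<tau>"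
    and rho: "\<And>x. \<rho> x = 1 / deriv (\<tau> x) 0"
    and hyp2_d2: "\<And>t s x. ((\<lambda>s. sstar t s x) has_real_derivative D2_sstar t s x) (at s)"
    and hyp2_d1d2: "\<And>t s x. ((\<lambda>t. D2_sstar t s x) has_real_derivative u t s x) (at t)"
    and hyp2_cont: "continuous_on UNIV (\<lambda>(t, s, x). u t s x)"
    and X_f: "vector_field_of A f X_f"
    and X_phi: "vector_field_of A \<phi> X_\<phi>"
    and hyp3_fields: "C1_vector_field A X_f" "C1_vector_field A X_\<phi>"
    and Xf_rho: "\<And>x. ((\<lambda>t. \<rho> (f t x)) has_real_derivative Xf_\<rho> x) (at 0)"
    and hyp3_cont: "continuous_on UNIV Xf_\<rho>"
    and hyp3_C1: "C1_map A std_atlas (\<lambda>x. inverse (\<rho> x) * Xf_\<rho> x)"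
  shows "purely_ac_spectrum_on \<mu> (koopman_generator \<mu> \<phi>) (- {0}) \<and>
         eigenspace \<mu> (koopman_generator \<mu> \<phi>) 0 = {\<psi> \<in> L2 \<mu>. \<exists>a. AE x in \<mu>. \<psi> x = a}"
proof -
  have compact: "compact (UNIV :: 'a set)" and A: "smooth_atlas A"
    using manifold by (auto simp: compact_connected_riemannian_manifold_def)
  have cf: "continuous_flow f"
    using anosov by (auto simp: codimension_one_anosov_flow_def anosov_flow_def regular_map_def continuous_flow_def)
  have c\<phi>: "continuous_flow \<phi>" using Wu_flow by (simp add: minimal_Wu_flow_def)
  have c\<phi>': "continuous_flow \<phi>'" using expanding by (simp add: uniformly_expanding_parametrisation_def)
  obtain l where l: "l > 1" "\<And>s t x. f t (\<phi>' s x) = \<phi>' (l powr t * s) (f t x)"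
    using expanding by (auto simp: uniformly_expanding_parametrisation_def)
  have \<tau>C1: "C1_map (prod_atlas A std_atlas) std_atlas (\<lambda>(x, s). \<tau> x s)"
    and \<tau>rep: "reparametrisation \<phi> \<phi>' \<tau>" and \<tau>pos: "deriv (\<tau> x) 0 > 0" for x
    using hyp1_reparam by (auto simp: C1_reparametrisation_def)
  note \<tau>d = C1_reparametrisation_derivative[OF A \<tau>C1]
  have inv\<rho>: "1 / \<rho> x = deriv (\<tau> x) 0" "\<rho> x > 0" for x using \<tau>pos[of x] by (simp_all add: rho)
  \<comment> \<open>The cocycle identity moves the derivative at time 0 and base point
    \<open>\<phi> s x\<close> to the derivative at time \<open>s\<close> and base point
    \<open>x\<close>.\<close>
  have \<tau>_deriv: "(\<tau> x has_real_derivative 1 / \<rho> (\<phi> s x)) (at s)" for x s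
  proof -
    have "(\<tau> (\<phi> s x) has_real_derivative 1 / \<rho> (\<phi> s x)) (at 0)" using \<tau>d(1)[of "\<phi> s x" 0] by (simp add: inv\<rho>)
    then have "((\<lambda>t. \<tau> x s + \<tau> (\<phi> s x) t) has_real_derivative 1 / \<rho> (\<phi> s x)) (at 0)"
      using DERIV_add[OF DERIV_const[of "\<tau> x s"]] by fastforce
    moreover have "\<tau> x s + \<tau> (\<phi> s x) t = \<tau> x (t + s)" for t
      using \<tau>rep by (simp add: reparametrisation_def add.commute[of t s])
    ultimately show ?thesis using DERIV_shift[of "\<tau> x" "1 / \<rho> (\<phi> s x)" 0 s] by simp
  qed
  have \<rho>_cont: "continuous_on UNIV \<rho>"
  proof -
    have "continuous_on UNIV (\<lambda>x. 1 / deriv (\<tau> x) 0)" using \<tau>pos by (intro continuous_intros \<tau>d(2)) (auto simp: less_imp_neq[symmetric])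
    moreover have "\<rho> = (\<lambda>x. 1 / deriv (\<tau> x) 0)" using rho by (rule ext)
    ultimately show ?thesis by simp
  qed
  have G_eq: "inverse (\<rho> x) * Xf_\<rho> x = Xf_\<rho> x / \<rho> x" for x by (simp add: divide_inverse mult.commute)
  obtain XG VG where XG: "C1_along f (\<lambda>x. inverse (\<rho> x) * Xf_\<rho> x) XG" "C1_along \<phi> (\<lambda>x. inverse (\<rho> x) * Xf_\<rho> x) VG"
    using C1_map_along_flow[OF A cf hyp3_C1 X_f hyp3_fields(1)] C1_map_along_flow[OF A c\<phi> hyp3_C1 X_phi hyp3_fields(2)] by metis
  \<comment> \<open>\<open>G\<close> differs from the function of the third hypothesis by the
    constant \<open>ln l\<close>, which leaves derivatives unchanged.\<close>
  have shift: "C1_along F (\<lambda>x. ln l + p x) p'" if "C1_along F p p'" for F :: "real \<Rightarrow> 'a \<Rightarrow> 'a" and p p'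
    using that unfolding C1_along_def by (auto intro!: continuous_intros derivative_eq_intros)
  interpret expanding_time_change f \<phi> \<phi>' "ln l" \<tau> \<rho> Xf_\<rho> XG VG \<mu>
  proof (unfold_locales)
    show "compact (UNIV :: 'a set)" "continuous_flow f" "continuous_flow \<phi>" "continuous_flow \<phi>'" by fact+
    show "0 < ln l" using l by simp
    show "f t (\<phi>' s x) = \<phi>' (exp (ln l * t) * s) (f t x)" for t s x
      using l by (simp add: powr_def mult.commute)
    show "\<phi> s x = \<phi>' (\<tau> x s) x" "\<tau> x 0 = 0" "strict_mono (\<tau> x)" for s x
      using \<tau>rep unfolding reparametrisation_def by blast+
    show "(\<tau> x has_real_derivative 1 / \<rho> (\<phi> s x)) (at s)" for x s by (rule \<tau>_deriv)
    show "continuous_on UNIV (\<lambda>x. \<tau> x s)" for s by (rule \<tau>d(3))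
    show "\<rho> x > 0" for x by (rule inv\<rho>)
    show "C1_along f \<rho> Xf_\<rho>" using \<rho>_cont hyp3_cont Xf_rho by (simp add: C1_along_def)
    show "C1_along f (\<lambda>x. ln l + Xf_\<rho> x / \<rho> x) XG" "C1_along \<phi> (\<lambda>x. ln l + Xf_\<rho> x / \<rho> x) VG"
      using shift[OF XG(1)] shift[OF XG(2)] by (simp_all add: G_eq)
    show "unique_invariant_probability \<phi> \<mu>" by fact
  qed
  show ?thesis using purely_ac eigenspace_0 by blast
qed

end
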